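(* Let $q\ge5$ be a prime power with $q\not\equiv0\pmod3$. If $q\equiv1\pmod3$: $\Lambda_{\mathrm{E}\Gamma,3_{\mathcal C}}=q-4$, $\Lambda_{\mathrm{E}\Gamma,\overline{1_{\mathcal C}}}=q$, $\Lambda_{\mathrm{E}\Gamma,0_{\mathcal C}}=q-1$; $\Pi_{3_{\mathcal C},\mathrm{E}\Gamma}=(q-4)/6$, $\Pi_{\overline{1_{\mathcal C}},\mathrm{E}\Gamma}=q/2$, $\Pi_{0_{\mathcal C},\mathrm{E}\Gamma}=(q-1)/3$; $\Lambda_{\mathrm{En}\Gamma,3_{\mathcal C}}=q^2-3q+4$, $\Lambda_{\mathrm{En}\Gamma,\overline{1_{\mathcal C}}}=q^2-q-2$, $\Lambda_{\mathrm{En}\Gamma,0_{\mathcal C}}=q^2+1$; $\Pi_{3_{\mathcal C},\mathrm{En}\Gamma}=\frac{q^2-3q+4}{6(q-1)}$, $\Pi_{\overline{1_{\mathcal C}},\mathrm{En}\Gamma}=\frac{q^2-q-2}{2(q-1)}$, $\Pi_{0_{\mathcal C},\mathrm{En}\Gamma}=\frac{q^2+1}{3(q-1)}$. If $q\equiv-1\pmod3$: $\Lambda_{\mathrm{E}\Gamma,3_{\mathcal C}}=\Lambda_{\mathrm{E}\Gamma,\overline{1_{\mathcal C}}}=q-2$, $\Lambda_{\mathrm{E}\Gamma,0_{\mathcal C}}=q+1$; $\Pi_{3_{\mathcal C},\mathrm{E}\Gamma}=(q-2)/6$, $\Pi_{\overline{1_{\mathcal C}},\mathrm{E}\Gamma}=(q-2)/2$,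 $\Pi_{0_{\mathcal C},\mathrm{E}\Gamma}=(q+1)/3$; $\Lambda_{\mathrm{En}\Gamma,3_{\mathcal C}}=(q-1)(q-2)$, $\Lambda_{\mathrm{En}\Gamma,\overline{1_{\mathcal C}}}=q^2-q$, $\Lambda_{\mathrm{En}\Gamma,0_{\mathcal C}}=q^2-1$; $\Pi_{3_{\mathcal C},\mathrm{En}\Gamma}=(q-2)/6$, $\Pi_{\overline{1_{\mathcal C}},\mathrm{En}\Gamma}=q/2$, $\Pi_{0_{\mathcal C},\mathrm{En}\Gamma}=(q+1)/3$.
   Context: Let $\mathrm{PG}(3,q)$ have points $\mathbf{P}(x_0,x_1,x_2,x_3)$; put $P(t)=\mathbf{P}(t^3,t^2,t,1)$ ($t\in\mathbb{F}_q$), $P(\infty)=\mathbf{P}(1,0,0,0)$, $\mathcal{C}=\{P(t):t\in\mathbb{F}_q\cup\{\infty\}\}$ the twisted cubic, $G_q$ the group of projectivities fixing $\mathcal C$. Write $\boldsymbol{\pi}(c_0,c_1,c_2,c_3)$ for the plane $c_0x_0+c_1x_1+c_2x_2+c_3x_3=0$. $\Gamma$-planes: the osculating planes $\boldsymbol{\pi}(1,-3t,3t^2,-t^3)$ ($t\in\mathbb{F}_q$) and $\boldsymbol{\pi}(0,0,0,1)$. A $d_{\mathcal C}$-plane ($d\in\{0,3\}$) contains exactly $d$ points of $\mathcal C$; a $\overline{1_{\mathcal C}}$-plane is a non-$\Gamma$-plane containing exactly one point of $\mathcal C$ (each type is a $G_q$-orbit for $q\ge5$). An external line contains no point of $\mathcal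 C$. A real axis is the intersection of two distinct $\Gamma$-planes; an imaginary axis is the line of $\mathrm{PG}(3,q)$ which is the intersection of $\boldsymbol{\pi}(1,-3s,3s^2,-s^3)$ and $\boldsymbol{\pi}(1,-3s^q,3s^{2q},-s^{3q})$, $s\in\mathbb{F}_{q^2}\setminus\mathbb{F}_q$; an imaginary chord is the line joining $P(s),P(s^q)$, $s\in\mathbb{F}_{q^2}\setminus\mathbb{F}_q$. An E$\Gamma$-line is an external line lying in a $\Gamma$-plane which is not a real axis; an En$\Gamma$-line is an external line lying in no $\Gamma$-plane which is neither an imaginary chord nor an imaginary axis. Notation: $\Lambda_{\lambda,\pi}$ is the number of $\lambda$-lines in a $\pi$-plane; $\Pi_{\pi,\lambda}$ is the average, over all $\lambda$-lines, of the number of $\pi$-planes through the line. *)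

theory Defs
  imports
    "HOL-Analysis.Cartesian_Space"
    "HOL-Algebra.Algebraic_Closure_Type"
    "HOL-Computational_Algebra.Primes"
    "HOL-Number_Theory.Cong"
begin

text \<open>
  The field of order \<open>q\<close> is a type \<open>'a :: finite_field\<close> with \<open>CARD('a) = q\<close>; its quadratic extension
  is taken inside the library's algebraic closure \<open>'a alg_closure\<close>, with embedding \<^const>\<open>to_ac\<close>.
  Points, lines and planes of the projective space are the vector subspaces of \<open>'a^4\<close> of dimension
  1, 2 and 3, and incidence is inclusion. The coordinates \<open>x0, x1, x2, x3\<close> are the components
  \<open>x $ 1, x $ 2, x $ 3, x $ 4\<close>.
\<close>

definition proj_lines :: "('a::field ^ 4) set set" where
  "proj_lines = {L. vec.subspace L \<and> vec.dim L = 2}"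

definition proj_planes :: "('a::field ^ 4) set set" where
  "proj_planes = {H. vec.subspace H \<and> vec.dim H = 3}"

definition proj_point :: "'a::field ^ 4 \<Rightarrow> ('a ^ 4) set" where
  "proj_point x = vec.span {x}"

definition plane_of :: "'a::field ^ 4 \<Rightarrow> ('a ^ 4) set" where
  "plane_of c = {x. (\<Sum>i\<in>UNIV. c $ i * x $ i) = 0}"

text \<open>Both coordinate vectors are also used over the algebraic closure.\<close>

definition cubic_vec :: "'a::field \<Rightarrow> 'a ^ 4" where
  "cubic_vec t = vector [t ^ 3, t ^ 2, t, 1]"

definition osc_vec :: "'a::field \<Rightarrow> 'a ^ 4" where
  "osc_vec t = vector [1, - (3 * t), 3 * t ^ 2, - (t ^ 3)]"

definition twisted_cubic :: "('a::field ^ 4) set set" where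
  "twisted_cubic = insert (proj_point (vector [1, 0, 0, 0])) (range (\<lambda>t. proj_point (cubic_vec t)))"

definition Gamma_planes :: "('a::field ^ 4) set set" where
  "Gamma_planes = insert (plane_of (vector [0, 0, 0, 1])) (range (\<lambda>t. plane_of (osc_vec t)))"


definition C_planes :: "nat \<Rightarrow> ('a::finite_field ^ 4) set set" where
  "C_planes d = {H \<in> proj_planes. card {P \<in> twisted_cubic. P \<subseteq> H} = d}"

definition one_bar_planes :: "('a::finite_field ^ 4) set set" where
  "one_bar_planes = C_planes 1 - Gamma_planes"


text \<open>The elements of the quadratic extension that do not lie in the base field.\<close>

definition quad_nonbase :: "'a::finite_field alg_closure set" where
  "quad_nonbase = {s. s ^ (CARD('a) ^ 2) = s} - range to_ac"

definition vec_to_ac :: "'a::field ^ 4 \<Rightarrow> 'a alg_closure ^ 4" where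
  "vec_to_ac x = (\<chi> i. to_ac (x $ i))"

definition external_lines :: "('a::field ^ 4) set set" where
  "external_lines = {L \<in> proj_lines. \<forall>P \<in> twisted_cubic. \<not> P \<subseteq> L}"

definition real_axes :: "('a::field ^ 4) set set" where
  "real_axes = {G \<inter> H | G H. G \<in> Gamma_planes \<and> H \<in> Gamma_planes \<and> G \<noteq> H}"

text \<open>
  Imaginary axes and chords are lines over the base field: the preimages under \<^const>\<open>vec_to_ac\<close> of
  lines defined by two conjugate planes, respectively by two conjugate points.
\<close>

definition imaginary_axes :: "('a::finite_field ^ 4) set set" where
  "imaginary_axes = {L \<in> proj_lines. \<exists>s \<in> quad_nonbase.
     L = vec_to_ac -` (plane_of (osc_vec s) \<inter> plane_of (osc_vec (s ^ CARD('a))))}"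

definition imaginary_chords :: "('a::finite_field ^ 4) set set" where
  "imaginary_chords = {L \<in> proj_lines. \<exists>s \<in> quad_nonbase.
     L = vec_to_ac -` vec.span {cubic_vec s, cubic_vec (s ^ CARD('a))}}"

definition EG_lines :: "('a::field ^ 4) set set" where
  "EG_lines = {L \<in> external_lines. (\<exists>H \<in> Gamma_planes. L \<subseteq> H) \<and> L \<notin> real_axes}"

definition EnG_lines :: "('a::finite_field ^ 4) set set" where
  "EnG_lines = {L \<in> external_lines. (\<forall>H \<in> Gamma_planes. \<not> L \<subseteq> H) \<and>
     L \<notin> imaginary_chords \<and> L \<notin> imaginary_axes}"


text \<open>
  \<open>Lambda_eq \<L> \<H> k\<close> says that the number of lines from \<open>\<L>\<close> in a plane from \<open>\<H>\<close> does not depend on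
  the plane and equals \<open>k\<close>; nonemptiness of \<open>\<H>\<close> makes \<open>k\<close> unique. An integer \<open>k\<close> avoids truncated
  subtraction.
\<close>

definition Lambda_eq :: "('a::field ^ 4) set set \<Rightarrow> ('a ^ 4) set set \<Rightarrow> int \<Rightarrow> bool" where
  "Lambda_eq \<L> \<H> k \<longleftrightarrow> \<H> \<noteq> {} \<and> (\<forall>H \<in> \<H>. int (card {L \<in> \<L>. L \<subseteq> H}) = k)"

text \<open>The average number of planes from \<open>\<H>\<close> through a line from \<open>\<L>\<close>.\<close>

definition Pi_avg :: "('a::field ^ 4) set set \<Rightarrow> ('a ^ 4) set set \<Rightarrow> real" where
  "Pi_avg \<H> \<L> = (\<Sum>L \<in> \<L>. real (card {H \<in> \<H>. L \<subseteq> H})) / real (card \<L>)"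

end

theory Submission
  imports Defs
begin

text \<open>
  A plane is the same thing as a binary cubic form up to scalars; its points on the cubic are the
  roots of the form, while the \<open>\<Gamma>\<close>-planes are the cubes of linear forms. The Hessian of a form that is not
  a cube is, up to scalars, the unique quadratic form apolar to it. If the Hessian has two roots in the
  field, the form is a combination of two cubes and the plane contains exactly one real axis; if it has
  a double root, so has the cubic form; if it has no root, the plane contains exactly one imaginary
  axis. In the first case the number of roots is the number of cube roots of a nonzero scalar, that is,
  0 or 3 if \<open>q \<equiv> 1\<close> and 1 if \<open>q \<equiv> - 1\<close> modulo 3. Comparing cardinalities shows that these inclusions
  between types of planes are equalities. Imaginary chords in a plane correspond to irreducible
  quadratic factors of its form. The numbers of E\<open>\<Gamma>\<close>- and En\<open>\<Gamma>\<close>-lines in a plane follow by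
  inclusion and exclusion, and the averages by double counting.
\<close>

section \<open>Counting subspaces\<close>

text \<open>The obstacle is a plane whose Hessian has no root in the field: its form is a
  combination of two cubes only over the quadratic extension, so its roots are not counted directly.
  Instead, the numbers of planes with 0, 1, 2 and 3 points are found independently, from incidences
  with points, pairs and triples of the cubic. For \<open>q mod 3 = 1\<close> the planes through a
  real axis number (q^3 - q)/2 = (q^3 - q)/3 + (q^3 - q)/6, for \<open>q mod 3 = 2\<close> the same
  number is that of \<open>one_bar_planes\<close>, and the tangents account for the q^2 + q planes
  with two points. The planes through imaginary axes are what remains. Characteristic 2 is included.
  Quadratics are therefore sorted by whether they have a root in \<open>P1\<close> and not by a
  discriminant, and the distinctness of imaginary chords and axes has a separate argument there. The
  extension field enters only through the trace \<open>a\<close> and the norm \<open>b\<close> of a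
  conjugate pair: imaginary axes and chords receive equations over the base field, and the rest
  takes place there.\<close>

lemma card_span_insert:
  fixes x :: "'a::finite_field ^ 'n"
  assumes "x \<notin> vec.span S"
  shows "card (vec.span (insert x S)) = CARD('a) * card (vec.span S)"
proof -
  have "vec.span (insert x S) = (\<lambda>(k, y). k *s x + y) ` (UNIV \<times> vec.span S)"
  proof (intro equalityI subsetI)
    fix z assume "z \<in> vec.span (insert x S)"
    then obtain k where "z - k *s x \<in> vec.span S"
      unfolding vec.span_insert by blast
    then show "z \<in> (\<lambda>(k, y). k *s x + y) ` (UNIV \<times> vec.span S)"
      by (intro image_eqI[where x = "(k, z - k *s x)"]) auto
  next
    fix z assume "z \<in> (\<lambda>(k, y). k *s x + y) ` (UNIV \<times> vec.span S)"
    then obtain k y where "y \<in> vec.span S" "z = k *s x + y"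
      by auto
    then have "z - k *s x \<in> vec.span S"
      by simp
    then show "z \<in> vec.span (insert x S)"
      unfolding vec.span_insert by blast
  qed
  moreover have "inj_on (\<lambda>(k, y). k *s x + y) (UNIV \<times> vec.span S)"
  proof (rule inj_onI, clarify)
    fix k y k' y'
    assume *: "y \<in> vec.span S" "y' \<in> vec.span S" "k *s x + y = k' *s x + y'"
    then have "(k - k') *s x = y' - y"
      by (simp add: vec.scale_left_diff_distrib algebra_simps)
    then have "(k - k') *s x \<in> vec.span S"
      using * by (simp add: vec.span_diff)
    then have "inverse (k - k') *s ((k - k') *s x) \<in> vec.span S"
      by (rule vec.span_scale)
    then have "k = k'"
      using assms by (cases "k = k'") simp_all
    then show "k = k' \<and> y = y'"
      using * by simp
  qed
  ultimately show ?thesis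
    by (simp add: card_image card_cartesian_product)
qed

lemma card_subspace:
  fixes S :: "('a::finite_field ^ 'n) set"
  assumes "vec.subspace S"
  shows "card S = CARD('a) ^ vec.dim S"
proof -
  have *: "card (vec.span B) = CARD('a) ^ card B" if "finite B" "vec.independent B"
    for B :: "('a ^ 'n) set"
    using that
  proof (induction B rule: finite_induct)
    case (insert x B)
    then have "x \<notin> vec.span B"
      by (auto simp: vec.independent_insert)
    then show ?case
      using insert by (simp add: card_span_insert vec.independent_insert)
  qed simp
  obtain B where "B \<subseteq> S" "vec.independent B" "S \<subseteq> vec.span B" "card B = vec.dim S"
    using vec.basis_exists by blast
  moreover from this have "vec.span B = S"
    using assms by (simp add: vec.span_minimal subset_antisym)
  ultimately show ?thesis
    using *[of B] vec.finiteI_independent by metis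
qed

text \<open>One notion for lines through a point (in a plane or in the whole space) and planes
  through a line, so that a single count serves all of them.\<close>

definition up_covers :: "('a::field ^ 'n) set \<Rightarrow> ('a ^ 'n) set \<Rightarrow> ('a ^ 'n) set set" where
  "up_covers W Y = {U. vec.subspace U \<and> W \<subseteq> U \<and> U \<subseteq> Y \<and> vec.dim U = Suc (vec.dim W)}"

lemma cover_eq_span_insert:
  fixes W :: "('a::field ^ 'n) set"
  assumes "vec.subspace W" "U \<in> up_covers W Y" "x \<in> U - W"
  shows "U = vec.span (insert x W)"
proof (rule sym, rule vec.subspace_dim_equal)
  have "x \<notin> vec.span W"
    using assms by (simp add: vec.span_eq_iff[THEN iffD2])
  then show "vec.dim U \<le> vec.dim (vec.span (insert x W))"
    using assms unfolding up_covers_def vec.dim_span vec.dim_insert by auto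
  show "vec.span (insert x W) \<subseteq> U"
    using assms by (intro vec.span_minimal) (auto simp: up_covers_def)
qed (use assms in \<open>auto simp: up_covers_def\<close>)

lemma span_insert_cover:
  fixes W :: "('a::field ^ 'n) set"
  assumes "vec.subspace W" "vec.subspace Y" "W \<subseteq> Y" "x \<in> Y - W"
  shows "vec.span (insert x W) \<in> up_covers W Y"
proof -
  have "vec.span W = W"
    using assms(1) by simp
  then show ?thesis
    using assms unfolding up_covers_def
    by (auto simp: vec.dim_insert intro: vec.span_base dest!: subsetD[OF vec.span_minimal, rotated 2])
qed

text \<open>The sets \<open>U - W\<close> for the covers \<open>U\<close> partition
  \<open>Y - W\<close>, since a cover is spanned by \<open>W\<close> and any one of its other
  vectors.\<close>

lemma card_up_covers:
  fixes W Y :: "('a::finite_field ^ 'n) set"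
  assumes "vec.subspace W" "vec.subspace Y" "W \<subseteq> Y"
  shows "card (up_covers W Y) * (CARD('a) ^ Suc (vec.dim W) - CARD('a) ^ vec.dim W)
           = CARD('a) ^ vec.dim Y - CARD('a) ^ vec.dim W"
proof -
  have "Y - W = (\<Union>U\<in>up_covers W Y. U - W)"
  proof (intro equalityI subsetI)
    fix x assume "x \<in> Y - W"
    then show "x \<in> (\<Union>U\<in>up_covers W Y. U - W)"
      using span_insert_cover[OF assms] vec.span_base[of x "insert x W"] by blast
  qed (auto simp: up_covers_def)
  then have "card (Y - W) = card (\<Union>U\<in>up_covers W Y. U - W)"
    by simp
  also have "\<dots> = (\<Sum>U\<in>up_covers W Y. card (U - W))"
  proof (rule card_UN_disjoint)
    show "\<forall>U\<in>up_covers W Y. \<forall>U'\<in>up_covers W Y. U \<noteq> U' \<longrightarrow> (U - W) \<inter> (U' - W) = {}"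
      using cover_eq_span_insert[OF assms(1)] by (metis disjoint_iff)
  qed auto
  also have "\<dots> = (\<Sum>U\<in>up_covers W Y. CARD('a) ^ Suc (vec.dim W) - CARD('a) ^ vec.dim W)"
    using assms(1) by (intro sum.cong)
      (auto simp: up_covers_def card_Diff_subset finite_subset card_subspace)
  finally show ?thesis
    using assms by (simp add: card_Diff_subset finite_subset card_subspace)
qed

lemma sum_card_swap:
  assumes "finite A" "finite B"
  shows "(\<Sum>a\<in>A. card {b \<in> B. R a b}) = (\<Sum>b\<in>B. card {a \<in> A. R a b})"
  using sum.swap_restrict[OF assms, of "\<lambda>_ _. 1 :: nat" R] by simp

lemma finite_field_card_ge_2: "CARD('a::finite_field) \<ge> 2"
proof -
  have "card {0, 1 :: 'a} \<le> CARD('a)"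
    by (intro card_mono) auto
  then show ?thesis
    by simp
qed

lemma mult_cancel_right_nat: "m * k = n * k \<Longrightarrow> k > 0 \<Longrightarrow> m = (n::nat)"
  by simp

lemma card_lines_through_in_plane:
  fixes x :: "'a::finite_field ^ 4"
  assumes "H \<in> proj_planes" "x \<in> H" "x \<noteq> 0"
  shows "card {L \<in> proj_lines. x \<in> L \<and> L \<subseteq> H} = CARD('a) + 1"
proof -
  let ?q = "CARD('a)"
  have "{L \<in> proj_lines. x \<in> L \<and> L \<subseteq> H} = up_covers (vec.span {x}) H"
    using assms unfolding proj_lines_def up_covers_def
    by (auto simp: vec.dim_span intro: vec.span_base dest: vec.span_minimal[of "{x}", rotated])
  moreover have "card (up_covers (vec.span {x}) H) * (?q ^ 2 - ?q) = ?q ^ 3 - ?q"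
    using card_up_covers[of "vec.span {x}" H] assms
    by (auto simp: proj_planes_def vec.span_minimal vec.dim_span power2_eq_square)
  moreover have "?q ^ 3 - ?q = (?q + 1) * (?q ^ 2 - ?q)"
    by (simp add: power2_eq_square power3_eq_cube algebra_simps)
  moreover have "?q ^ 2 - ?q > 0"
    using finite_field_card_ge_2[where 'a = 'a] by (simp add: power2_eq_square)
  ultimately show ?thesis
    by (metis mult_cancel_right_nat)
qed

lemma card_lines_through:
  fixes x :: "'a::finite_field ^ 4"
  assumes "x \<noteq> 0"
  shows "card {L \<in> proj_lines. x \<in> L} = CARD('a) ^ 2 + CARD('a) + 1"
proof -
  let ?q = "CARD('a)"
  have "{L \<in> proj_lines. x \<in> L} = up_covers (vec.span {x}) UNIV"
    using assms unfolding proj_lines_def up_covers_def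
    by (auto simp: vec.dim_span intro: vec.span_base dest: vec.span_minimal[of "{x}", rotated])
  moreover have "card (up_covers (vec.span {x}) UNIV) * (?q ^ 2 - ?q) = ?q ^ 4 - ?q"
    using card_up_covers[of "vec.span {x}" UNIV] assms
    by (auto simp: vec.dim_span card_cart_basis power2_eq_square)
  moreover have "?q ^ 4 - ?q = (?q ^ 2 + ?q + 1) * (?q ^ 2 - ?q)"
    by (simp add: power2_eq_square power4_eq_xxxx algebra_simps)
  moreover have "?q ^ 2 - ?q > 0"
    using finite_field_card_ge_2[where 'a = 'a] by (simp add: power2_eq_square)
  ultimately show ?thesis
    by (metis mult_cancel_right_nat)
qed

lemma card_planes_through_line:
  fixes L :: "('a::finite_field ^ 4) set"
  assumes "L \<in> proj_lines"
  shows "card {H \<in> proj_planes. L \<subseteq> H} = CARD('a) + 1"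
proof -
  let ?q = "CARD('a)"
  have "{H \<in> proj_planes. L \<subseteq> H} = up_covers L UNIV"
    using assms unfolding proj_lines_def proj_planes_def up_covers_def by auto
  moreover have "card (up_covers L UNIV) * (?q ^ 3 - ?q ^ 2) = ?q ^ 4 - ?q ^ 2"
    using card_up_covers[of L UNIV] assms
    by (auto simp: proj_lines_def card_cart_basis power2_eq_square power3_eq_cube mult.assoc)
  moreover have "?q ^ 4 - ?q ^ 2 = (?q + 1) * (?q ^ 3 - ?q ^ 2)"
    by (simp add: power2_eq_square power3_eq_cube power4_eq_xxxx algebra_simps)
  moreover have "?q ^ 3 - ?q ^ 2 > 0"
    using finite_field_card_ge_2[where 'a = 'a] by (simp add: power2_eq_square power3_eq_cube)
  ultimately show ?thesis
    by (metis mult_cancel_right_nat)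
qed

text \<open>Double counting of incident line-plane pairs through the point: both sides have degree q
  + 1, so there are as many planes as lines.\<close>

lemma card_planes_through_point:
  fixes x :: "'a::finite_field ^ 4"
  assumes "x \<noteq> 0"
  shows "card {H \<in> proj_planes. x \<in> H} = CARD('a) ^ 2 + CARD('a) + 1"
proof -
  let ?q = "CARD('a)" and ?\<L> = "{L \<in> proj_lines. x \<in> L}" and ?\<H> = "{H \<in> proj_planes. x \<in> H}"
  have "(\<Sum>L\<in>?\<L>. card {H \<in> ?\<H>. L \<subseteq> H}) = (\<Sum>H\<in>?\<H>. card {L \<in> ?\<L>. L \<subseteq> H})"
    by (rule sum_card_swap) auto
  moreover have "(\<Sum>L\<in>?\<L>. card {H \<in> ?\<H>. L \<subseteq> H}) = (\<Sum>L\<in>?\<L>. ?q + 1)"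
  proof (rule sum.cong)
    fix L assume "L \<in> ?\<L>"
    then have "{H \<in> ?\<H>. L \<subseteq> H} = {H \<in> proj_planes. L \<subseteq> H}"
      by auto
    then show "card {H \<in> ?\<H>. L \<subseteq> H} = ?q + 1"
      using card_planes_through_line \<open>L \<in> ?\<L>\<close> by auto
  qed simp
  moreover have "(\<Sum>H\<in>?\<H>. card {L \<in> ?\<L>. L \<subseteq> H}) = (\<Sum>H\<in>?\<H>. ?q + 1)"
    using card_lines_through_in_plane[OF _ _ assms] by (intro sum.cong) (auto simp: conj_assoc)
  ultimately have "card ?\<L> * (?q + 1) = card ?\<H> * (?q + 1)"
    by simp
  then have "card ?\<L> = card ?\<H>"
    by (rule mult_cancel_right_nat) simp
  then show ?thesis
    using card_lines_through[OF assms] by simp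
qed

text \<open>Double counting of pairs of a nonzero vector and a line containing it; a line has q^2 -
  1 nonzero vectors, the plane q^3 - 1.\<close>

lemma card_lines_in_plane:
  fixes H :: "('a::finite_field ^ 4) set"
  assumes "H \<in> proj_planes"
  shows "card {L \<in> proj_lines. L \<subseteq> H} = CARD('a) ^ 2 + CARD('a) + 1"
proof -
  let ?q = "CARD('a)" and ?\<L> = "{L \<in> proj_lines. L \<subseteq> H}"
  have H: "vec.subspace H" "card H = ?q ^ 3" "0 \<in> H"
    using assms by (auto simp: proj_planes_def card_subspace vec.subspace_0)
  have "(\<Sum>L\<in>?\<L>. card {x \<in> H - {0}. x \<in> L}) = (\<Sum>x\<in>H - {0}. card {L \<in> ?\<L>. x \<in> L})"
    by (rule sum_card_swap) auto
  moreover have "(\<Sum>L\<in>?\<L>. card {x \<in> H - {0}. x \<in> L}) = (\<Sum>L\<in>?\<L>. ?q ^ 2 - 1)"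
  proof (rule sum.cong)
    fix L assume L: "L \<in> ?\<L>"
    then have "{x \<in> H - {0}. x \<in> L} = L - {0}"
      by auto
    then show "card {x \<in> H - {0}. x \<in> L} = ?q ^ 2 - 1"
      using L by (simp add: proj_lines_def card_subspace vec.subspace_0)
  qed simp
  moreover have "(\<Sum>x\<in>H - {0}. card {L \<in> ?\<L>. x \<in> L}) = (\<Sum>x\<in>H - {0}. ?q + 1)"
  proof (rule sum.cong)
    fix x assume "x \<in> H - {0}"
    moreover have "{L \<in> ?\<L>. x \<in> L} = {L \<in> proj_lines. x \<in> L \<and> L \<subseteq> H}"
      by auto
    ultimately show "card {L \<in> ?\<L>. x \<in> L} = ?q + 1"
      using card_lines_through_in_plane[OF assms] by auto
  qed simp
  ultimately have "card ?\<L> * (?q ^ 2 - 1) = (?q ^ 3 - 1) * (?q + 1)"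
    using H by simp
  also have "\<dots> = (?q ^ 2 + ?q + 1) * (?q ^ 2 - 1)"
  proof -
    have "int ((?q ^ 3 - 1) * (?q + 1)) = int ((?q ^ 2 + ?q + 1) * (?q ^ 2 - 1))"
      by (simp add: of_nat_diff Suc_leI) (simp add: algebra_simps power2_eq_square power3_eq_cube)
    then show ?thesis
      by (simp only: of_nat_eq_iff)
  qed
  finally show ?thesis
    by (rule mult_cancel_right_nat)
      (use finite_field_card_ge_2[where 'a = 'a] one_less_power[of ?q 2] in simp)
qed

lemma card_proj_planes:
  "card (proj_planes :: ('a::finite_field ^ 4) set set) = CARD('a) ^ 3 + CARD('a) ^ 2 + CARD('a) + 1"
proof -
  let ?q = "CARD('a)" and ?\<H> = "proj_planes :: ('a ^ 4) set set"
  have "(\<Sum>H\<in>?\<H>. card {x \<in> UNIV - {0}. x \<in> H}) = (\<Sum>x\<in>UNIV - {0}. card {H \<in> ?\<H>. x \<in> H})"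
    by (rule sum_card_swap) auto
  moreover have "(\<Sum>H\<in>?\<H>. card {x \<in> UNIV - {0}. x \<in> H}) = (\<Sum>H\<in>?\<H>. ?q ^ 3 - 1)"
  proof (rule sum.cong)
    fix H :: "('a ^ 4) set" assume H: "H \<in> ?\<H>"
    have "{x \<in> UNIV - {0}. x \<in> H} = H - {0}"
      by auto
    then show "card {x \<in> UNIV - {0}. x \<in> H} = ?q ^ 3 - 1"
      using H by (simp add: proj_planes_def card_subspace vec.subspace_0)
  qed simp
  moreover have "(\<Sum>x\<in>UNIV - {0 :: 'a ^ 4}. card {H \<in> ?\<H>. x \<in> H})
      = (\<Sum>x\<in>UNIV - {0 :: 'a ^ 4}. ?q ^ 2 + ?q + 1)"
    using card_planes_through_point by (intro sum.cong) auto
  moreover have "card (UNIV - {0 :: 'a ^ 4}) = ?q ^ 4 - 1"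
    by (simp add: card_Diff_subset)
  ultimately have "card ?\<H> * (?q ^ 3 - 1) = (?q ^ 4 - 1) * (?q ^ 2 + ?q + 1)"
    by simp
  also have "\<dots> = (?q ^ 3 + ?q ^ 2 + ?q + 1) * (?q ^ 3 - 1)"
  proof -
    have "int ((?q ^ 4 - 1) * (?q ^ 2 + ?q + 1)) = int ((?q ^ 3 + ?q ^ 2 + ?q + 1) * (?q ^ 3 - 1))"
      by (simp add: of_nat_diff Suc_leI)
        (simp add: algebra_simps power2_eq_square power3_eq_cube power4_eq_xxxx)
    then show ?thesis
      by (simp only: of_nat_eq_iff)
  qed
  finally show ?thesis
    by (rule mult_cancel_right_nat)
      (use finite_field_card_ge_2[where 'a = 'a] one_less_power[of ?q 3] in simp)
qed

lemma proj_line_eqI: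
  fixes L L' :: "('a::field ^ 4) set"
  assumes "L \<in> proj_lines" "L' \<in> proj_lines" "{x, y} \<subseteq> L" "{x, y} \<subseteq> L'" "x \<noteq> 0" "y \<notin> vec.span {x}"
  shows "L = L'"
proof -
  have "U = vec.span (insert y (vec.span {x}))" if "U \<in> proj_lines" "{x, y} \<subseteq> U" for U
    using that assms vec.span_minimal[of "{x}" U]
    by (intro cover_eq_span_insert[of _ _ UNIV]) (auto simp: up_covers_def proj_lines_def vec.dim_span)
  then show ?thesis
    using assms by metis
qed

lemma proj_plane_eqI:
  fixes H H' :: "('a::field ^ 4) set"
  assumes "H \<in> proj_planes" "H' \<in> proj_planes" "L \<in> proj_lines" "L \<subseteq> H" "L \<subseteq> H'"
    and "x \<in> H" "x \<in> H'" "x \<notin> L"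
  shows "H = H'"
proof -
  have "U = vec.span (insert x L)" if "U \<in> proj_planes" "L \<subseteq> U" "x \<in> U" for U
    using that assms
    by (intro cover_eq_span_insert[of _ _ UNIV]) (auto simp: up_covers_def proj_lines_def proj_planes_def)
  then show ?thesis
    using assms by metis
qed

lemma plane_inter_line:
  fixes H H' :: "('a::field ^ 4) set"
  assumes "H \<in> proj_planes" "H' \<in> proj_planes" "H \<noteq> H'"
  shows "H \<inter> H' \<in> proj_lines"
proof -
  have sub: "vec.subspace (H \<inter> H')"
    using assms by (simp add: proj_planes_def vec.subspace_inter)
  have "vec.dim {x + y |x y. x \<in> H \<and> y \<in> H'} + vec.dim (H \<inter> H') = 6"
    using assms by (simp add: vec.dim_sums_Int proj_planes_def)
  moreover have "vec.dim {x + y |x y. x \<in> H \<and> y \<in> H'} \<le> 4"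
    using dim_subset_UNIV_cart_gen[of "{x + y |x y. x \<in> H \<and> y \<in> H'}"] by simp
  moreover have "vec.dim (H \<inter> H') \<noteq> 3"
  proof
    assume *: "vec.dim (H \<inter> H') = 3"
    have "H \<inter> H' = H" "H \<inter> H' = H'"
      using assms sub * by (simp_all add: vec.subspace_dim_equal proj_planes_def)
    then show False
      using assms by simp
  qed
  moreover have "vec.dim (H \<inter> H') \<le> 3"
    using assms vec.dim_subset[of "H \<inter> H'" H] by (simp add: proj_planes_def)
  ultimately show ?thesis
    using sub by (simp add: proj_lines_def)
qed

section \<open>Planes and binary cubic forms\<close>

unbundle no Formal_Power_Series.fps_syntax

lemma vector_4 [simp]:
  "(vector [x, y, z, w] :: 'a::zero ^ 4) $ 1 = x"
  "(vector [x, y, z, w] :: 'a::zero ^ 4) $ 2 = y"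
  "(vector [x, y, z, w] :: 'a::zero ^ 4) $ 3 = z"
  "(vector [x, y, z, w] :: 'a::zero ^ 4) $ 4 = w"
  unfolding vector_def by simp_all

lemma vec4_eq_iff:
  "x = y \<longleftrightarrow> x $ 1 = y $ 1 \<and> x $ 2 = y $ 2 \<and> x $ 3 = y $ 3 \<and> x $ 4 = (y :: 'a ^ 4) $ 4"
  by (simp add: vec_eq_iff forall_4)

lemma mem_plane_of:
  "x \<in> plane_of c \<longleftrightarrow> c $ 1 * x $ 1 + c $ 2 * x $ 2 + c $ 3 * x $ 3 + c $ 4 * x $ 4 = 0"
  by (simp add: plane_of_def sum_4)

lemma subspace_plane_of: "vec.subspace (plane_of c)"
  by (auto simp: vec.subspace_def plane_of_def distrib_left sum.distrib mult.left_commute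
      simp flip: sum_distrib_left)

lemma plane_of_scale: "k \<noteq> 0 \<Longrightarrow> plane_of (k *s c) = plane_of c"
  by (auto simp: plane_of_def mult.assoc simp flip: sum_distrib_left)

text \<open>A basis vector \<open>axis i 1\<close> with \<open>c $ i \<noteq> 0\<close> lies outside
  the plane and spans the space together with it.\<close>

lemma plane_of_proj_plane:
  fixes c :: "'a::field ^ 4"
  assumes "c \<noteq> 0"
  shows "plane_of c \<in> proj_planes"
proof -
  obtain i where i: "c $ i \<noteq> 0"
    using assms by (auto simp: vec_eq_iff)
  have dot_axis: "(\<Sum>j\<in>UNIV. c $ j * axis i 1 $ j) = c $ i"
    by (simp add: axis_def if_distrib cong: if_cong)
  have "x \<in> vec.span (insert (axis i 1) (plane_of c))" for x
  proof -
    define k where "k = (\<Sum>j\<in>UNIV. c $ j * x $ j) / c $ i"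
    have "(\<Sum>j\<in>UNIV. c $ j * (x - k *s axis i 1) $ j)
        = (\<Sum>j\<in>UNIV. c $ j * x $ j) - k * (\<Sum>j\<in>UNIV. c $ j * axis i 1 $ j)"
      by (simp add: right_diff_distrib sum_subtractf sum_distrib_left mult_ac)
    then have "x - k *s axis i 1 \<in> plane_of c"
      using i by (simp add: plane_of_def k_def dot_axis)
    then show ?thesis
      unfolding vec.span_insert using vec.span_base by blast
  qed
  then have "vec.span (insert (axis i 1) (plane_of c)) = UNIV"
    by auto
  moreover have "axis i 1 \<notin> vec.span (plane_of c)"
    using i dot_axis unfolding vec.span_eq_iff[THEN iffD2, OF subspace_plane_of]
    by (simp add: plane_of_def)
  ultimately have "Suc (vec.dim (plane_of c)) = 4"
    using vec.dim_insert[of "axis i 1" "plane_of c"] vec.dim_span[of "insert (axis i 1) (plane_of c)"]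
    by (simp add: card_cart_basis)
  then show ?thesis
    by (simp add: proj_planes_def subspace_plane_of)
qed

lemma proj_plane_eq_plane_of:
  fixes H :: "('a::field ^ 4) set"
  assumes "H \<in> proj_planes"
  obtains c where "c \<noteq> 0" "H = plane_of c"
proof -
  have H: "vec.subspace H" "vec.dim H = 3"
    using assms by (auto simp: proj_planes_def)
  then have "H \<noteq> UNIV"
    by (auto simp: card_cart_basis)
  then obtain e where e: "e \<notin> H"
    by auto
  obtain B where B: "B \<subseteq> H" "vec.independent B" "H \<subseteq> vec.span B" "card B = vec.dim H"
    using vec.basis_exists by blast
  then have span: "vec.span B = H"
    using H by (simp add: vec.span_minimal subset_antisym)
  then have "vec.independent (insert e B)"
    using B e by (simp add: vec.independent_insert)
  \<comment> \<open>\<open>g\<close> serves as a linear functional that vanishes on \<open>H\<close>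
    but not at \<open>e\<close>: only component 1 of its values is used.\<close>
  then obtain g :: "'a ^ 4 \<Rightarrow> 'a ^ 4" where g: "Vector_Spaces.linear (*s) (*s) g"
    "\<forall>x\<in>insert e B. g x = (if x = e then axis 1 1 else 0)"
    using vec.linear_independent_extend[of "insert e B" "\<lambda>x. if x = e then axis 1 1 else 0"] by blast
  interpret g: Vector_Spaces.linear "(*s)" "(*s)" g
    by fact
  define c :: "'a ^ 4" where "c = (\<chi> i. g (axis i 1) $ 1)"
  have dot: "(\<Sum>i\<in>UNIV. c $ i * x $ i) = g x $ 1" for x
  proof -
    have "g x = g (\<Sum>i\<in>UNIV. x $ i *s axis i 1)"
      by (simp add: basis_expansion)
    then show ?thesis
      by (simp add: g.sum g.scale c_def mult.commute)
  qed
  have "g e $ 1 = 1"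
    using g by simp
  then have "e \<notin> plane_of c"
    by (simp add: plane_of_def dot)
  then have "c \<noteq> 0"
    by (auto simp: plane_of_def)
  have "B \<subseteq> plane_of c"
    using g(2) B(1) e by (auto simp: plane_of_def dot)
  then have "H \<subseteq> plane_of c"
    using span subspace_plane_of vec.span_minimal by metis
  then have "H = plane_of c"
    using H plane_of_proj_plane[OF \<open>c \<noteq> 0\<close>]
    by (intro vec.subspace_dim_equal) (auto simp: proj_planes_def)
  then show thesis
    using that \<open>c \<noteq> 0\<close> by blast
qed

text \<open>Representatives of the points of the projective line; \<open>(1, 0)\<close> is the parameter \<open>\<infinity>\<close>.\<close>

definition P1 :: "('a::field \<times> 'a) set" where
  "P1 = insert (1, 0) (range (\<lambda>t. (t, 1)))"

definition pt :: "'a::field \<times> 'a \<Rightarrow> 'a ^ 4" where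
  "pt v = vector [fst v ^ 3, fst v ^ 2 * snd v, fst v * snd v ^ 2, snd v ^ 3]"

text \<open>The coefficients of the cube of the linear form with root \<open>v\<close>: pairing
  \<open>osc v\<close> with \<open>pt w\<close> gives \<open>bracket w v ^ 3\<close>.\<close>

definition osc :: "'a::field \<times> 'a \<Rightarrow> 'a ^ 4" where
  "osc v = vector [snd v ^ 3, - (3 * snd v ^ 2 * fst v), 3 * snd v * fst v ^ 2, - (fst v ^ 3)]"

definition osc_plane :: "'a::field \<times> 'a \<Rightarrow> ('a ^ 4) set" where
  "osc_plane v = plane_of (osc v)"

definition bracket :: "'a::field \<times> 'a \<Rightarrow> 'a \<times> 'a \<Rightarrow> 'a" where
  "bracket v w = fst v * snd w - snd v * fst w"

lemma P1_cases [consumes 1, case_names inf fin]: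
  assumes "v \<in> P1"
  obtains "v = (1, 0)" | t where "v = (t, 1)"
  using assms by (auto simp: P1_def)

lemma inf_in_P1 [simp]: "(1, 0) \<in> P1" and fin_in_P1 [simp]: "(t, 1) \<in> P1"
  by (auto simp: P1_def)

lemma card_P1: "card (P1 :: ('a::finite_field \<times> 'a) set) = CARD('a) + 1"
proof -
  have "card (range (\<lambda>t :: 'a. (t, 1 :: 'a))) = CARD('a)"
    by (rule card_image) (auto simp: inj_on_def)
  then show ?thesis
    by (auto simp: P1_def card_insert_if)
qed

lemma bracket_eq_0_iff: "v \<in> P1 \<Longrightarrow> w \<in> P1 \<Longrightarrow> bracket v w = 0 \<longleftrightarrow> v = w"
  by (auto simp: P1_def bracket_def)

lemma pt_neq_0: "v \<in> P1 \<Longrightarrow> pt v \<noteq> 0"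
  by (auto simp: P1_def pt_def vec4_eq_iff)

lemma osc_neq_0: "v \<in> P1 \<Longrightarrow> osc v \<noteq> 0"
  by (auto simp: P1_def osc_def vec4_eq_iff)

lemma pt_in_osc_plane_iff:
  assumes "v \<in> P1" "w \<in> P1"
  shows "pt w \<in> osc_plane v \<longleftrightarrow> w = v"
proof -
  have "pt w \<in> osc_plane v \<longleftrightarrow> bracket w v ^ 3 = 0"
    by (simp add: osc_plane_def mem_plane_of pt_def osc_def bracket_def power2_eq_square
        power3_eq_cube algebra_simps)
  then show ?thesis
    using assms by (simp add: bracket_eq_0_iff)
qed

text \<open>The osculating plane at \<open>v\<close> contains \<open>pt v\<close> and misses
  \<open>pt w\<close>.\<close>

lemma pt_notin_span:
  assumes "v \<in> P1" "w \<in> P1" "v \<noteq> w"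
  shows "pt w \<notin> vec.span {pt v}"
proof
  assume "pt w \<in> vec.span {pt v}"
  moreover have "vec.span {pt v} \<subseteq> osc_plane v"
    using assms pt_in_osc_plane_iff[of v v]
    by (intro vec.span_minimal) (auto simp: osc_plane_def subspace_plane_of)
  ultimately show False
    using assms by (auto simp: pt_in_osc_plane_iff)
qed

lemma proj_point_subset_iff:
  assumes "vec.subspace H"
  shows "proj_point x \<subseteq> H \<longleftrightarrow> x \<in> H"
  using assms by (auto simp: proj_point_def intro: vec.span_base dest: vec.span_minimal[of "{x}", rotated])

lemma twisted_cubic_eq: "twisted_cubic = (\<lambda>v. proj_point (pt v)) ` P1"
proof -
  have "pt (1, 0) = vector [1, 0, 0, 0 :: 'a]" "pt (t, 1) = cubic_vec t" for t :: 'a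
    by (simp_all add: pt_def cubic_vec_def)
  then show ?thesis
    by (simp add: twisted_cubic_def P1_def image_image)
qed

lemma Gamma_planes_eq: "Gamma_planes = osc_plane ` P1"
proof -
  have "osc (1, 0) = (-1) *s vector [0, 0, 0, 1 :: 'a]"
    by (simp add: osc_def vec4_eq_iff)
  then have "osc_plane (1, 0) = plane_of (vector [0, 0, 0, 1 :: 'a])"
    using plane_of_scale[of "-1 :: 'a"] by (simp add: osc_plane_def)
  moreover have "osc_plane (t, 1) = plane_of (osc_vec t)" for t :: 'a
    by (simp add: osc_plane_def osc_def osc_vec_def)
  ultimately show ?thesis
    by (simp add: Gamma_planes_def P1_def image_image)
qed

lemma osc_plane_proj_plane: "v \<in> P1 \<Longrightarrow> osc_plane v \<in> proj_planes"
  by (simp add: osc_plane_def plane_of_proj_plane osc_neq_0)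

lemma inj_on_osc_plane: "inj_on osc_plane P1"
proof (rule inj_onI)
  fix v w :: "'a \<times> 'a"
  assume "v \<in> P1" "w \<in> P1" "osc_plane v = osc_plane w"
  then show "v = w"
    using pt_in_osc_plane_iff[of v v] pt_in_osc_plane_iff[of w v] by simp
qed

text \<open>Parameters replace the points of the cubic, which are themselves sets; \<open>S\<close>
  will be a plane or a line.\<close>

definition cubic_pts :: "('a::field ^ 4) set \<Rightarrow> ('a \<times> 'a) set" where
  "cubic_pts S = {v \<in> P1. pt v \<in> S}"

lemma card_twisted_cubic_inter:
  fixes H :: "('a::field ^ 4) set"
  assumes "vec.subspace H"
  shows "card {P \<in> twisted_cubic. P \<subseteq> H} = card (cubic_pts H)"
proof -
  have "{P \<in> twisted_cubic. P \<subseteq> H} = (\<lambda>v. proj_point (pt v)) ` cubic_pts H"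
    using proj_point_subset_iff[OF assms] by (auto simp: twisted_cubic_eq cubic_pts_def)
  moreover have "inj_on (\<lambda>v. proj_point (pt v)) (cubic_pts H)"
  proof (rule inj_onI, rule ccontr)
    fix v w assume "v \<in> cubic_pts H" "w \<in> cubic_pts H" "proj_point (pt v) = proj_point (pt w)" "v \<noteq> w"
    then show False
      using pt_notin_span[of v w] vec.span_base[of "pt w" "{pt w}"]
      by (auto simp: proj_point_def cubic_pts_def)
  qed
  ultimately show ?thesis
    by (simp add: card_image)
qed

lemma C_planes_eq: "C_planes d = {H \<in> proj_planes. card (cubic_pts H) = d}"
  by (auto simp: C_planes_def proj_planes_def card_twisted_cubic_inter)

lemma external_lines_eq: "external_lines = {L \<in> proj_lines. cubic_pts L = {}}"
  by (auto simp: external_lines_def twisted_cubic_eq proj_lines_def proj_point_subset_iff cubic_pts_def)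

lemma cubic_pts_osc_plane: "v \<in> P1 \<Longrightarrow> cubic_pts (osc_plane v) = {v}"
  by (auto simp: cubic_pts_def pt_in_osc_plane_iff)

lemma mem_cubic_pts_plane_of:
  "v \<in> cubic_pts (plane_of c) \<longleftrightarrow> v \<in> P1 \<and>
     c $ 1 * fst v ^ 3 + c $ 2 * (fst v ^ 2 * snd v) + c $ 3 * (fst v * snd v ^ 2) + c $ 4 * snd v ^ 3 = 0"
  by (auto simp: cubic_pts_def mem_plane_of pt_def)

text \<open>The affine roots are those of a polynomial of degree at most 3. The root at infinity
  occurs only if the leading coefficient vanishes, and then the degree is at most 2.\<close>

lemma card_cubic_pts_plane_le_3:
  fixes H :: "('a::finite_field ^ 4) set"
  assumes "H \<in> proj_planes"
  shows "card (cubic_pts H) \<le> 3"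
proof -
  obtain c where c: "c \<noteq> 0" "H = plane_of c"
    using assms proj_plane_eq_plane_of by blast
  define p where "p = [:c $ 4, c $ 3, c $ 2, c $ 1:]"
  have p0: "p \<noteq> 0"
    using c by (auto simp: p_def vec4_eq_iff)
  define R where "R = {t. poly p t = 0}"
  have R: "card R \<le> degree p" "finite R"
    using p0 by (simp_all add: R_def card_poly_roots_bound poly_roots_finite)
  have fin: "(t, 1) \<in> cubic_pts H \<longleftrightarrow> t \<in> R" for t
    by (simp add: c mem_cubic_pts_plane_of R_def p_def power2_eq_square power3_eq_cube algebra_simps)
  have inf: "(1, 0) \<in> cubic_pts H \<longleftrightarrow> c $ 1 = 0"
    by (simp add: c mem_cubic_pts_plane_of)
  have card_fin: "card ((\<lambda>t. (t, 1 :: 'a)) ` R) = card R"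
    by (rule card_image) (auto simp: inj_on_def)
  show ?thesis
  proof (cases "c $ 1 = 0")
    case True
    have "cubic_pts H \<subseteq> insert (1, 0) ((\<lambda>t. (t, 1)) ` R)"
      using fin by (auto simp: cubic_pts_def elim!: P1_cases)
    then have "card (cubic_pts H) \<le> Suc (card R)"
      using card_mono[of "insert (1, 0) ((\<lambda>t. (t, 1)) ` R)" "cubic_pts H"] card_fin R
      by (simp add: card_insert_if split: if_splits)
    also have "degree p \<le> 2"
      using True by (simp add: p_def)
    then have "Suc (card R) \<le> 3"
      using R by linarith
    finally show ?thesis .
  next
    case False
    then have "cubic_pts H \<subseteq> (\<lambda>t. (t, 1)) ` R"
      using fin inf by (auto simp: cubic_pts_def elim!: P1_cases)
    then have "card (cubic_pts H) \<le> card R"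
      using card_fin R by (metis card_mono finite_imageI)
    also have "\<dots> \<le> 3"
      using R(1) by (rule order.trans) (simp add: p_def)
    finally show ?thesis .
  qed
qed

section \<open>Apolar quadratics and axes\<close>

text \<open>The factors 3 compensate for the binomial coefficients contained in \<open>c $ 2\<close> and \<open>c $ 3\<close>.\<close>

definition apolar :: "'a::field ^ 4 \<Rightarrow> 'a \<Rightarrow> 'a \<Rightarrow> 'a \<Rightarrow> bool" where
  "apolar c a b d \<longleftrightarrow> a * c $ 3 - b * c $ 2 + 3 * d * c $ 1 = 0 \<and> 3 * a * c $ 4 - b * c $ 3 + d * c $ 2 = 0"

text \<open>
  For \<open>a x\<^sup>2 + b x y + d y\<^sup>2\<close> with two roots this is the intersection of the osculating planes at the roots;
  the roots may be conjugate over the field, which gives the imaginary axes.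
\<close>

definition axis_line :: "'a::field \<Rightarrow> 'a \<Rightarrow> 'a \<Rightarrow> ('a ^ 4) set" where
  "axis_line a b d = vec.span {vector [3 * d, - b, a, 0], vector [0, - d, b, - (3 * a)]}"

lemma span_subset_plane_of_iff: "vec.span S \<subseteq> plane_of c \<longleftrightarrow> S \<subseteq> plane_of c"
  by (meson order.trans subspace_plane_of vec.span_minimal vec.span_superset)

text \<open>Apolarity is linear in \<open>c\<close>: its two equations say that \<open>c\<close>
  annihilates the two spanning vectors of the axis, the second one up to sign.\<close>

lemma axis_line_subset_iff: "axis_line a b d \<subseteq> plane_of c \<longleftrightarrow> apolar c a b d"
proof -
  have "axis_line a b d \<subseteq> plane_of c \<longleftrightarrow>
      vector [3 * d, - b, a, 0] \<in> plane_of c \<and> vector [0, - d, b, - (3 * a)] \<in> plane_of c"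
    by (simp add: axis_line_def span_subset_plane_of_iff)
  also have "\<dots> \<longleftrightarrow> apolar c a b d"
  proof -
    have "c $ 1 * (3 * d) + c $ 2 * - b + c $ 3 * a + c $ 4 * 0 = a * c $ 3 - b * c $ 2 + 3 * d * c $ 1"
      "c $ 1 * 0 + c $ 2 * - d + c $ 3 * b + c $ 4 * - (3 * a) = - (3 * a * c $ 4 - b * c $ 3 + d * c $ 2)"
      by (simp_all add: algebra_simps)
    then show ?thesis
      unfolding mem_plane_of apolar_def vector_4 by (metis neg_equal_0_iff_equal)
  qed
  finally show ?thesis .
qed

lemma axis_line_proj_line:
  fixes a b d :: "'a::field"
  assumes "(3 :: 'a) \<noteq> 0" "(a, b, d) \<noteq> (0, 0, 0)"
  shows "axis_line a b d \<in> proj_lines"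
proof -
  let ?x = "vector [3 * d, - b, a, 0] :: 'a ^ 4" and ?y = "vector [0, - d, b, - (3 * a)] :: 'a ^ 4"
  have "?y \<noteq> 0"
    using assms by (auto simp: vec4_eq_iff)
  moreover have "?x \<notin> vec.span {?y}"
    using assms by (auto simp: vec.span_singleton vec4_eq_iff)
  ultimately have "vec.dim {?x, ?y} = 2"
    by (simp add: vec.dim_insert)
  then show ?thesis
    by (simp add: proj_lines_def axis_line_def)
qed

definition qform :: "'a::field \<Rightarrow> 'a \<Rightarrow> 'a \<Rightarrow> 'a \<times> 'a \<Rightarrow> 'a" where
  "qform a b d v = a * fst v ^ 2 + b * fst v * snd v + d * snd v ^ 2"

lemma qform_mult: "k * qform a b d v = qform (k * a) (k * b) (k * d) v"
  by (simp add: qform_def algebra_simps)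

text \<open>For a cube both equations are \<open>3 * qform a b d v\<close> times a coordinate of
  \<open>v\<close> (up to sign), and the coordinates do not vanish together.\<close>

lemma apolar_osc_iff:
  fixes a b d :: "'a::field"
  assumes "(3 :: 'a) \<noteq> 0" "v \<in> P1"
  shows "apolar (osc v) a b d \<longleftrightarrow> qform a b d v = 0"
proof -
  have "apolar (osc v) a b d \<longleftrightarrow> 3 * (snd v * qform a b d v) = 0 \<and> 3 * (fst v * qform a b d v) = 0"
  proof -
    have "a * osc v $ 3 - b * osc v $ 2 + 3 * d * osc v $ 1 = 3 * (snd v * qform a b d v)"
      "3 * a * osc v $ 4 - b * osc v $ 3 + d * osc v $ 2 = - (3 * (fst v * qform a b d v))"
      by (simp_all add: osc_def qform_def power2_eq_square power3_eq_cube algebra_simps)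
    then show ?thesis
      unfolding apolar_def by (metis neg_equal_0_iff_equal)
  qed
  then show ?thesis
    using assms by (auto simp: P1_def)
qed

text \<open>The coefficients belong to the product of the linear forms with roots \<open>u\<close>
  and \<open>v\<close>. For \<open>u = v\<close> the line is the tangent of the cubic at
  \<open>pt v\<close>.\<close>

definition pair_axis :: "'a::field \<times> 'a \<Rightarrow> 'a \<times> 'a \<Rightarrow> ('a ^ 4) set" where
  "pair_axis u v = axis_line (snd u * snd v) (- (snd u * fst v) - fst u * snd v) (fst u * fst v)"

lemma qform_pair:
  "qform (snd u * snd v) (- (snd u * fst v) - fst u * snd v) (fst u * fst v) w = bracket w u * bracket w v"
  by (simp add: qform_def bracket_def power2_eq_square algebra_simps)

lemma pair_coeffs_neq_0:
  "u \<in> P1 \<Longrightarrow> v \<in> P1 \<Longrightarrow> (snd u * snd v, - (snd u * fst v) - fst u * snd v, fst u * fst v) \<noteq> (0, 0, 0)"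
  by (auto simp: P1_def)

lemma pair_axis_proj_line:
  fixes u v :: "'a::field \<times> 'a"
  assumes "(3 :: 'a) \<noteq> 0" "u \<in> P1" "v \<in> P1"
  shows "pair_axis u v \<in> proj_lines"
  using assms axis_line_proj_line pair_coeffs_neq_0 unfolding pair_axis_def by blast

lemma pair_axis_subset_osc_plane_iff:
  fixes u v :: "'a::field \<times> 'a"
  assumes "(3 :: 'a) \<noteq> 0" "u \<in> P1" "v \<in> P1" "w \<in> P1"
  shows "pair_axis u v \<subseteq> osc_plane w \<longleftrightarrow> w = u \<or> w = v"
  using assms
  by (simp add: pair_axis_def osc_plane_def axis_line_subset_iff apolar_osc_iff qform_pair bracket_eq_0_iff)

lemma osc_plane_inter:
  fixes u v :: "'a::field \<times> 'a"
  assumes "(3 :: 'a) \<noteq> 0" "u \<in> P1" "v \<in> P1" "u \<noteq> v"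
  shows "osc_plane u \<inter> osc_plane v = pair_axis u v"
proof -
  have "osc_plane u \<inter> osc_plane v \<in> proj_lines"
    using assms by (intro plane_inter_line osc_plane_proj_plane) (auto dest: inj_onD[OF inj_on_osc_plane])
  moreover have "pair_axis u v \<subseteq> osc_plane u \<inter> osc_plane v"
    using assms by (simp add: pair_axis_subset_osc_plane_iff)
  ultimately show ?thesis
    using pair_axis_proj_line[OF assms(1-3)]
    by (intro sym[OF vec.subspace_dim_equal]) (auto simp: proj_lines_def)
qed

lemma real_axes_eq:
  assumes "(3 :: 'a::field) \<noteq> 0"
  shows "real_axes = {pair_axis u v |u v. u \<in> P1 \<and> v \<in> P1 \<and> u \<noteq> (v :: 'a \<times> 'a)}"
proof -
  have 1: "\<exists>u v. L = pair_axis u v \<and> u \<in> P1 \<and> v \<in> P1 \<and> u \<noteq> v"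
    if L0: "L \<in> real_axes" for L :: "('a ^ 4) set"
  proof -
    obtain G H :: "('a ^ 4) set"
      where L: "L = G \<inter> H" and GH: "G \<in> Gamma_planes" "H \<in> Gamma_planes" "G \<noteq> H"
      using L0 unfolding real_axes_def by blast
    obtain u v where "u \<in> P1" "v \<in> P1" "G = osc_plane u" "H = osc_plane v"
      using GH by (auto simp: Gamma_planes_eq)
    moreover from this have "u \<noteq> v"
      using GH by blast
    ultimately show ?thesis
      using osc_plane_inter[OF assms, of u v] L by metis
  qed
  have 2: "pair_axis u v \<in> real_axes" if uv: "u \<in> P1" "v \<in> P1" "u \<noteq> v" for u v :: "'a \<times> 'a"
  proof -
    have "osc_plane u \<noteq> osc_plane v"
      using uv inj_onD[OF inj_on_osc_plane] by blast
    then show ?thesis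
      unfolding real_axes_def Gamma_planes_eq osc_plane_inter[OF assms uv, symmetric] using uv by blast
  qed
  show ?thesis
    by (intro equalityI subsetI; (elim CollectE exE conjE)?) (use 1 2 in simp_all)
qed

text \<open>\<open>hess0\<close>, \<open>hess1\<close>, \<open>hess2\<close> are the coefficients of
  the Hessian determinant of the cubic form, divided by -4 so that they make sense in characteristic
  2. Up to sign they are also the cross product of the two coefficient rows of the apolarity
  equations.\<close>

definition hess0 :: "'a::field ^ 4 \<Rightarrow> 'a" where
  "hess0 c = c $ 2 ^ 2 - 3 * c $ 1 * c $ 3"

definition hess1 :: "'a::field ^ 4 \<Rightarrow> 'a" where
  "hess1 c = c $ 2 * c $ 3 - 9 * c $ 1 * c $ 4"

definition hess2 :: "'a::field ^ 4 \<Rightarrow> 'a" where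
  "hess2 c = c $ 3 ^ 2 - 3 * c $ 2 * c $ 4"

lemma apolar_hess: "apolar c (hess0 c) (hess1 c) (hess2 c)"
  by (simp add: apolar_def hess0_def hess1_def hess2_def power2_eq_square algebra_simps)

text \<open>A solution of two linear equations is parallel to the cross product of their rows. Each
  2 by 2 minor is an explicit combination of the left-hand sides \<open>e\<close> and
  \<open>f\<close>, so the rows may also be dependent.\<close>

lemma apolar_parallel_hess:
  assumes "apolar c a b d"
  shows "a * hess1 c = b * hess0 c" "a * hess2 c = d * hess0 c" "b * hess2 c = d * hess1 c"
proof -
  define e where "e = a * c $ 3 - b * c $ 2 + 3 * d * c $ 1"
  define f where "f = 3 * a * c $ 4 - b * c $ 3 + d * c $ 2"
  have "e = 0" "f = 0"
    using assms by (simp_all add: apolar_def e_def f_def)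
  moreover have "a * hess1 c - b * hess0 c = c $ 2 * e - 3 * c $ 1 * f"
    "a * hess2 c - d * hess0 c = c $ 3 * e - c $ 2 * f"
    "b * hess2 c - d * hess1 c = 3 * c $ 4 * e - c $ 3 * f"
    unfolding hess0_def hess1_def hess2_def e_def f_def
    by (simp_all add: algebra_simps power2_eq_square)
  ultimately show "a * hess1 c = b * hess0 c" "a * hess2 c = d * hess0 c" "b * hess2 c = d * hess1 c"
    by simp_all
qed

lemma hess_zero_imp_Gamma:
  fixes c :: "'a::field ^ 4"
  assumes "(3 :: 'a) \<noteq> 0" "c \<noteq> 0" "hess0 c = 0" "hess1 c = 0" "hess2 c = 0"
  shows "plane_of c \<in> Gamma_planes"
proof (cases "c $ 1 = 0")
  case True
  then have "c $ 2 = 0"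
    using assms by (simp add: hess0_def)
  then have "c $ 3 = 0"
    using assms by (simp add: hess2_def)
  have "c = (- (c $ 4)) *s osc (1, 0)" and "- (c $ 4) \<noteq> 0"
    using \<open>c $ 1 = 0\<close> \<open>c $ 2 = 0\<close> \<open>c $ 3 = 0\<close> \<open>c \<noteq> 0\<close> by (simp_all add: osc_def vec4_eq_iff)
  then have "plane_of c = osc_plane (1, 0)"
    unfolding osc_plane_def using plane_of_scale by metis
  then show ?thesis
    by (auto simp: Gamma_planes_eq)
next
  case False
  \<comment> \<open>The only candidate for the triple root: the cube of x - t y, times
    \<open>c $ 1\<close>, has second coefficient \<open>- 3 * t * c $ 1\<close>.\<close>
  define t where "t = - (c $ 2) / (3 * c $ 1)"
  have c2: "c $ 2 = - (3 * t * c $ 1)"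
    using False assms(1) by (simp add: t_def)
  have "3 * c $ 1 * c $ 3 = c $ 2 ^ 2"
    using assms(3) by (simp add: hess0_def)
  then have "3 * c $ 1 * c $ 3 = 3 * c $ 1 * (3 * t ^ 2 * c $ 1)"
    unfolding c2 by (simp add: power2_eq_square algebra_simps)
  then have c3: "c $ 3 = 3 * t ^ 2 * c $ 1"
    using False assms(1) by (simp only: mult_cancel_left) simp
  have "3 * 3 * c $ 1 * c $ 4 = c $ 2 * c $ 3"
    using assms(4) by (simp add: hess1_def)
  then have "3 * 3 * c $ 1 * c $ 4 = 3 * 3 * c $ 1 * (- (t ^ 3 * c $ 1))"
    unfolding c2 c3 by (simp add: power2_eq_square power3_eq_cube algebra_simps)
  then have "c $ 4 = - (t ^ 3 * c $ 1)"
    using False assms(1) by (simp only: mult_cancel_left mult_eq_0_iff) simp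
  then have "c = (c $ 1) *s osc (t, 1)"
    using c2 c3 by (simp add: osc_def vec4_eq_iff algebra_simps)
  then have "plane_of c = osc_plane (t, 1)"
    unfolding osc_plane_def using plane_of_scale[OF False] by metis
  then show ?thesis
    by (auto simp: Gamma_planes_eq)
qed

lemma apolar_same_roots:
  fixes c :: "'a::field ^ 4"
  assumes "(3 :: 'a) \<noteq> 0" "c \<noteq> 0" "plane_of c \<notin> Gamma_planes"
    and h: "apolar c a b d" "(a, b, d) \<noteq> (0, 0, 0)"
  shows "qform a b d v = 0 \<longleftrightarrow> qform (hess0 c) (hess1 c) (hess2 c) v = 0"
proof -
  have hess: "(hess0 c, hess1 c, hess2 c) \<noteq> (0, 0, 0)"
    using hess_zero_imp_Gamma assms by blast
  note par = apolar_parallel_hess[OF h(1)]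
  have "a * qform (hess0 c) (hess1 c) (hess2 c) v = hess0 c * qform a b d v"
    "b * qform (hess0 c) (hess1 c) (hess2 c) v = hess1 c * qform a b d v"
    "d * qform (hess0 c) (hess1 c) (hess2 c) v = hess2 c * qform a b d v"
    using par by (simp_all add: qform_mult mult.commute)
  then show ?thesis
    using hess h(2) by auto
qed

text \<open>Both pairs are recovered as the roots of the Hessian in \<open>P1\<close>.\<close>

lemma pair_axis_unique:
  fixes c :: "'a::field ^ 4"
  assumes "(3 :: 'a) \<noteq> 0" "c \<noteq> 0" "plane_of c \<notin> Gamma_planes"
    and "u \<in> P1" "v \<in> P1" "u' \<in> P1" "v' \<in> P1"
    and "pair_axis u v \<subseteq> plane_of c" "pair_axis u' v' \<subseteq> plane_of c"
  shows "{u, v} = {u', v'}"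
proof -
  have *: "bracket w x * bracket w y = 0 \<longleftrightarrow> qform (hess0 c) (hess1 c) (hess2 c) w = 0"
    if "x \<in> P1" "y \<in> P1" "pair_axis x y \<subseteq> plane_of c" for x y w
    using apolar_same_roots[OF assms(1-3) _ pair_coeffs_neq_0[OF that(1,2)], of w] that(3)
    by (simp add: pair_axis_def axis_line_subset_iff qform_pair)
  have "w \<in> {u, v} \<longleftrightarrow> w \<in> {u', v'}" if "w \<in> P1" for w
    using *[of u v w] *[of u' v' w] assms that by (simp add: bracket_eq_0_iff)
  then show ?thesis
    using assms by blast
qed

lemma pair_axis_commute: "pair_axis u v = pair_axis v u"
proof -
  have *: "- (snd u * fst v) - fst u * snd v = - (snd v * fst u) - fst v * snd u"
    by (simp add: algebra_simps)
  show ?thesis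
    by (simp only: pair_axis_def * mult.commute[of "snd u" "snd v"] mult.commute[of "fst u" "fst v"])
qed

text \<open>A quadratic without roots is irreducible, and it does not vanish at infinity, so it can
  be taken monic. \<open>a\<close> and \<open>b\<close> are the trace and the norm of its conjugate
  roots.\<close>

definition irr :: "'a::field \<Rightarrow> 'a \<Rightarrow> bool" where
  "irr a b \<longleftrightarrow> (\<forall>t. t ^ 2 - a * t + b \<noteq> 0)"

text \<open>Both quadratics have the roots of the Hessian, so \<open>u\<close> would be a root of
  the irreducible one.\<close>

lemma irr_axis_not_pair_axis:
  fixes c :: "'a::field ^ 4"
  assumes "(3 :: 'a) \<noteq> 0" "c \<noteq> 0" "plane_of c \<notin> Gamma_planes"
    and "u \<in> P1" "v \<in> P1" "pair_axis u v \<subseteq> plane_of c" "irr a b"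
  shows "\<not> axis_line 1 (- a) b \<subseteq> plane_of c"
proof
  assume "axis_line 1 (- a) b \<subseteq> plane_of c"
  then have "qform 1 (- a) b u = 0 \<longleftrightarrow> bracket u u * bracket u v = 0"
    using apolar_same_roots[OF assms(1-3), of 1 "- a" b u]
      apolar_same_roots[OF assms(1-3) _ pair_coeffs_neq_0[OF assms(4,5)], of u] assms(6)
    by (simp add: pair_axis_def axis_line_subset_iff qform_pair)
  then have "qform 1 (- a) b u = 0"
    using assms by (simp add: bracket_eq_0_iff)
  then show False
    using assms(4,7) by (auto simp: irr_def qform_def elim!: P1_cases)
qed

lemma irr_axis_unique:
  fixes c :: "'a::field ^ 4"
  assumes "(3 :: 'a) \<noteq> 0" "c \<noteq> 0" "plane_of c \<notin> Gamma_planes"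
    and "axis_line 1 (- a) b \<subseteq> plane_of c" "axis_line 1 (- a') b' \<subseteq> plane_of c"
  shows "a = a' \<and> b = b'"
proof -
  have hess: "hess1 c = - a * hess0 c" "hess2 c = b * hess0 c"
    "hess1 c = - a' * hess0 c" "hess2 c = b' * hess0 c"
    using apolar_parallel_hess(1,2)[of c 1 "- a" b] apolar_parallel_hess(1,2)[of c 1 "- a'" b'] assms
    by (simp_all add: axis_line_subset_iff)
  then have "hess0 c \<noteq> 0"
    using hess_zero_imp_Gamma[OF assms(1,2)] assms(3) by auto
  then show ?thesis
    using hess by auto
qed

lemma apolar_scale: "k \<noteq> 0 \<Longrightarrow> apolar c (k * a) (k * b) (k * d) \<longleftrightarrow> apolar c a b d"
proof -
  assume "k \<noteq> 0"
  have "apolar c (k * a) (k * b) (k * d) \<longleftrightarrow>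
      k * (a * c $ 3 - b * c $ 2 + 3 * d * c $ 1) = 0 \<and> k * (3 * a * c $ 4 - b * c $ 3 + d * c $ 2) = 0"
    unfolding apolar_def by (simp add: algebra_simps)
  then show ?thesis
    using \<open>k \<noteq> 0\<close> by (simp add: apolar_def)
qed

text \<open>The Hessian is apolar to \<open>c\<close>. If its leading coefficient vanishes, infinity
  is a root; otherwise one root \<open>t\<close> of the monic quadratic yields the other one as
  \<open>x - t\<close>. Avoiding the discriminant keeps the argument valid in characteristic
  2.\<close>

lemma axis_trichotomy:
  fixes c :: "'a::field ^ 4"
  assumes "(3 :: 'a) \<noteq> 0" "c \<noteq> 0" "plane_of c \<notin> Gamma_planes"
  obtains (pair) u v where "u \<in> P1" "v \<in> P1" "pair_axis u v \<subseteq> plane_of c"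
  | (irr) a b where "irr a b" "axis_line 1 (- a) b \<subseteq> plane_of c"
proof -
  let ?a = "hess0 c" and ?b = "hess1 c" and ?d = "hess2 c"
  have ap: "apolar c ?a ?b ?d"
    by (rule apolar_hess)
  show thesis
  proof (cases "?a = 0")
    case a0: True
    show thesis
    proof (cases "?b = 0")
      case True
      then have "?d \<noteq> 0"
        using hess_zero_imp_Gamma assms a0 by blast
      then have "apolar c 0 0 1"
        using apolar_scale[of ?d c 0 0 1] ap a0 True by simp
      then show thesis
        by (intro pair[of "(1, 0)" "(1, 0)"]) (auto simp: pair_axis_def axis_line_subset_iff)
    next
      case False
      \<comment> \<open>In \<open>pair_axis\<close> the form with a root at infinity and a finite
        root has middle coefficient -1, hence the scaling by \<open>- ?b\<close>.\<close>
      then have "apolar c 0 (- 1) (- (?d / ?b))"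
        using apolar_scale[of "- ?b" c 0 "-1" "- (?d / ?b)"] ap a0 by simp
      then show thesis
        by (intro pair[of "(1, 0)" "(- (?d / ?b), 1)"]) (auto simp: pair_axis_def axis_line_subset_iff)
    qed
  next
    case False
    then have ap1: "apolar c 1 (- (- ?b / ?a)) (?d / ?a)"
      using apolar_scale[of ?a c 1 "?b / ?a" "?d / ?a"] ap by simp
    define x where "x = - ?b / ?a"
    show thesis
    proof (cases "irr x (?d / ?a)")
      case True
      then show thesis
        using ap1 by (intro irr) (auto simp: axis_line_subset_iff x_def)
    next
      case False
      then obtain t where t: "t ^ 2 - x * t + ?d / ?a = 0"
        by (auto simp: irr_def)
      then have "?d / ?a = t * (x - t)"
        by (simp add: power2_eq_square algebra_simps eq_neg_iff_add_eq_0)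
      then show thesis
        using ap1 unfolding x_def[symmetric]
        by (intro pair[of "(t, 1)" "(x - t, 1)"]) (auto simp: pair_axis_def axis_line_subset_iff)
    qed
  qed
qed

section \<open>Counting the planes through real axes and tangents\<close>

lemma pair_axis_inj:
  fixes u v w :: "'a::field \<times> 'a"
  assumes "(3 :: 'a) \<noteq> 0" "v \<in> P1" "w \<in> P1" "w' \<in> P1" "w \<noteq> v" "pair_axis v w = pair_axis v w'"
  shows "w = w'"
  using assms pair_axis_subset_osc_plane_iff[of v w w] pair_axis_subset_osc_plane_iff[of v w' w] by simp

lemma card_real_axes_in_osc_plane:
  fixes v :: "'a::finite_field \<times> 'a"
  assumes "(3 :: 'a) \<noteq> 0" "v \<in> P1"
  shows "card {L \<in> real_axes. L \<subseteq> osc_plane v} = CARD('a)"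
proof -
  have "{L \<in> real_axes. L \<subseteq> osc_plane v} = pair_axis v ` (P1 - {v})"
  proof (intro equalityI subsetI)
    fix L assume "L \<in> {L \<in> real_axes. L \<subseteq> osc_plane v}"
    then obtain x y where L: "L = pair_axis x y" "x \<in> P1" "y \<in> P1" "x \<noteq> y" "L \<subseteq> osc_plane v"
      unfolding real_axes_eq[OF assms(1)] by blast
    then have "v = x \<or> v = y"
      using pair_axis_subset_osc_plane_iff assms by blast
    then show "L \<in> pair_axis v ` (P1 - {v})"
      using L pair_axis_commute[of x y] by auto
  next
    fix L assume "L \<in> pair_axis v ` (P1 - {v})"
    then obtain w where "w \<in> P1" "w \<noteq> v" "L = pair_axis v w"
      by blast
    then show "L \<in> {L \<in> real_axes. L \<subseteq> osc_plane v}"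
      unfolding real_axes_eq[OF assms(1)]
      using assms(2) pair_axis_subset_osc_plane_iff[OF assms(1), of v w v] by blast
  qed
  moreover have "inj_on (pair_axis v) (P1 - {v})"
    using pair_axis_inj[OF assms] by (auto simp: inj_on_def)
  ultimately show ?thesis
    using assms by (simp add: card_image card_Diff_singleton card_P1)
qed

lemma card_osc_planes_through_real_axis:
  fixes L :: "('a::finite_field ^ 4) set"
  assumes "(3 :: 'a) \<noteq> 0" "L \<in> real_axes"
  shows "card {w \<in> P1. L \<subseteq> osc_plane w} = 2"
proof -
  obtain u v where L: "L = pair_axis u v" "u \<in> P1" "v \<in> P1" "u \<noteq> v"
    using assms(2) unfolding real_axes_eq[OF assms(1)] by blast
  then have "{w \<in> P1. L \<subseteq> osc_plane w} = {u, v}"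
    using pair_axis_subset_osc_plane_iff[OF assms(1), of u v] by blast
  then show ?thesis
    using L by simp
qed

lemma card_real_axes:
  assumes "(3 :: 'a::finite_field) \<noteq> 0"
  shows "2 * card (real_axes :: ('a ^ 4) set set) = (CARD('a) + 1) * CARD('a)"
proof -
  have "(\<Sum>L\<in>real_axes. card {w \<in> P1. L \<subseteq> osc_plane (w :: 'a \<times> 'a)})
      = (\<Sum>w\<in>P1. card {L \<in> real_axes. L \<subseteq> osc_plane (w :: 'a \<times> 'a)})"
    by (rule sum_card_swap) auto
  then show ?thesis
    using card_osc_planes_through_real_axis[OF assms] card_real_axes_in_osc_plane[OF assms]
    by (simp add: card_P1 mult.commute)
qed

abbreviation nonosc_planes :: "('a::field ^ 4) set set" where
  "nonosc_planes \<equiv> proj_planes - Gamma_planes"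

lemma card_nonosc_planes_through:
  fixes L :: "('a::finite_field ^ 4) set"
  assumes "L \<in> proj_lines"
  shows "card {H \<in> nonosc_planes. L \<subseteq> H} + card {w \<in> P1. L \<subseteq> osc_plane w} = CARD('a) + 1"
proof -
  have "card {w \<in> P1. L \<subseteq> osc_plane w} = card (osc_plane ` {w \<in> P1. L \<subseteq> osc_plane w})"
    by (rule card_image[symmetric]) (auto intro: inj_on_subset[OF inj_on_osc_plane])
  moreover have "{H \<in> proj_planes. L \<subseteq> H}
      = {H \<in> nonosc_planes. L \<subseteq> H} \<union> osc_plane ` {w \<in> P1. L \<subseteq> osc_plane w}"
    using osc_plane_proj_plane by (auto simp: Gamma_planes_eq)
  moreover have "{H \<in> nonosc_planes. L \<subseteq> H} \<inter> osc_plane ` {w \<in> P1. L \<subseteq> osc_plane w} = {}"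
    by (auto simp: Gamma_planes_eq)
  ultimately show ?thesis
    using card_planes_through_line[OF assms] by (simp add: card_Un_disjoint)
qed

text \<open>The names of the three types tell how the Hessian behaves over the field: two distinct
  roots, a double root, no root. Membership is expressed by the apolar axis because incidences with
  axes are what is counted.\<close>

definition split_planes :: "('a::field ^ 4) set set" where
  "split_planes = {H \<in> nonosc_planes. \<exists>u\<in>P1. \<exists>v\<in>P1. u \<noteq> v \<and> pair_axis u v \<subseteq> H}"

definition double_planes :: "('a::field ^ 4) set set" where
  "double_planes = {H \<in> nonosc_planes. \<exists>v\<in>P1. pair_axis v v \<subseteq> H}"

definition irr_planes :: "('a::field ^ 4) set set" where
  "irr_planes = {H \<in> nonosc_planes. \<exists>a b. irr a b \<and> axis_line 1 (- a) b \<subseteq> H}"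

lemma nonosc_plane_cases:
  fixes H :: "('a::field ^ 4) set"
  assumes "(3 :: 'a) \<noteq> 0" "H \<in> nonosc_planes"
  shows "H \<in> split_planes \<or> H \<in> double_planes \<or> H \<in> irr_planes"
proof -
  obtain c where c: "c \<noteq> 0" "H = plane_of c"
    using assms proj_plane_eq_plane_of by blast
  show ?thesis
  proof (rule axis_trichotomy[OF assms(1) c(1)])
    show "plane_of c \<notin> Gamma_planes"
      using assms c by blast
  next
    fix u v assume "u \<in> P1" "v \<in> P1" "pair_axis u v \<subseteq> plane_of c"
    then show ?thesis
      using assms c unfolding split_planes_def double_planes_def by (cases "u = v") blast+
  next
    fix a b assume "irr a b" "axis_line 1 (- a) b \<subseteq> plane_of c"
    then show ?thesis
      using assms c unfolding irr_planes_def by blast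
  qed
qed

lemma pair_axis_in_plane_unique:
  fixes H :: "('a::field ^ 4) set"
  assumes "(3 :: 'a) \<noteq> 0" "H \<in> nonosc_planes"
    and "u \<in> P1" "v \<in> P1" "u' \<in> P1" "v' \<in> P1" "pair_axis u v \<subseteq> H" "pair_axis u' v' \<subseteq> H"
  shows "{u, v} = {u', v'}"
proof -
  obtain c where "c \<noteq> 0" "H = plane_of c"
    using assms proj_plane_eq_plane_of by blast
  then show ?thesis
    using pair_axis_unique[OF assms(1), of c u v u' v'] assms by blast
qed

lemma card_real_axes_in_nonosc_plane:
  fixes H :: "('a::finite_field ^ 4) set"
  assumes "(3 :: 'a) \<noteq> 0" "H \<in> nonosc_planes"
  shows "card {L \<in> real_axes. L \<subseteq> H} = of_bool (H \<in> split_planes)"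
proof (cases "H \<in> split_planes")
  case True
  then obtain u v where uv: "u \<in> P1" "v \<in> P1" "u \<noteq> v" "pair_axis u v \<subseteq> H"
    by (auto simp: split_planes_def)
  have "L = pair_axis u v" if L: "L \<in> real_axes" "L \<subseteq> H" for L
  proof -
    obtain x y where xy: "L = pair_axis x y" "x \<in> P1" "y \<in> P1"
      using L(1) unfolding real_axes_eq[OF assms(1)] by blast
    then have "{x, y} = {u, v}"
      using pair_axis_in_plane_unique[OF assms] uv L by blast
    then show ?thesis
      using xy pair_axis_commute[of x y] by (auto simp: doubleton_eq_iff)
  qed
  moreover have "pair_axis u v \<in> real_axes"
    unfolding real_axes_eq[OF assms(1)] using uv by blast
  ultimately have "{L \<in> real_axes. L \<subseteq> H} = {pair_axis u v}"
    using uv by blast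
  then show ?thesis
    using True by simp
next
  case False
  then have "{L \<in> real_axes. L \<subseteq> H} = {}"
    unfolding real_axes_eq[OF assms(1)] split_planes_def using assms by blast
  then show ?thesis
    using False by simp
qed

text \<open>Double counting of real axes in non-osculating planes: an axis lies in q + 1 planes, two
  of them osculating, and a split plane contains exactly one axis.\<close>

lemma card_split_planes:
  assumes "(3 :: 'a::finite_field) \<noteq> 0"
  shows "2 * int (card (split_planes :: ('a ^ 4) set set)) = (int CARD('a) + 1) * int CARD('a) * (int CARD('a) - 1)"
proof -
  have "(\<Sum>L\<in>real_axes. card {H \<in> nonosc_planes. L \<subseteq> (H :: ('a ^ 4) set)})
      = (\<Sum>H\<in>nonosc_planes. card {L \<in> real_axes. L \<subseteq> (H :: ('a ^ 4) set)})"
    by (rule sum_card_swap) auto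
  also have "\<dots> = (\<Sum>H\<in>nonosc_planes. of_bool ((H :: ('a ^ 4) set) \<in> split_planes))"
    using card_real_axes_in_nonosc_plane[OF assms] by (intro sum.cong) auto
  also have "\<dots> = card (nonosc_planes \<inter> split_planes :: ('a ^ 4) set set)"
    by (simp add: of_bool_def sum.If_cases)
  also have "nonosc_planes \<inter> split_planes = (split_planes :: ('a ^ 4) set set)"
    unfolding split_planes_def by blast
  finally have sum: "(\<Sum>L\<in>real_axes. card {H \<in> nonosc_planes. L \<subseteq> (H :: ('a ^ 4) set)})
      = card (split_planes :: ('a ^ 4) set set)" .
  have "int (card {H \<in> nonosc_planes. L \<subseteq> H}) = int CARD('a) - 1" if "L \<in> real_axes" for L :: "('a ^ 4) set"
  proof -
    have "L \<in> proj_lines"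
      using that pair_axis_proj_line[OF assms] unfolding real_axes_eq[OF assms] by blast
    then show ?thesis
      using card_nonosc_planes_through[of L] card_osc_planes_through_real_axis[OF assms that] by linarith
  qed
  then have "int (card (split_planes :: ('a ^ 4) set set))
      = int (card (real_axes :: ('a ^ 4) set set)) * (int CARD('a) - 1)"
    unfolding sum[symmetric] by simp
  moreover have "2 * int (card (real_axes :: ('a ^ 4) set set)) = (int CARD('a) + 1) * int CARD('a)"
    using arg_cong[OF card_real_axes[OF assms], of int] by (simp add: algebra_simps)
  ultimately show ?thesis
    by (metis mult.assoc)
qed

text \<open>The same count for tangents, each of which lies in only one osculating plane and hence
  in q others.\<close>

lemma card_double_planes:
  assumes "(3 :: 'a::finite_field) \<noteq> 0"
  shows "card (double_planes :: ('a ^ 4) set set) = (CARD('a) + 1) * CARD('a)"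
proof -
  have "(\<Sum>v\<in>P1. card {H \<in> nonosc_planes. pair_axis v v \<subseteq> (H :: ('a ^ 4) set)})
      = (\<Sum>H\<in>nonosc_planes. card {v \<in> P1. pair_axis v v \<subseteq> (H :: ('a ^ 4) set)})"
    by (rule sum_card_swap) auto
  also have "\<dots> = (\<Sum>H\<in>nonosc_planes. of_bool ((H :: ('a ^ 4) set) \<in> double_planes))"
  proof (rule sum.cong)
    fix H :: "('a ^ 4) set" assume H: "H \<in> nonosc_planes"
    show "card {v \<in> P1. pair_axis v v \<subseteq> H} = of_bool (H \<in> double_planes)"
    proof (cases "H \<in> double_planes")
      case True
      then obtain v where "v \<in> P1" "pair_axis v v \<subseteq> H"
        by (auto simp: double_planes_def)
      then have "{v \<in> P1. pair_axis v v \<subseteq> H} = {v}"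
        using pair_axis_in_plane_unique[OF assms H, of v v] by blast
      then show ?thesis
        using True by simp
    next
      case False
      then have "{v \<in> P1. pair_axis v v \<subseteq> H} = {}"
        using H by (auto simp: double_planes_def)
      then show ?thesis
        using False by simp
    qed
  qed simp
  also have "\<dots> = card (nonosc_planes \<inter> double_planes :: ('a ^ 4) set set)"
    by (simp add: of_bool_def sum.If_cases)
  also have "nonosc_planes \<inter> double_planes = (double_planes :: ('a ^ 4) set set)"
    unfolding double_planes_def by blast
  finally have sum: "(\<Sum>v\<in>P1. card {H \<in> nonosc_planes. pair_axis v v \<subseteq> (H :: ('a ^ 4) set)})
      = card (double_planes :: ('a ^ 4) set set)" .
  have "card {H \<in> nonosc_planes. pair_axis v v \<subseteq> H} = CARD('a)" if "v \<in> P1" for v :: "'a \<times> 'a"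
  proof -
    have "{w \<in> P1. pair_axis v v \<subseteq> osc_plane w} = {v}"
      using that pair_axis_subset_osc_plane_iff[OF assms that that] by blast
    then show ?thesis
      using card_nonosc_planes_through[OF pair_axis_proj_line[OF assms that that]] by simp
  qed
  then show ?thesis
    unfolding sum[symmetric] by (simp add: card_P1)
qed

lemma split_not_double:
  fixes H :: "('a::field ^ 4) set"
  assumes "(3 :: 'a) \<noteq> 0" "H \<in> split_planes"
  shows "H \<notin> double_planes"
  using assms pair_axis_in_plane_unique[OF assms(1), of H]
  by (fastforce simp: split_planes_def double_planes_def)

lemma irr_not_pair:
  fixes H :: "('a::field ^ 4) set"
  assumes "(3 :: 'a) \<noteq> 0" "H \<in> irr_planes"
  shows "H \<notin> split_planes" "H \<notin> double_planes"
proof -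
  obtain c where "c \<noteq> 0" "H = plane_of c"
    using assms proj_plane_eq_plane_of unfolding irr_planes_def by blast
  then show "H \<notin> split_planes" "H \<notin> double_planes"
    using irr_axis_not_pair_axis[OF assms(1), of c] assms(2)
    unfolding irr_planes_def split_planes_def double_planes_def by blast+
qed

section \<open>Planes by the number of their points on the cubic\<close>

lemma line_through_points:
  fixes v w :: "'a::field \<times> 'a"
  assumes "v \<in> P1" "w \<in> P1" "v \<noteq> w"
  shows "vec.span {pt v, pt w} \<in> proj_lines"
proof -
  have "pt v \<notin> vec.span {pt w}"
    using pt_notin_span[of w v] assms by simp
  then show ?thesis
    using assms pt_neq_0[of w] by (simp add: proj_lines_def vec.dim_span vec.dim_insert)
qed

lemma span_subset_iff:
  assumes "vec.subspace H"
  shows "vec.span S \<subseteq> H \<longleftrightarrow> S \<subseteq> H"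
  by (meson assms order.trans vec.span_minimal vec.span_superset)

lemma span_insert_proj_plane:
  fixes L :: "('a::field ^ 4) set"
  assumes "L \<in> proj_lines" "x \<notin> L"
  shows "vec.span (insert x L) \<in> proj_planes"
proof -
  have "vec.span L = L" "vec.dim L = 2"
    using assms by (auto simp: proj_lines_def)
  then have "x \<notin> vec.span L"
    using assms(2) by metis
  then show ?thesis
    using \<open>vec.dim L = 2\<close> unfolding proj_planes_def mem_Collect_eq vec.dim_span vec.dim_insert by simp
qed

text \<open>
  Three points of the cubic on a line would span, with a fourth point, a plane containing four points.
\<close>

lemma card_cubic_pts_line_le_2:
  fixes L :: "('a::finite_field ^ 4) set"
  assumes "L \<in> proj_lines" "CARD('a) \<ge> 3"
  shows "card (cubic_pts L) \<le> 2"
proof (rule ccontr)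
  assume *: "\<not> ?thesis"
  have "\<exists>H\<in>proj_planes. 4 \<le> card (cubic_pts (H :: ('a ^ 4) set))"
  proof (cases "cubic_pts L = P1")
    \<comment> \<open>There is no fourth point outside \<open>L\<close> here, but any plane through
      \<open>L\<close> already contains all q + 1 \<ge> 4 points.\<close>
    case True
    have "card {H \<in> proj_planes. L \<subseteq> H} \<noteq> 0"
      using card_planes_through_line[OF assms(1)] by simp
    then have "{H \<in> proj_planes. L \<subseteq> H} \<noteq> {}"
      by force
    then obtain H where H: "H \<in> proj_planes" "L \<subseteq> H"
      by blast
    then have "cubic_pts H = P1"
      using True by (auto simp: cubic_pts_def)
    then show ?thesis
      using H assms(2) card_P1[where 'a = 'a] by (intro bexI[where x = H]) simp_all
  next
    case False
    then obtain z where z: "z \<in> P1" "pt z \<notin> L"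
      by (auto simp: cubic_pts_def)
    have "insert z (cubic_pts L) \<subseteq> cubic_pts (vec.span (insert (pt z) L))"
      using z by (auto simp: cubic_pts_def intro: vec.span_base)
    then have "card (insert z (cubic_pts L)) \<le> card (cubic_pts (vec.span (insert (pt z) L)))"
      by (intro card_mono) auto
    moreover have "z \<notin> cubic_pts L"
      using z by (auto simp: cubic_pts_def)
    ultimately have "4 \<le> card (cubic_pts (vec.span (insert (pt z) L)))"
      using * by simp
    then show ?thesis
      using span_insert_proj_plane[OF assms(1) z(2)] by blast
  qed
  then show False
    using card_cubic_pts_plane_le_3 by fastforce
qed

lemma card_planes_through_three_points:
  fixes u v w :: "'a::finite_field \<times> 'a"
  assumes "CARD('a) \<ge> 3" "u \<in> P1" "v \<in> P1" "w \<in> P1" "u \<noteq> v" "u \<noteq> w" "v \<noteq> w"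
  shows "card {H \<in> proj_planes. pt u \<in> H \<and> pt v \<in> H \<and> pt w \<in> H} = 1"
proof -
  let ?L = "vec.span {pt u, pt v}"
  have L: "?L \<in> proj_lines"
    using assms by (intro line_through_points)
  have w: "pt w \<notin> ?L"
  proof
    assume "pt w \<in> ?L"
    then have "{u, v, w} \<subseteq> cubic_pts ?L"
      using assms by (auto simp: cubic_pts_def intro: vec.span_base)
    then have "card {u, v, w} \<le> card (cubic_pts ?L)"
      by (intro card_mono) auto
    then show False
      using card_cubic_pts_line_le_2[OF L assms(1)] assms by simp
  qed
  have "H = vec.span (insert (pt w) ?L)" if "H \<in> proj_planes" "pt u \<in> H" "pt v \<in> H" "pt w \<in> H" for H
  proof (rule proj_plane_eqI[OF that(1) span_insert_proj_plane[OF L w] L])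
    show "?L \<subseteq> H"
      using that by (simp add: proj_planes_def span_subset_iff)
    show "?L \<subseteq> vec.span (insert (pt w) ?L)"
      using vec.span_superset by blast
  qed (use that w in \<open>auto intro: vec.span_base\<close>)
  moreover have "vec.span (insert (pt w) ?L) \<in> {H \<in> proj_planes. pt u \<in> H \<and> pt v \<in> H \<and> pt w \<in> H}"
    using span_insert_proj_plane[OF L w] by (auto intro!: vec.span_base)
  ultimately have "{H \<in> proj_planes. pt u \<in> H \<and> pt v \<in> H \<and> pt w \<in> H} = {vec.span (insert (pt w) ?L)}"
    by blast
  then show ?thesis
    by simp
qed

lemma card_planes_through_two_points:
  fixes u v :: "'a::finite_field \<times> 'a"
  assumes "u \<in> P1" "v \<in> P1" "u \<noteq> v"
  shows "card {H \<in> proj_planes. pt u \<in> H \<and> pt v \<in> H} = CARD('a) + 1"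
proof -
  have "{H \<in> proj_planes. pt u \<in> H \<and> pt v \<in> H} = {H \<in> proj_planes. vec.span {pt u, pt v} \<subseteq> H}"
    by (intro Collect_cong conj_cong refl) (simp add: proj_planes_def span_subset_iff)
  then show ?thesis
    using card_planes_through_line[OF line_through_points[OF assms]] by simp
qed

lemma card_distinct_pairs:
  assumes "finite S"
  shows "card (SIGMA x:S. S - {x}) = card S * (card S - 1)"
  using assms by (subst card_SigmaI) auto

lemma card_distinct_triples:
  assumes "finite S"
  shows "card (SIGMA x:S. SIGMA y:S - {x}. S - {x, y}) = card S * (card S - 1) * (card S - 2)"
proof -
  have "card (SIGMA y:S - {x}. S - {x, y}) = (card S - 1) * (card S - 2)" if "x \<in> S" for x
  proof -
    have "card (S - {x, y}) = card S - 2" if "y \<in> S - {x}" for y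
      using that \<open>x \<in> S\<close> assms by (subst card_Diff_subset) auto
    then show ?thesis
      using assms that by (subst card_SigmaI) auto
  qed
  then show ?thesis
    using assms by (subst card_SigmaI) auto
qed

section \<open>Factorial moments of the number of points of the cubic in a plane\<close>

lemma sum_card_cubic_pts:
  "(\<Sum>H\<in>proj_planes. card (cubic_pts (H :: ('a::finite_field ^ 4) set)))
     = (CARD('a) + 1) * (CARD('a) ^ 2 + CARD('a) + 1)"
proof -
  have "(\<Sum>H\<in>proj_planes. card {v \<in> P1. pt v \<in> (H :: ('a ^ 4) set)})
      = (\<Sum>v\<in>P1. card {H \<in> proj_planes. pt v \<in> (H :: ('a ^ 4) set)})"
    by (rule sum_card_swap) auto
  then show ?thesis
    by (simp add: cubic_pts_def card_P1 card_planes_through_point pt_neq_0)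
qed

lemma sum_card_cubic_pts_pairs:
  "(\<Sum>H\<in>proj_planes. card (cubic_pts (H :: ('a::finite_field ^ 4) set)) * (card (cubic_pts H) - 1))
     = (CARD('a) + 1) * CARD('a) * (CARD('a) + 1)"
proof -
  let ?P = "SIGMA v:P1. P1 - {v :: 'a \<times> 'a}"
  have "(\<Sum>H\<in>proj_planes. card {p \<in> ?P. pt (fst p) \<in> H \<and> pt (snd p) \<in> (H :: ('a ^ 4) set)})
      = (\<Sum>p\<in>?P. card {H \<in> proj_planes. pt (fst p) \<in> H \<and> pt (snd p) \<in> (H :: ('a ^ 4) set)})"
    by (rule sum_card_swap) auto
  also have "\<dots> = (\<Sum>p\<in>?P. CARD('a) + 1)"
    by (intro sum.cong refl card_planes_through_two_points) auto
  also have "\<dots> = (CARD('a) + 1) * CARD('a) * (CARD('a) + 1)"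
    by (simp add: card_distinct_pairs card_P1)
  also have "(\<Sum>H\<in>proj_planes. card {p \<in> ?P. pt (fst p) \<in> H \<and> pt (snd p) \<in> (H :: ('a ^ 4) set)})
      = (\<Sum>H\<in>proj_planes. card (cubic_pts (H :: ('a ^ 4) set)) * (card (cubic_pts H) - 1))"
  proof (intro sum.cong refl)
    fix H :: "('a ^ 4) set"
    have "{p \<in> ?P. pt (fst p) \<in> H \<and> pt (snd p) \<in> H} = (SIGMA v:cubic_pts H. cubic_pts H - {v})"
      by (auto simp: cubic_pts_def)
    then show "card {p \<in> ?P. pt (fst p) \<in> H \<and> pt (snd p) \<in> H} = card (cubic_pts H) * (card (cubic_pts H) - 1)"
      by (simp add: card_distinct_pairs)
  qed
  finally show ?thesis .
qed

lemma sum_card_cubic_pts_triples: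
  assumes "CARD('a::finite_field) \<ge> 3"
  shows "(\<Sum>H\<in>proj_planes. card (cubic_pts (H :: ('a ^ 4) set)) * (card (cubic_pts H) - 1) * (card (cubic_pts H) - 2))
     = (CARD('a) + 1) * CARD('a) * (CARD('a) - 1)"
proof -
  let ?P = "SIGMA v:P1. SIGMA w:P1 - {v}. P1 - {v, w :: 'a \<times> 'a}"
  let ?R = "\<lambda>p (H :: ('a ^ 4) set). pt (fst p) \<in> H \<and> pt (fst (snd p)) \<in> H \<and> pt (snd (snd p)) \<in> H"
  have "(\<Sum>H\<in>proj_planes. card {p \<in> ?P. ?R p H}) = (\<Sum>p\<in>?P. card {H \<in> proj_planes. ?R p H})"
    by (rule sum_card_swap) auto
  also have "\<dots> = (\<Sum>p\<in>?P. 1)"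
    by (intro sum.cong refl card_planes_through_three_points[OF assms]) auto
  also have "\<dots> = (CARD('a) + 1) * CARD('a) * (CARD('a) - 1)"
    by (simp add: card_distinct_triples card_P1 del: card_SigmaI)
  also have "(\<Sum>H\<in>proj_planes. card {p \<in> ?P. ?R p H}) = (\<Sum>H\<in>proj_planes.
      card (cubic_pts (H :: ('a ^ 4) set)) * (card (cubic_pts H) - 1) * (card (cubic_pts H) - 2))"
  proof (intro sum.cong refl)
    fix H :: "('a ^ 4) set"
    have "{p \<in> ?P. ?R p H} = (SIGMA v:cubic_pts H. SIGMA w:cubic_pts H - {v}. cubic_pts H - {v, w})"
      by (auto simp: cubic_pts_def)
    then show "card {p \<in> ?P. ?R p H} = card (cubic_pts H) * (card (cubic_pts H) - 1) * (card (cubic_pts H) - 2)"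
      by (simp add: card_distinct_triples del: card_SigmaI)
  qed
  finally show ?thesis .
qed

lemma sum_by_values:
  fixes g :: "nat \<Rightarrow> nat"
  assumes "finite A" "\<And>x. x \<in> A \<Longrightarrow> f x \<in> V" "finite V"
  shows "(\<Sum>x\<in>A. g (f x)) = (\<Sum>n\<in>V. card {x \<in> A. f x = n} * g n)"
proof -
  have "(\<Sum>x\<in>A. g (f x)) = (\<Sum>n\<in>V. \<Sum>x\<in>{x \<in> A. f x = n}. g (f x))"
    using assms by (intro sum.group[symmetric]) auto
  then show ?thesis
    by simp
qed

lemma card_cubic_pts_plane_mem:
  fixes H :: "('a::finite_field ^ 4) set"
  assumes "H \<in> proj_planes"
  shows "card (cubic_pts H) \<in> {0, 1, 2, 3}"
proof -
  have "{..3 :: nat} = {0, 1, 2, 3}"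
    by auto
  then show ?thesis
    using card_cubic_pts_plane_le_3[OF assms] by blast
qed

text \<open>The total number of planes and the first three factorial moments give four linear
  equations for the numbers of planes with 0, 1, 2 and 3 points. The system is triangular: the third
  moment contains \<open>N 3\<close> alone.\<close>

lemma card_C_planes:
  assumes "CARD('a::finite_field) \<ge> 3"
  shows "6 * int (card (C_planes 3 :: ('a ^ 4) set set)) = int CARD('a) ^ 3 - int CARD('a)" (is ?A3)
    and "int (card (C_planes 2 :: ('a ^ 4) set set)) = int CARD('a) ^ 2 + int CARD('a)" (is ?A2)
    and "2 * int (card (C_planes 1 :: ('a ^ 4) set set)) = int CARD('a) ^ 3 + int CARD('a) + 2" (is ?A1)
    and "3 * int (card (C_planes 0 :: ('a ^ 4) set set)) = int CARD('a) ^ 3 - int CARD('a)" (is ?A0)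
proof -
  let ?q = "CARD('a)"
  define N where "N d = card (C_planes d :: ('a ^ 4) set set)" for d
  have sum: "(\<Sum>H\<in>proj_planes. g (card (cubic_pts (H :: ('a ^ 4) set))))
      = N 0 * g 0 + N 1 * g 1 + N 2 * g 2 + N 3 * g 3" for g
  proof -
    have "(\<Sum>H\<in>proj_planes. g (card (cubic_pts (H :: ('a ^ 4) set))))
        = (\<Sum>n\<in>{0, 1, 2, 3}. card {H \<in> proj_planes. card (cubic_pts (H :: ('a ^ 4) set)) = n} * g n)"
      by (intro sum_by_values card_cubic_pts_plane_mem) simp_all
    then show ?thesis
      by (simp add: N_def C_planes_eq del: card_0_eq card_eq_0_iff)
  qed
  have m0: "N 0 + N 1 + N 2 + N 3 = ?q ^ 3 + ?q ^ 2 + ?q + 1"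
    using sum[of "\<lambda>_. 1"] card_proj_planes[where 'a = 'a] by simp
  have m1: "N 1 + N 2 * 2 + N 3 * 3 = (?q + 1) * (?q ^ 2 + ?q + 1)"
    using sum[of "\<lambda>n. n"] sum_card_cubic_pts[where 'a = 'a] by simp
  have m2: "N 2 * 2 + N 3 * 6 = (?q + 1) * ?q * (?q + 1)"
    using sum[of "\<lambda>n. n * (n - 1)"] sum_card_cubic_pts_pairs[where 'a = 'a] by simp
  have m3: "N 3 * 6 = (?q + 1) * ?q * (?q - 1)"
    using sum[of "\<lambda>n. n * (n - 1) * (n - 2)"] sum_card_cubic_pts_triples[OF assms] by simp
  have i3: "6 * int (N 3) = int ?q ^ 3 - int ?q"
    using arg_cong[OF m3, of int] by (simp add: of_nat_diff Suc_leI algebra_simps power3_eq_cube)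
  have i2: "2 * int (N 2) + 6 * int (N 3) = int ?q ^ 3 + 2 * int ?q ^ 2 + int ?q"
    using arg_cong[OF m2, of int] by (simp add: algebra_simps power2_eq_square power3_eq_cube)
  have i1: "int (N 1) + 2 * int (N 2) + 3 * int (N 3) = int ?q ^ 3 + 2 * int ?q ^ 2 + 2 * int ?q + 1"
    using arg_cong[OF m1, of int] by (simp add: algebra_simps power2_eq_square power3_eq_cube)
  have i0: "int (N 0) + int (N 1) + int (N 2) + int (N 3) = int ?q ^ 3 + int ?q ^ 2 + int ?q + 1"
    using arg_cong[OF m0, of int] by simp
  show ?A3 ?A2 ?A1 ?A0
    using i0 i1 i2 i3 unfolding N_def by linarith+
qed

lemma card_one_bar_planes:
  assumes "CARD('a::finite_field) \<ge> 3"
  shows "2 * int (card (one_bar_planes :: ('a ^ 4) set set)) = int CARD('a) ^ 3 - int CARD('a)"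
proof -
  have sub: "Gamma_planes \<subseteq> (C_planes 1 :: ('a ^ 4) set set)"
    by (auto simp: Gamma_planes_eq C_planes_eq osc_plane_proj_plane cubic_pts_osc_plane)
  have "card (Gamma_planes :: ('a ^ 4) set set) = CARD('a) + 1"
    by (simp add: Gamma_planes_eq card_P1 card_image inj_on_osc_plane)
  then have "int (card (one_bar_planes :: ('a ^ 4) set set))
      = int (card (C_planes 1 :: ('a ^ 4) set set)) - (int CARD('a) + 1)"
    using sub card_mono[OF _ sub] by (simp add: one_bar_planes_def card_Diff_subset of_nat_diff)
  then show ?thesis
    using card_C_planes(3)[OF assms] by linarith
qed

section \<open>Cube roots and the three types of planes\<close>

lemma finite_field_power_card_minus_1:
  fixes x :: "'a::finite_field"
  assumes "x \<noteq> 0"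
  shows "x ^ (CARD('a) - 1) = 1"
proof -
  have "Suc (CARD('a) - 1) = CARD('a)"
    using finite_field_card_ge_2[where 'a = 'a] by simp
  then have "x * x ^ (CARD('a) - 1) = x * 1"
    using finite_field_power_card_eq_same[of x] by (metis mult_1_right power_Suc)
  then show ?thesis
    using assms by (simp only: mult_cancel_left) simp
qed

lemma card_cube_roots_2:
  fixes k :: "'a::finite_field"
  assumes "CARD('a) mod 3 = 2"
  shows "card {y. y ^ 3 = k} = 1"
proof -
  obtain m where "CARD('a) = 3 * m + 2"
    using assms by (metis mult_div_mod_eq)
  then have m: "CARD('a) - 1 = 3 * m + 1"
    by simp
  have inj: "inj (\<lambda>y :: 'a. y ^ 3)"
  proof (rule injI)
    fix x y :: 'a assume eq: "x ^ 3 = y ^ 3"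
    \<comment> \<open>The left side is 1 for \<open>z \<noteq> 0\<close>, so \<open>z\<close> is the
      inverse of a power of its own cube and is determined by that cube.\<close>
    have "z ^ (CARD('a) - 1) = (z ^ 3) ^ m * z" for z :: 'a
      by (simp only: m power_add power_mult power_one_right)
    then have "(x ^ 3) ^ m * x = (x ^ 3) ^ m * y" if "x \<noteq> 0" "y \<noteq> 0"
      using finite_field_power_card_minus_1[of x] finite_field_power_card_minus_1[of y] that eq by metis
    moreover have "x = 0 \<longleftrightarrow> y = 0"
      using eq by (metis power_eq_0_iff zero_less_numeral)
    ultimately show "x = y"
      by (cases "x = 0") auto
  qed
  have "surj (\<lambda>y :: 'a. y ^ 3)"
    using inj by (simp add: finite_UNIV_inj_surj)
  then obtain y where "k = y ^ 3"
    by (rule surjE)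
  then have "{y. y ^ 3 = k} = {y}"
    using injD[OF inj] by auto
  then show ?thesis
    by simp
qed

text \<open>With q - 1 = 3 m, every nonzero \<open>x\<close> satisfies (x^m)^3 = 1. If 1 were the
  only cube root of unity, all 3 m nonzero elements would be roots of a polynomial of degree
  m.\<close>

lemma primitive_cube_root:
  assumes "CARD('a::finite_field) mod 3 = 1"
  obtains (root) z :: "'a::finite_field" where "z ^ 3 = 1" "z \<noteq> 1"
proof (rule ccontr)
  assume no: "\<not> thesis"
  have *: "z = 1" if "z ^ 3 = 1" for z :: 'a
    using root[OF that] no by blast
  define m where "m = CARD('a) div 3"
  have card: "CARD('a) = 3 * m + 1"
    using assms unfolding m_def by (metis mult_div_mod_eq)
  then have "m > 0"
    using finite_field_card_ge_2[where 'a = 'a] by simp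
  have "x ^ m = 1" if "x \<noteq> 0" for x :: 'a
    using finite_field_power_card_minus_1[OF that] *[of "x ^ m"] card
    by (simp add: mult.commute flip: power_mult)
  then have sub: "UNIV - {0} \<subseteq> {x :: 'a. poly (monom 1 m - 1) x = 0}"
    by (auto simp: poly_monom)
  have nz: "monom 1 m - 1 \<noteq> (0 :: 'a poly)"
    using \<open>m > 0\<close> by (metis degree_1 degree_monom_eq less_not_refl2 right_minus_eq zero_neq_one)
  have "3 * m = card (UNIV - {0 :: 'a})"
    using card by simp
  also have "\<dots> \<le> card {x :: 'a. poly (monom 1 m - 1) x = 0}"
    using sub nz by (intro card_mono poly_roots_finite)
  also have "\<dots> \<le> degree (monom 1 m - 1 :: 'a poly)"
    using nz by (rule card_poly_roots_bound)
  also have "\<dots> \<le> m"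
    by (intro degree_diff_le) (auto simp: degree_monom_le)
  finally show False
    using \<open>m > 0\<close> by simp
qed

lemma card_cube_roots_1:
  fixes k :: "'a::finite_field"
  assumes "CARD('a) mod 3 = 1" "k \<noteq> 0"
  shows "card {y. y ^ 3 = k} \<in> {0, 3}"
proof (cases "\<exists>y. y ^ 3 = k")
  case True
  then obtain y where y: "y ^ 3 = k"
    by blast
  then have "y \<noteq> 0"
    using assms(2) by auto
  obtain z :: 'a where z: "z ^ 3 = 1" "z \<noteq> 1"
    using primitive_cube_root[OF assms(1)] .
  have "(z - 1) * (z ^ 2 + z + 1) = z ^ 3 - 1"
    by (simp add: algebra_simps power2_eq_square power3_eq_cube)
  then have z2: "z ^ 2 + z + 1 = 0"
    using z by auto
  have "z \<noteq> 0"
    using z by auto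
  have fact: "x ^ 3 - y ^ 3 = (x - y) * (x - z * y) * (x - z ^ 2 * y)" for x
  proof -
    have "(x - y) * (x - z * y) * (x - z ^ 2 * y)
        = x ^ 3 - (z ^ 2 + z + 1) * x ^ 2 * y + z * (z ^ 2 + z + 1) * x * y ^ 2 - z ^ 3 * y ^ 3"
      by (simp add: algebra_simps power2_eq_square power3_eq_cube)
    then show ?thesis
      by (simp add: z2 z)
  qed
  have "{x. x ^ 3 = k} = {y, z * y, z ^ 2 * y}"
    using fact by (auto simp flip: y) (metis eq_iff_diff_eq_0 mult_eq_0_iff)+
  moreover have "z ^ 2 \<noteq> z" "z ^ 2 \<noteq> 1"
    using z \<open>z \<noteq> 0\<close> by (auto simp: power2_eq_square power3_eq_cube)
  ultimately show ?thesis
    using z \<open>y \<noteq> 0\<close> by (auto simp: card_insert_if)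
next
  case False
  then show ?thesis
    by simp
qed

section \<open>Points of the cubic in planes through a real axis\<close>

lemma cubic_form_osc_comb:
  assumes "c = \<alpha> *s osc u + \<beta> *s osc v"
  shows "pt z \<in> plane_of c \<longleftrightarrow> \<alpha> * bracket z u ^ 3 + \<beta> * bracket z v ^ 3 = 0"
proof -
  have "c $ 1 * pt z $ 1 + c $ 2 * pt z $ 2 + c $ 3 * pt z $ 3 + c $ 4 * pt z $ 4
      = \<alpha> * bracket z u ^ 3 + \<beta> * bracket z v ^ 3"
    by (simp add: assms pt_def osc_def bracket_def algebra_simps power2_eq_square power3_eq_cube)
  then show ?thesis
    by (simp add: mem_plane_of)
qed

text \<open>The planes through the axis form the pencil spanned by the two osculating planes. The
  coefficients are given explicitly, with a parameter at infinity treated apart.\<close>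

lemma pair_axis_imp_osc_comb:
  fixes c :: "'a::field ^ 4"
  assumes "(3 :: 'a) \<noteq> 0" "u \<in> P1" "v \<in> P1" "u \<noteq> v" "pair_axis u v \<subseteq> plane_of c"
  shows "\<exists>\<alpha> \<beta>. c = \<alpha> *s osc u + \<beta> *s osc v"
proof -
  have fin_inf: "\<exists>\<alpha> \<beta>. c = \<alpha> *s osc (t, 1) + \<beta> *s osc (1, 0)" if "pair_axis (t, 1) (1, 0) \<subseteq> plane_of c" for t
  proof -
    have "c $ 2 = - (3 * t * c $ 1)" "c $ 3 = - (t * c $ 2)"
      using that by (simp_all add: pair_axis_def axis_line_subset_iff apolar_def algebra_simps
          eq_neg_iff_add_eq_0)
    then have "c = (c $ 1) *s osc (t, 1) + (- (c $ 4 + c $ 1 * t ^ 3)) *s osc (1, 0)"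
      by (simp add: vec4_eq_iff osc_def algebra_simps power2_eq_square)
    then show ?thesis
      by blast
  qed
  show ?thesis
    using assms(2)
  proof (cases u rule: P1_cases)
    case inf
    then obtain t where "v = (t, 1)"
      using assms by (auto elim!: P1_cases)
    then show ?thesis
      using fin_inf[of t] assms(5) inf by (metis add.commute pair_axis_commute)
  next
    case u: (fin t)
    show ?thesis
      using assms(3)
    proof (cases v rule: P1_cases)
      case inf
      then show ?thesis
        using fin_inf u assms by simp
    next
      case v: (fin s)
      have d: "3 * (t - s) \<noteq> 0"
        using assms u v by auto
      have c3: "c $ 3 = - (t + s) * c $ 2 - 3 * t * s * c $ 1"
        using assms(5) by (simp add: u v pair_axis_def axis_line_subset_iff apolar_def algebra_simps
            eq_neg_iff_add_eq_0)
      have "3 * c $ 4 = - (t + s) * c $ 3 - t * s * c $ 2"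
        using assms(5) by (simp add: u v pair_axis_def axis_line_subset_iff apolar_def algebra_simps
            eq_neg_iff_add_eq_0)
      then have c4: "3 * c $ 4 = (t ^ 2 + t * s + s ^ 2) * c $ 2 + 3 * (t + s) * t * s * c $ 1"
        unfolding c3 by (simp add: algebra_simps power2_eq_square)
      \<comment> \<open>Cramer's rule for the first two coordinates of the combination. Scaling
        \<open>c\<close> by the determinant \<open>3 * (t - s)\<close> postpones the
        division.\<close>
      define \<alpha> where "\<alpha> = - (c $ 2 + 3 * s * c $ 1)"
      define \<beta> where "\<beta> = c $ 2 + 3 * t * c $ 1"
      have "(3 * (t - s)) *s c = \<alpha> *s osc (t, 1) + \<beta> *s osc (s, 1)"
      proof -
        have "3 * (t - s) * c $ 4 = (t - s) * (3 * c $ 4)"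
          by simp
        also have "\<dots> = - (t ^ 3 * \<alpha>) - s ^ 3 * \<beta>"
          unfolding c4 \<alpha>_def \<beta>_def by (simp add: algebra_simps power2_eq_square power3_eq_cube)
        finally show ?thesis
          by (simp add: vec4_eq_iff osc_def) (simp add: c3 \<alpha>_def \<beta>_def algebra_simps power2_eq_square)
      qed
      then have "inverse (3 * (t - s)) *s ((3 * (t - s)) *s c)
          = (inverse (3 * (t - s)) * \<alpha>) *s osc (t, 1) + (inverse (3 * (t - s)) * \<beta>) *s osc (s, 1)"
        by (simp only: vec.scale_right_distrib vec.scale_scale)
      then show ?thesis
        using d u v by (metis left_inverse vec.scale_one vec.scale_scale)
    qed
  qed
qed

text \<open>This is the coordinate on the projective line with zero \<open>u\<close> and pole
  \<open>v\<close>. Injectivity comes from the Pluecker identity for brackets, surjectivity from the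
  q elements on both sides.\<close>

lemma bij_bracket_quotient:
  fixes u v :: "'a::finite_field \<times> 'a"
  assumes "u \<in> P1" "v \<in> P1" "u \<noteq> v"
  shows "bij_betw (\<lambda>z. bracket z u / bracket z v) (P1 - {v}) UNIV"
proof -
  have "inj_on (\<lambda>z. bracket z u / bracket z v) (P1 - {v})"
  proof (rule inj_onI)
    fix x y assume x: "x \<in> P1 - {v}" and y: "y \<in> P1 - {v}"
      and eq: "bracket x u / bracket x v = bracket y u / bracket y v"
    have "bracket x v \<noteq> 0" "bracket y v \<noteq> 0"
      using x y assms by (auto simp: bracket_eq_0_iff)
    then have "bracket x u * bracket y v - bracket y u * bracket x v = 0"
      using eq by (simp add: frac_eq_eq)
    moreover have "bracket x u * bracket y v - bracket y u * bracket x v = bracket x y * bracket u v"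
      by (simp add: bracket_def algebra_simps)
    ultimately show "x = y"
      using x y assms by (simp add: bracket_eq_0_iff)
  qed
  moreover from this have "(\<lambda>z. bracket z u / bracket z v) ` (P1 - {v}) = UNIV"
    using assms by (intro card_eq_UNIV_imp_eq_UNIV) (simp_all add: card_image card_P1 card_Diff_singleton)
  ultimately show ?thesis
    by (simp add: bij_betw_def)
qed

lemma card_Collect_bij:
  assumes "bij_betw f S UNIV"
  shows "card {z \<in> S. Q (f z)} = card {y. Q y}"
proof -
  have "f ` {z \<in> S. Q (f z)} = {y. Q y}"
  proof (intro equalityI subsetI)
    fix y assume "y \<in> {y. Q y}"
    moreover obtain z where "z \<in> S" "y = f z"
      using assms by (metis UNIV_I bij_betw_imp_surj_on imageE)
    ultimately show "y \<in> f ` {z \<in> S. Q (f z)}"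
      by blast
  qed auto
  moreover have "inj_on f {z \<in> S. Q (f z)}"
    using assms by (auto simp: bij_betw_def inj_on_def)
  ultimately show ?thesis
    by (metis card_image)
qed

text \<open>The form is a combination of the cubes of the linear forms with roots \<open>u\<close>
  and \<open>v\<close>. Both coefficients are nonzero, since otherwise the plane would be
  osculating; hence \<open>v\<close> is not a root, and dividing by the second cube leaves a pure
  cubic equation.\<close>

lemma card_cubic_pts_split_plane:
  fixes H :: "('a::finite_field ^ 4) set"
  assumes "(3 :: 'a) \<noteq> 0" "H \<in> split_planes"
  shows "\<exists>k. k \<noteq> 0 \<and> card (cubic_pts H) = card {y :: 'a. y ^ 3 = k}"
proof -
  obtain u v where uv: "u \<in> P1" "v \<in> P1" "u \<noteq> v" "pair_axis u v \<subseteq> H"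
    using assms(2) unfolding split_planes_def by blast
  obtain c where c: "c \<noteq> 0" "H = plane_of c"
    using assms(2) proj_plane_eq_plane_of unfolding split_planes_def by blast
  obtain \<alpha> \<beta> where comb: "c = \<alpha> *s osc u + \<beta> *s osc v"
    using pair_axis_imp_osc_comb[OF assms(1) uv(1-3)] uv c by blast
  have notG: "plane_of c \<notin> osc_plane ` P1"
    using assms(2) c by (auto simp: split_planes_def Gamma_planes_eq)
  have "\<alpha> \<noteq> 0"
  proof
    assume "\<alpha> = 0"
    then have "plane_of c = osc_plane v"
      using comb c plane_of_scale[of \<beta> "osc v"] by (auto simp: osc_plane_def)
    then show False
      using notG uv by blast
  qed
  have "\<beta> \<noteq> 0"
  proof
    assume "\<beta> = 0"
    then have "plane_of c = osc_plane u"
      using comb c plane_of_scale[of \<alpha> "osc u"] by (auto simp: osc_plane_def)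
    then show False
      using notG uv by blast
  qed
  let ?f = "\<lambda>z. bracket z u / bracket z v"
  have "z \<in> cubic_pts H \<longleftrightarrow> z \<in> P1 - {v} \<and> ?f z ^ 3 = - \<beta> / \<alpha>" for z
  proof (cases "z \<in> P1 - {v}")
    case True
    then have "bracket z v \<noteq> 0"
      using uv by (simp add: bracket_eq_0_iff)
    then have "\<alpha> * bracket z u ^ 3 + \<beta> * bracket z v ^ 3 = 0 \<longleftrightarrow> ?f z ^ 3 = - \<beta> / \<alpha>"
      using \<open>\<alpha> \<noteq> 0\<close> by (simp add: power_divide field_simps eq_neg_iff_add_eq_0)
    then show ?thesis
      using True by (simp add: cubic_pts_def c cubic_form_osc_comb[OF comb])
  next
    case False
    have "v \<notin> cubic_pts H"
      using \<open>\<alpha> \<noteq> 0\<close> uv bracket_eq_0_iff[of v u] bracket_eq_0_iff[of v v]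
      by (simp add: cubic_pts_def c cubic_form_osc_comb[OF comb])
    then show ?thesis
      using False by (auto simp: cubic_pts_def)
  qed
  then have set_eq: "cubic_pts H = {z \<in> P1 - {v}. ?f z ^ 3 = - \<beta> / \<alpha>}"
    by blast
  have "card (cubic_pts H) = card {y. y ^ 3 = - \<beta> / \<alpha>}"
    unfolding set_eq by (rule card_Collect_bij[OF bij_bracket_quotient[OF uv(1-3)]])
  moreover have "- \<beta> / \<alpha> \<noteq> 0"
    using \<open>\<alpha> \<noteq> 0\<close> \<open>\<beta> \<noteq> 0\<close> by simp
  ultimately show ?thesis
    by blast
qed

section \<open>Points of the cubic in planes through a tangent\<close>

lemma linear_form_root:
  fixes e f :: "'a::field"
  assumes "(e, f) \<noteq> (0, 0)"
  shows "\<exists>w\<in>P1. {z \<in> P1. e * fst z + f * snd z = 0} = {w}"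
proof (cases "e = 0")
  case True
  then have "{z \<in> P1. e * fst z + f * snd z = 0} = {(1, 0)}"
    using assms by (auto simp: P1_def)
  then show ?thesis
    by (intro bexI[where x = "(1, 0)"]) auto
next
  case False
  then have "{z \<in> P1. e * fst z + f * snd z = 0} = {(- f / e, 1)}"
    by (auto simp: P1_def field_simps eq_neg_iff_add_eq_0)
  then show ?thesis
    by (intro bexI[where x = "(- f / e, 1)"]) auto
qed

text \<open>The two vectors are the coefficients of \<open>bracket z v ^ 2\<close> times the first
  and the second coordinate of \<open>z\<close>. So \<open>v\<close> is a double root, and
  \<open>e\<close>, \<open>f\<close> are the coefficients of the remaining linear factor.\<close>

lemma tangent_cubic_form:
  fixes c :: "'a::field ^ 4"
  assumes "(3 :: 'a) \<noteq> 0" "v \<in> P1" "pair_axis v v \<subseteq> plane_of c"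
  shows "\<exists>e f. c = e *s vector [snd v ^ 2, - (2 * fst v * snd v), fst v ^ 2, 0]
      + f *s vector [0, snd v ^ 2, - (2 * fst v * snd v), fst v ^ 2]"
  using assms(2)
proof (cases v rule: P1_cases)
  case inf
  then have "c $ 1 = 0" "c $ 2 = 0"
    using assms by (simp_all add: pair_axis_def axis_line_subset_iff apolar_def)
  then show ?thesis
    using inf by (intro exI[of _ "c $ 3", OF exI[of _ "c $ 4"]]) (simp add: vec4_eq_iff)
next
  case (fin t)
  have c3: "c $ 3 = - (2 * t * c $ 2) - 3 * t ^ 2 * c $ 1"
    using assms(3) by (simp add: fin pair_axis_def axis_line_subset_iff apolar_def algebra_simps
        eq_neg_iff_add_eq_0 power2_eq_square)
  have "3 * c $ 4 = - (2 * t * c $ 3) - t ^ 2 * c $ 2"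
    using assms(3) by (simp add: fin pair_axis_def axis_line_subset_iff apolar_def algebra_simps
        eq_neg_iff_add_eq_0 power2_eq_square)
  then have "3 * c $ 4 = 3 * (t ^ 2 * (c $ 2 + 2 * t * c $ 1))"
    unfolding c3 by (simp add: algebra_simps power2_eq_square)
  then have "c $ 4 = t ^ 2 * (c $ 2 + 2 * t * c $ 1)"
    using assms(1) by (simp only: mult_cancel_left) simp
  then show ?thesis
    by (intro exI[of _ "c $ 1", OF exI[of _ "c $ 2 + 2 * t * c $ 1"]])
      (simp add: fin vec4_eq_iff c3 algebra_simps power2_eq_square)
qed

lemma card_cubic_pts_double_plane:
  fixes H :: "('a::finite_field ^ 4) set"
  assumes "(3 :: 'a) \<noteq> 0" "H \<in> double_planes"
  shows "card (cubic_pts H) = 2"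
proof -
  obtain v where v: "v \<in> P1" "pair_axis v v \<subseteq> H"
    using assms(2) unfolding double_planes_def by blast
  obtain c where c: "c \<noteq> 0" "H = plane_of c"
    using assms(2) proj_plane_eq_plane_of unfolding double_planes_def by blast
  obtain e f where ef: "c = e *s vector [snd v ^ 2, - (2 * fst v * snd v), fst v ^ 2, 0]
      + f *s vector [0, snd v ^ 2, - (2 * fst v * snd v), fst v ^ 2]"
    using tangent_cubic_form[OF assms(1) v(1)] v c by blast
  then have "(e, f) \<noteq> (0, 0)"
    using c by auto
  then obtain w where w: "w \<in> P1" "{z \<in> P1. e * fst z + f * snd z = 0} = {w}"
    using linear_form_root by blast
  have "pt z \<in> H \<longleftrightarrow> bracket z v ^ 2 * (e * fst z + f * snd z) = 0" for z
  proof -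
    have "c $ 1 * pt z $ 1 + c $ 2 * pt z $ 2 + c $ 3 * pt z $ 3 + c $ 4 * pt z $ 4
        = bracket z v ^ 2 * (e * fst z + f * snd z)"
      by (simp add: ef pt_def bracket_def algebra_simps power2_eq_square power3_eq_cube)
    then show ?thesis
      by (simp add: c mem_plane_of)
  qed
  then have "cubic_pts H = {v, w}"
    using v w by (auto simp: cubic_pts_def bracket_eq_0_iff)
  moreover have "v \<noteq> w"
  proof
    assume "v = w"
    then have "e * fst v + f * snd v = 0"
      using w by blast
    consider "v = (1, 0)" | t where "v = (t, 1)"
      using v(1) by (rule P1_cases)
    \<comment> \<open>A linear form vanishing at \<open>v\<close> is a multiple of the bracket with
      \<open>v\<close>; the cubic form is then a cube, which the plane being non-osculating
      excludes.\<close>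
    then obtain k where "e = k * snd v" "f = - (k * fst v)"
    proof cases
      case 1
      then show ?thesis
        using \<open>e * fst v + f * snd v = 0\<close> that[of "- f"] by simp
    next
      case (2 t)
      then show ?thesis
        using \<open>e * fst v + f * snd v = 0\<close> that[of e] by (simp add: eq_neg_iff_add_eq_0 add.commute)
    qed
    then have "c = k *s osc v"
      by (simp add: ef osc_def vec4_eq_iff algebra_simps power2_eq_square power3_eq_cube)
    moreover from this have "k \<noteq> 0"
      using c by auto
    ultimately have "H = osc_plane v"
      using plane_of_scale[of k "osc v"] c by (simp add: osc_plane_def)
    then show False
      using assms(2) v by (auto simp: double_planes_def Gamma_planes_eq)
  qed
  ultimately show ?thesis
    by simp
qed

section \<open>Identifying the types of planes by their cardinalities\<close>

lemma double_planes_eq: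
  assumes "(3 :: 'a::finite_field) \<noteq> 0" "CARD('a) \<ge> 3"
  shows "double_planes = (C_planes 2 :: ('a ^ 4) set set)"
proof (rule card_subset_eq)
  show "double_planes \<subseteq> (C_planes 2 :: ('a ^ 4) set set)"
    using card_cubic_pts_double_plane[OF assms(1)] by (auto simp: C_planes_eq double_planes_def)
  have "int (card (double_planes :: ('a ^ 4) set set)) = int (card (C_planes 2 :: ('a ^ 4) set set))"
    unfolding card_C_planes(2)[OF assms(2)] card_double_planes[OF assms(1)]
    by (simp add: algebra_simps power2_eq_square)
  then show "card (double_planes :: ('a ^ 4) set set) = card (C_planes 2 :: ('a ^ 4) set set)"
    by (simp only: of_nat_eq_iff)
qed simp

lemma nonosc_planes_partition:
  "nonosc_planes = C_planes 0 \<union> one_bar_planes \<union> C_planes 2 \<union> (C_planes 3 :: ('a::finite_field ^ 4) set set)"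
proof -
  have "H \<notin> Gamma_planes" if "card (cubic_pts H) \<noteq> 1" for H :: "('a ^ 4) set"
    using that by (auto simp: Gamma_planes_eq cubic_pts_osc_plane)
  moreover have "H \<in> C_planes 0 \<union> C_planes 1 \<union> C_planes 2 \<union> C_planes 3"
    if "H \<in> proj_planes" for H :: "('a ^ 4) set"
    using card_cubic_pts_plane_mem[OF that] that unfolding C_planes_eq by blast
  ultimately show ?thesis
    unfolding one_bar_planes_def by (auto simp: C_planes_eq)
qed

lemma split_planes_eq_1:
  assumes "(3 :: 'a::finite_field) \<noteq> 0" "CARD('a) \<ge> 3" "CARD('a) mod 3 = 1"
  shows "split_planes = C_planes 0 \<union> (C_planes 3 :: ('a ^ 4) set set)"
proof (rule card_subset_eq)
  show "split_planes \<subseteq> C_planes 0 \<union> (C_planes 3 :: ('a ^ 4) set set)"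
  proof
    fix H :: "('a ^ 4) set" assume H: "H \<in> split_planes"
    then have "card (cubic_pts H) \<in> {0, 3}"
      using card_cubic_pts_split_plane[OF assms(1) H] card_cube_roots_1[OF assms(3)] by metis
    then show "H \<in> C_planes 0 \<union> C_planes 3"
      using H by (auto simp: C_planes_eq split_planes_def)
  qed
  have "C_planes 0 \<inter> C_planes 3 = ({} :: ('a ^ 4) set set)"
    by (auto simp: C_planes_eq)
  then have "card (C_planes 0 \<union> (C_planes 3 :: ('a ^ 4) set set))
      = card (C_planes 0 :: ('a ^ 4) set set) + card (C_planes 3 :: ('a ^ 4) set set)"
    by (intro card_Un_disjoint) auto
  moreover have "2 * int (card (split_planes :: ('a ^ 4) set set)) = int CARD('a) ^ 3 - int CARD('a)"
    unfolding card_split_planes[OF assms(1)] by (simp add: algebra_simps power3_eq_cube)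
  ultimately show "card (split_planes :: ('a ^ 4) set set) = card (C_planes 0 \<union> (C_planes 3 :: ('a ^ 4) set set))"
    using card_C_planes(1,4)[OF assms(2)] by linarith
qed simp

lemma split_planes_eq_2:
  assumes "(3 :: 'a::finite_field) \<noteq> 0" "CARD('a) \<ge> 3" "CARD('a) mod 3 = 2"
  shows "split_planes = (one_bar_planes :: ('a ^ 4) set set)"
proof (rule card_subset_eq)
  show "split_planes \<subseteq> (one_bar_planes :: ('a ^ 4) set set)"
  proof
    fix H :: "('a ^ 4) set" assume H: "H \<in> split_planes"
    then have "card (cubic_pts H) = 1"
      using card_cubic_pts_split_plane[OF assms(1) H] card_cube_roots_2[OF assms(3)] by metis
    then show "H \<in> one_bar_planes"
      using H by (auto simp: C_planes_eq split_planes_def one_bar_planes_def)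
  qed
  have "2 * int (card (split_planes :: ('a ^ 4) set set)) = int CARD('a) ^ 3 - int CARD('a)"
    unfolding card_split_planes[OF assms(1)] by (simp add: algebra_simps power3_eq_cube)
  then show "card (split_planes :: ('a ^ 4) set set) = card (one_bar_planes :: ('a ^ 4) set set)"
    using card_one_bar_planes[OF assms(2)] by linarith
qed simp

section \<open>Imaginary axes and chords over the base field\<close>

lemma poly_eq_0_if_many_roots:
  fixes p :: "'a::idom poly"
  assumes "degree p \<le> n" "coeff p n = 0" "n > 0" "n \<le> card S" "\<And>x. x \<in> S \<Longrightarrow> poly p x = 0"
  shows "p = 0"
proof (rule ccontr)
  assume "p \<noteq> 0"
  then have "degree p \<noteq> n"
    using assms(2) by (metis leading_coeff_0_iff)
  moreover have "card S \<le> card {x. poly p x = 0}"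
    using assms(5) \<open>p \<noteq> 0\<close> by (intro card_mono poly_roots_finite) auto
  moreover have "card {x. poly p x = 0} \<le> degree p"
    using \<open>p \<noteq> 0\<close> by (rule card_poly_roots_bound)
  ultimately show False
    using assms(1,4) by linarith
qed

lemma card_range_to_ac: "card (range (to_ac :: 'a::finite_field \<Rightarrow> _)) = CARD('a)"
  by (rule card_image[OF inj_to_ac])

lemma to_ac_power_card [simp]: "to_ac (x :: 'a::finite_field) ^ CARD('a) = to_ac x"
  by (metis finite_field_power_card_eq_same to_ac_power)

text \<open>
  As a polynomial in \<open>x\<close>, the difference of both sides has degree less than \<open>q\<close> but vanishes at the
  \<open>q\<close> elements of the base field as soon as the identity holds there; this is applied first with \<open>y\<close>
  in the base field.
\<close>

lemma power_card_add:
  fixes x y :: "'a::finite_field alg_closure"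
  shows "(x + y) ^ CARD('a) = x ^ CARD('a) + y ^ CARD('a)"
proof -
  let ?q = "CARD('a)"
  have q: "?q \<ge> 2"
    by (rule finite_field_card_ge_2)
  have *: "(x + y) ^ ?q = x ^ ?q + y ^ ?q" if "\<And>t :: 'a. (to_ac t + y) ^ ?q = to_ac t ^ ?q + y ^ ?q"
    for x y :: "'a alg_closure"
  proof -
    define p where "p = [:y, 1:] ^ ?q - [:0, 1:] ^ ?q - [:y ^ ?q:]"
    have "p = 0"
    proof (rule poly_eq_0_if_many_roots)
      show "degree p \<le> ?q"
        unfolding p_def by (intro degree_diff_le) (simp_all add: degree_linear_power)
      show "coeff p ?q = 0"
        using q by (simp add: p_def coeff_linear_power coeff_pCons split: nat.split)
      show "?q \<le> card (range (to_ac :: 'a \<Rightarrow> _))"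
        by (simp add: card_range_to_ac)
      show "poly p z = 0" if "z \<in> range to_ac" for z
        using that \<open>\<And>t. (to_ac t + y) ^ ?q = to_ac t ^ ?q + y ^ ?q\<close>
        by (auto simp: p_def add.commute)
    qed (use q in simp)
    then have "poly p x = 0"
      by simp
    then show ?thesis
      by (simp add: p_def algebra_simps)
  qed
  have base: "(x + to_ac s) ^ ?q = x ^ ?q + to_ac s ^ ?q" for x and s :: 'a
  proof (rule *)
    fix t :: 'a
    show "(to_ac t + to_ac s) ^ ?q = to_ac t ^ ?q + to_ac s ^ ?q"
      using to_ac_power_card[of "t + s"] by simp
  qed
  show ?thesis
  proof (rule *)
    fix t :: 'a
    show "(to_ac t + y) ^ ?q = to_ac t ^ ?q + y ^ ?q"
      using base[of y t] by (simp add: add.commute)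
  qed
qed

text \<open>The polynomial X^q - X has at most q roots, and the base field already supplies q of
  them.\<close>

lemma power_card_fixed_iff:
  fixes x :: "'a::finite_field alg_closure"
  shows "x ^ CARD('a) = x \<longleftrightarrow> x \<in> range to_ac"
proof -
  let ?q = "CARD('a)" and ?p = "monom 1 CARD('a) - [:0, 1:] :: 'a alg_closure poly"
  have q: "?q \<ge> 2"
    by (rule finite_field_card_ge_2)
  have "coeff ?p ?q = 1"
    using q by (simp add: coeff_pCons split: nat.split)
  then have nz: "?p \<noteq> 0"
    by (metis coeff_0 zero_neq_one)
  have "card {x. poly ?p x = 0} \<le> degree ?p"
    using nz by (rule card_poly_roots_bound)
  also have "\<dots> \<le> ?q"
    using q by (intro degree_diff_le) (auto simp: degree_monom_le)
  finally have "range to_ac = {x. poly ?p x = 0}"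
    using nz card_range_to_ac[where 'a = 'a] poly_roots_finite[OF nz]
    by (intro card_seteq) (auto simp: poly_monom)
  then show ?thesis
    by (auto simp: poly_monom set_eq_iff)
qed

text \<open>Raising to the power q exchanges \<open>s\<close> and its conjugate, so their sum and
  product are fixed and lie in the base field. A root of the quadratic in the base field would be
  one of the two, and then \<open>s\<close> itself.\<close>

lemma quad_nonbase_imp_irr:
  fixes s :: "'a::finite_field alg_closure"
  assumes "s \<in> quad_nonbase"
  obtains a b where "irr a b" "to_ac a = s + s ^ CARD('a)" "to_ac b = s * s ^ CARD('a)" "s \<noteq> s ^ CARD('a)"
proof -
  let ?q = "CARD('a)"
  define s' where "s' = s ^ ?q"
  have s: "s ^ (?q ^ 2) = s" "s \<notin> range to_ac"
    using assms by (auto simp: quad_nonbase_def)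
  have s'q: "s' ^ ?q = s"
    using s(1) by (simp add: s'_def power2_eq_square power_mult)
  have "(s + s') ^ ?q = s + s'" "(s * s') ^ ?q = s * s'"
    by (simp_all only: power_card_add power_mult_distrib s'q) (simp_all add: s'_def add.commute mult.commute)
  then obtain a b where ab: "to_ac a = s + s'" "to_ac b = s * s'"
    by (metis power_card_fixed_iff imageE)
  have "s \<noteq> s'"
    using s(2) power_card_fixed_iff[of s] by (simp add: s'_def)
  moreover have "irr a b"
    unfolding irr_def
  proof (intro allI notI)
    fix t assume "t ^ 2 - a * t + b = 0"
    then have "to_ac (t ^ 2 - a * t + b) = 0"
      by (simp only: to_ac_0)
    then have "(to_ac t - s) * (to_ac t - s') = 0"
      by (simp add: ab algebra_simps power2_eq_square)
    then have "s = to_ac t \<or> s' = to_ac t"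
      by auto
    then have "s = to_ac t"
      using s'q to_ac_power_card by metis
    then show False
      using s(2) by blast
  qed
  ultimately show thesis
    using that ab by (simp add: s'_def)
qed

text \<open>Take a root \<open>s\<close> in the algebraic closure. The Frobenius map preserves the
  quadratic, so \<open>s'\<close> is a root too, and it differs from \<open>s\<close> because
  \<open>s\<close> lies outside the base field.\<close>

lemma irr_imp_quad_nonbase:
  fixes a b :: "'a::finite_field"
  assumes "irr a b"
  obtains s where "s \<in> quad_nonbase" "to_ac a = s + s ^ CARD('a)" "to_ac b = s * s ^ CARD('a)" "s \<noteq> s ^ CARD('a)"
proof -
  let ?q = "CARD('a)"
  have "\<exists>s. poly [:to_ac b, - to_ac a, 1:] s = 0"
    by (intro alg_closed_imp_poly_has_root) simp
  then obtain s where "to_ac b + s * (s - to_ac a) = 0"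
    by (auto simp: algebra_simps)
  then have s2: "s ^ 2 = to_ac a * s + to_ac (- b)"
    by (simp add: algebra_simps power2_eq_square eq_neg_iff_add_eq_0)
  have nb: "s \<notin> range to_ac"
  proof
    assume "s \<in> range to_ac"
    then obtain t where t: "s = to_ac t"
      by blast
    then have "to_ac (t ^ 2) = to_ac (a * t - b)"
      using s2 by simp
    then have "t ^ 2 - a * t + b = 0"
      by (simp only: to_ac_eq_iff) simp
    then show False
      using assms by (simp add: irr_def)
  qed
  define s' where "s' = s ^ ?q"
  have ne: "s \<noteq> s'"
    using nb power_card_fixed_iff[of s] by (simp add: s'_def)
  have "s' ^ 2 = (s ^ 2) ^ ?q"
    by (simp add: s'_def mult.commute flip: power_mult)
  also have "\<dots> = to_ac a * s' + to_ac (- b)"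
    unfolding s2 power_card_add power_mult_distrib to_ac_power_card s'_def ..
  finally have "s' ^ 2 - s ^ 2 = to_ac a * (s' - s)"
    unfolding s2 by (simp add: algebra_simps)
  then have "(s' - s) * (s' + s) = (s' - s) * to_ac a"
    by (simp add: algebra_simps power2_eq_square)
  then have a: "to_ac a = s + s'"
    using ne by (simp add: add.commute)
  have b: "to_ac b = s * s'"
    using s2 by (simp add: a algebra_simps power2_eq_square eq_neg_iff_add_eq_0)
  \<comment> \<open>Applying the Frobenius map to the trace, which it fixes, shows that its second
    power fixes \<open>s\<close>.\<close>
  have "s + s' = s' + s' ^ ?q"
    using power_card_add[of s s'] to_ac_power_card[of a] by (simp add: a s'_def)
  then have "s' ^ ?q = s"
    by simp
  then have "s ^ (?q ^ 2) = s"
    by (simp add: s'_def power2_eq_square power_mult)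
  then show thesis
    using that[of s] nb a b ne by (auto simp: quad_nonbase_def s'_def)
qed

text \<open>The two left-hand sides arise from the osculating plane at a root \<open>s\<close> of
  t^2 - a t + b: reducing its equation by s^2 = a s - b leaves the first one plus \<open>s\<close>
  times the second one.\<close>

lemma mem_axis_line_monic:
  fixes x :: "'a::field ^ 4"
  assumes "(3 :: 'a) \<noteq> 0"
  shows "x \<in> axis_line 1 (- a) b \<longleftrightarrow>
    x $ 1 - 3 * b * x $ 3 + a * b * x $ 4 = 0 \<and> - 3 * x $ 2 + 3 * a * x $ 3 - (a ^ 2 - b) * x $ 4 = 0"
    (is "_ \<longleftrightarrow> ?A = 0 \<and> ?B = 0")
proof
  have "axis_line 1 (- a) b \<subseteq> plane_of (vector [1, 0, - 3 * b, a * b])"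
    "axis_line 1 (- a) b \<subseteq> plane_of (vector [0, - 3, 3 * a, - (a ^ 2 - b)])"
    by (simp_all add: axis_line_subset_iff apolar_def algebra_simps power2_eq_square)
  moreover assume "x \<in> axis_line 1 (- a) b"
  ultimately have "x \<in> plane_of (vector [1, 0, - 3 * b, a * b])"
    "x \<in> plane_of (vector [0, - 3, 3 * a, - (a ^ 2 - b)])"
    by blast+
  then show "?A = 0 \<and> ?B = 0"
    by (simp add: mem_plane_of algebra_simps)
next
  assume AB: "?A = 0 \<and> ?B = 0"
  let ?u = "vector [3 * b, - (- a), 1, 0] :: 'a ^ 4" and ?v = "vector [0, - b, - a, - (3 * 1)] :: 'a ^ 4"
  \<comment> \<open>The coefficients are read off from the last two coordinates; the factor 3 avoids
    a division.\<close>
  have "3 *s x = (3 * x $ 3 - a * x $ 4) *s ?u + (- x $ 4) *s ?v"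
  proof -
    have x1: "x $ 1 = 3 * b * x $ 3 - a * b * x $ 4"
      and x2: "3 * x $ 2 = 3 * a * x $ 3 - (a ^ 2 - b) * x $ 4"
      using AB by (simp_all add: algebra_simps)
    show ?thesis
      by (simp add: vec4_eq_iff x1 x2) (simp add: algebra_simps power2_eq_square)
  qed
  moreover have "(3 * x $ 3 - a * x $ 4) *s ?u + (- x $ 4) *s ?v \<in> axis_line 1 (- a) b"
    unfolding axis_line_def by (intro vec.span_add vec.span_scale) (auto intro: vec.span_base)
  ultimately have "inverse 3 *s (3 *s x) \<in> axis_line 1 (- a) b"
    unfolding axis_line_def by (metis vec.span_scale)
  then show "x \<in> axis_line 1 (- a) b"
    using assms by simp
qed

lemma imaginary_axis_eq:
  fixes a b :: "'a::finite_field"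
  assumes "(3 :: 'a) \<noteq> 0" "to_ac a = s + s'" "to_ac b = s * s'" "s \<noteq> s'"
  shows "vec_to_ac -` (plane_of (osc_vec s) \<inter> plane_of (osc_vec s')) = axis_line 1 (- a) b"
proof (rule Set.set_eqI)
  fix x :: "'a ^ 4"
  define A where "A = x $ 1 - 3 * b * x $ 3 + a * b * x $ 4"
  define B where "B = - 3 * x $ 2 + 3 * a * x $ 3 - (a ^ 2 - b) * x $ 4"
  have "vec_to_ac x \<in> plane_of (osc_vec s) \<longleftrightarrow> to_ac A + to_ac B * s = 0"
    by (simp add: mem_plane_of vec_to_ac_def osc_vec_def A_def B_def assms(2,3) algebra_simps
        power2_eq_square power3_eq_cube)
  moreover have "vec_to_ac x \<in> plane_of (osc_vec s') \<longleftrightarrow> to_ac A + to_ac B * s' = 0"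
    by (simp add: mem_plane_of vec_to_ac_def osc_vec_def A_def B_def assms(2,3) algebra_simps
        power2_eq_square power3_eq_cube)
  moreover have "to_ac A + to_ac B * s = 0 \<and> to_ac A + to_ac B * s' = 0 \<longleftrightarrow> A = 0 \<and> B = 0"
  proof
    assume *: "to_ac A + to_ac B * s = 0 \<and> to_ac A + to_ac B * s' = 0"
    \<comment> \<open>Two distinct roots of the linear polynomial A + B X force both of its
      coefficients to vanish.\<close>
    have "to_ac B * (s - s') = (to_ac A + to_ac B * s) - (to_ac A + to_ac B * s')"
      by (simp add: algebra_simps)
    then have "to_ac B * (s - s') = 0"
      using * by simp
    then show "A = 0 \<and> B = 0"
      using * assms(4) by simp
  qed simp
  ultimately show "x \<in> vec_to_ac -` (plane_of (osc_vec s) \<inter> plane_of (osc_vec s')) \<longleftrightarrow> x \<in> axis_line 1 (- a) b"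
    by (simp add: mem_axis_line_monic[OF assms(1)] A_def B_def)
qed

text \<open>The chord joining the points whose parameters are the roots of \<open>t\<^sup>2 - a t + b\<close>.\<close>

definition chord_line :: "'a::field \<Rightarrow> 'a \<Rightarrow> ('a ^ 4) set" where
  "chord_line a b = vec.span {vector [a ^ 2 - b, a, 1, 0], vector [- (a * b), - b, 0, 1]}"

lemma chord_line_proj_line: "chord_line a b \<in> proj_lines"
proof -
  let ?x = "vector [a ^ 2 - b, a, 1, 0] :: 'a ^ 4" and ?y = "vector [- (a * b), - b, 0, 1] :: 'a ^ 4"
  have "?y \<noteq> 0"
    by (auto simp: vec4_eq_iff)
  moreover have "?x \<notin> vec.span {?y}"
    by (auto simp: vec.span_singleton vec4_eq_iff)
  ultimately have "vec.dim {?x, ?y} = 2"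
    by (simp add: vec.dim_insert)
  then show ?thesis
    by (simp add: proj_lines_def chord_line_def)
qed

text \<open>The conditions say that x^2 - a x y + b y^2 divides the cubic form of \<open>c\<close>;
  the quotient has coefficients \<open>c $ 1\<close> and \<open>c $ 2 + a * c $ 1\<close>.\<close>

lemma chord_line_subset_iff:
  "chord_line a b \<subseteq> plane_of c \<longleftrightarrow>
     c $ 3 = - (a * c $ 2) - (a ^ 2 - b) * c $ 1 \<and> c $ 4 = a * b * c $ 1 + b * c $ 2"
  by (simp add: chord_line_def span_subset_plane_of_iff mem_plane_of)
    (auto simp: algebra_simps eq_neg_iff_add_eq_0 add_eq_0_iff)

text \<open>The equations are a linear recurrence with characteristic polynomial t^2 - a t + b,
  which the powers of its roots satisfy.\<close>

lemma mem_chord_line: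
  "x \<in> chord_line a b \<longleftrightarrow> x $ 1 - a * x $ 2 + b * x $ 3 = 0 \<and> x $ 2 - a * x $ 3 + b * x $ 4 = 0"
    (is "_ \<longleftrightarrow> ?A = 0 \<and> ?B = 0")
proof
  have "chord_line a b \<subseteq> plane_of (vector [1, - a, b, 0])" "chord_line a b \<subseteq> plane_of (vector [0, 1, - a, b])"
    by (simp_all add: chord_line_subset_iff algebra_simps power2_eq_square)
  moreover assume "x \<in> chord_line a b"
  ultimately have "x \<in> plane_of (vector [1, - a, b, 0])" "x \<in> plane_of (vector [0, 1, - a, b])"
    by blast+
  then show "?A = 0 \<and> ?B = 0"
    by (simp add: mem_plane_of algebra_simps)
next
  assume AB: "?A = 0 \<and> ?B = 0"
  have x2: "x $ 2 = a * x $ 3 - b * x $ 4"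
    using AB by (simp add: algebra_simps)
  have x1: "x $ 1 = a * x $ 2 - b * x $ 3"
    using AB by (simp add: algebra_simps)
  have "x = x $ 3 *s vector [a ^ 2 - b, a, 1, 0] + x $ 4 *s vector [- (a * b), - b, 0, 1]"
    by (simp add: vec4_eq_iff x1 x2 algebra_simps power2_eq_square)
  moreover have "x $ 3 *s vector [a ^ 2 - b, a, 1, 0] + x $ 4 *s vector [- (a * b), - b, 0, 1] \<in> chord_line a b"
    unfolding chord_line_def by (intro vec.span_add vec.span_scale) (auto intro: vec.span_base)
  ultimately show "x \<in> chord_line a b"
    by metis
qed

lemma imaginary_chord_eq:
  fixes a b :: "'a::finite_field"
  assumes "to_ac a = s + s'" "to_ac b = s * s'" "s \<noteq> s'"
  shows "vec_to_ac -` vec.span {cubic_vec s, cubic_vec s'} = chord_line a b"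
proof (rule Set.set_eqI)
  fix x :: "'a ^ 4"
  let ?A = "x $ 1 - a * x $ 2 + b * x $ 3" and ?B = "x $ 2 - a * x $ 3 + b * x $ 4"
  let ?\<A> = "vector [1, - to_ac a, to_ac b, 0]" and ?\<B> = "vector [0, 1, - to_ac a, to_ac b]"
  have "vec_to_ac x \<in> vec.span {cubic_vec s, cubic_vec s'} \<longleftrightarrow> ?A = 0 \<and> ?B = 0"
  proof
    have "vec.span {cubic_vec s, cubic_vec s'} \<subseteq> plane_of ?\<A>" "vec.span {cubic_vec s, cubic_vec s'} \<subseteq> plane_of ?\<B>"
      by (simp_all add: span_subset_plane_of_iff mem_plane_of cubic_vec_def assms algebra_simps
          power2_eq_square power3_eq_cube)
    moreover assume "vec_to_ac x \<in> vec.span {cubic_vec s, cubic_vec s'}"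
    ultimately have "vec_to_ac x \<in> plane_of ?\<A>" "vec_to_ac x \<in> plane_of ?\<B>"
      by blast+
    then have "to_ac ?A = 0" "to_ac ?B = 0"
      by (simp_all add: mem_plane_of vec_to_ac_def algebra_simps)
    then show "?A = 0 \<and> ?B = 0"
      by (simp only: to_ac_eq_0_iff)
  next
    assume AB: "?A = 0 \<and> ?B = 0"
    define y where "y = vec_to_ac x"
    have "to_ac ?A = 0" "to_ac ?B = 0"
      using AB by (simp_all only: to_ac_0)
    then have y1: "y $ 1 = (s + s') * y $ 2 - s * s' * y $ 3" and y2: "y $ 2 = (s + s') * y $ 3 - s * s' * y $ 4"
      by (simp_all add: y_def vec_to_ac_def assms algebra_simps eq_neg_iff_add_eq_0)
    \<comment> \<open>The coefficients come from Cramer's rule for the last two coordinates; the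
      recurrence takes care of the first two.\<close>
    have "(s - s') *s y = (y $ 3 - s' * y $ 4) *s cubic_vec s + (s * y $ 4 - y $ 3) *s cubic_vec s'"
      by (simp add: vec4_eq_iff cubic_vec_def y1 y2 algebra_simps power2_eq_square power3_eq_cube)
    moreover have "(y $ 3 - s' * y $ 4) *s cubic_vec s + (s * y $ 4 - y $ 3) *s cubic_vec s'
        \<in> vec.span {cubic_vec s, cubic_vec s'}"
      by (intro vec.span_add vec.span_scale) (auto intro: vec.span_base)
    ultimately have "inverse (s - s') *s ((s - s') *s y) \<in> vec.span {cubic_vec s, cubic_vec s'}"
      by (metis vec.span_scale)
    then show "vec_to_ac x \<in> vec.span {cubic_vec s, cubic_vec s'}"
      using assms(3) by (simp add: y_def)
  qed
  then show "x \<in> vec_to_ac -` vec.span {cubic_vec s, cubic_vec s'} \<longleftrightarrow> x \<in> chord_line a b"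
    by (simp add: mem_chord_line)
qed

lemma imaginary_axes_eq:
  assumes "(3 :: 'a::finite_field) \<noteq> 0"
  shows "imaginary_axes = {axis_line 1 (- a) (b :: 'a) |a b. irr a b}"
proof (intro equalityI subsetI)
  fix L :: "('a ^ 4) set" assume "L \<in> imaginary_axes"
  then obtain s where s: "s \<in> quad_nonbase"
    "L = vec_to_ac -` (plane_of (osc_vec s) \<inter> plane_of (osc_vec (s ^ CARD('a))))"
    unfolding imaginary_axes_def by blast
  obtain a b where "irr a b" "to_ac a = s + s ^ CARD('a)" "to_ac b = s * s ^ CARD('a)" "s \<noteq> s ^ CARD('a)"
    using quad_nonbase_imp_irr[OF s(1)] .
  then show "L \<in> {axis_line 1 (- a) b |a b. irr a b}"
    using imaginary_axis_eq[OF assms, of a s "s ^ CARD('a)" b] s(2) by blast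
next
  fix L :: "('a ^ 4) set" assume "L \<in> {axis_line 1 (- a) b |a b. irr a b}"
  then obtain a b where ab: "irr a b" "L = axis_line 1 (- a) b"
    by blast
  obtain s where s: "s \<in> quad_nonbase" "to_ac a = s + s ^ CARD('a)" "to_ac b = s * s ^ CARD('a)" "s \<noteq> s ^ CARD('a)"
    using irr_imp_quad_nonbase[OF ab(1)] .
  have "L = vec_to_ac -` (plane_of (osc_vec s) \<inter> plane_of (osc_vec (s ^ CARD('a))))"
    using imaginary_axis_eq[OF assms s(2-4)] ab(2) by simp
  moreover have "L \<in> proj_lines"
    using axis_line_proj_line[OF assms] ab(2) by simp
  ultimately show "L \<in> imaginary_axes"
    unfolding imaginary_axes_def using s(1) by blast
qed

lemma imaginary_chords_eq:
  "imaginary_chords = {chord_line a (b :: 'a::finite_field) |a b. irr a b}"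
proof (intro equalityI subsetI)
  fix L :: "('a ^ 4) set" assume "L \<in> imaginary_chords"
  then obtain s where s: "s \<in> quad_nonbase"
    "L = vec_to_ac -` vec.span {cubic_vec s, cubic_vec (s ^ CARD('a))}"
    unfolding imaginary_chords_def by blast
  obtain a b where "irr a b" "to_ac a = s + s ^ CARD('a)" "to_ac b = s * s ^ CARD('a)" "s \<noteq> s ^ CARD('a)"
    using quad_nonbase_imp_irr[OF s(1)] .
  then show "L \<in> {chord_line a b |a b. irr a b}"
    using imaginary_chord_eq[of a s "s ^ CARD('a)" b] s(2) by blast
next
  fix L :: "('a ^ 4) set" assume "L \<in> {chord_line a b |a b. irr a b}"
  then obtain a b where ab: "irr a b" "L = chord_line a b"
    by blast
  obtain s where s: "s \<in> quad_nonbase" "to_ac a = s + s ^ CARD('a)" "to_ac b = s * s ^ CARD('a)" "s \<noteq> s ^ CARD('a)"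
    using irr_imp_quad_nonbase[OF ab(1)] .
  have "L = vec_to_ac -` vec.span {cubic_vec s, cubic_vec (s ^ CARD('a))}"
    using imaginary_chord_eq[OF s(2-4)] ab(2) by simp
  moreover have "L \<in> proj_lines"
    using chord_line_proj_line ab(2) by simp
  ultimately show "L \<in> imaginary_chords"
    unfolding imaginary_chords_def using s(1) by blast
qed

section \<open>Imaginary axes and chords in planes\<close>

lemma irr_qform_neq_0: "irr a b \<Longrightarrow> v \<in> P1 \<Longrightarrow> qform 1 (- a) b v \<noteq> 0"
  by (auto simp: irr_def qform_def elim!: P1_cases)

text \<open>With \<open>Q = t\<^sup>2 - a t + b\<close> the two equations read \<open>Q (a - 2 t) = 0\<close> and \<open>3 Q = 4 b - a\<^sup>2\<close>.\<close>

lemma irr_no_triple_root: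
  fixes a b t :: "'a::field"
  assumes "irr a b" "t ^ 3 - 3 * b * t + a * b = 0" "- 3 * t ^ 2 + 3 * a * t - (a ^ 2 - b) = 0"
  shows False
proof -
  define Q where "Q = t ^ 2 - a * t + b"
  have "Q \<noteq> 0"
    using assms(1) by (simp add: irr_def Q_def)
  have "Q * (a - 2 * t) = (t ^ 3 - 3 * b * t + a * b) + t * (- 3 * t ^ 2 + 3 * a * t - (a ^ 2 - b))"
    by (simp add: Q_def algebra_simps power2_eq_square power3_eq_cube)
  then have a: "a = 2 * t"
    using assms(2,3) \<open>Q \<noteq> 0\<close> by simp
  have "Q = - 3 * t ^ 2 + 3 * a * t - (a ^ 2 - b)"
    by (simp add: Q_def a algebra_simps power2_eq_square)
  then show False
    using assms(3) \<open>Q \<noteq> 0\<close> by simp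
qed

lemma irr_axis_not_subset_osc_plane:
  fixes a b :: "'a::field"
  assumes "(3 :: 'a) \<noteq> 0" "irr a b" "v \<in> P1"
  shows "\<not> axis_line 1 (- a) b \<subseteq> osc_plane v"
  using assms by (simp add: osc_plane_def axis_line_subset_iff apolar_osc_iff irr_qform_neq_0)

lemma irr_axis_external:
  fixes a b :: "'a::field"
  assumes "(3 :: 'a) \<noteq> 0" "irr a b"
  shows "axis_line 1 (- a) b \<in> external_lines"
proof -
  have "pt v \<notin> axis_line 1 (- a) b" if "v \<in> P1" for v
    using that
  proof (cases v rule: P1_cases)
    case inf
    then show ?thesis
      by (simp add: mem_axis_line_monic[OF assms(1)] pt_def)
  next
    case (fin t)
    show ?thesis
    proof
      assume "pt v \<in> axis_line 1 (- a) b"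
      then have "t ^ 3 - 3 * b * t + a * b = 0" "- 3 * t ^ 2 + 3 * a * t - (a ^ 2 - b) = 0"
        by (simp_all add: mem_axis_line_monic[OF assms(1)] pt_def fin)
      then show False
        using irr_no_triple_root[OF assms(2)] by blast
    qed
  qed
  then show ?thesis
    using axis_line_proj_line[OF assms(1)] by (auto simp: external_lines_eq cubic_pts_def)
qed

text \<open>The cube of a linear form has no irreducible quadratic factor. Comparing coefficients
  leads to the same two equations as for a point of the cubic on an imaginary axis, so
  \<open>irr_no_triple_root\<close> applies again.\<close>

lemma irr_chord_not_subset_osc_plane:
  fixes a b :: "'a::field"
  assumes "irr a b" "v \<in> P1"
  shows "\<not> chord_line a b \<subseteq> osc_plane v"
  using assms(2)
proof (cases v rule: P1_cases)
  case inf
  then show ?thesis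
    by (simp add: osc_plane_def chord_line_subset_iff osc_def)
next
  case (fin t)
  show ?thesis
  proof
    assume "chord_line a b \<subseteq> osc_plane v"
    then have *: "3 * t ^ 2 = - (a * - (3 * t)) - (a ^ 2 - b) * 1" "- (t ^ 3) = a * b * 1 + b * - (3 * t)"
      unfolding osc_plane_def chord_line_subset_iff by (simp_all add: osc_def fin)
    have "t ^ 3 - 3 * b * t + a * b = - (- (t ^ 3)) + (a * b * 1 + b * - (3 * t))"
      by (simp add: algebra_simps)
    moreover have "- 3 * t ^ 2 + 3 * a * t - (a ^ 2 - b) = - (3 * t ^ 2) + (- (a * - (3 * t)) - (a ^ 2 - b) * 1)"
      by (simp add: algebra_simps)
    ultimately have "t ^ 3 - 3 * b * t + a * b = 0" "- 3 * t ^ 2 + 3 * a * t - (a ^ 2 - b) = 0"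
      unfolding *(2)[symmetric] *(1)[symmetric] by simp_all
    then show False
      using irr_no_triple_root[OF assms(1)] by blast
  qed
qed

lemma irr_chord_external:
  fixes a b :: "'a::field"
  assumes "irr a b"
  shows "chord_line a b \<in> external_lines"
proof -
  have "pt v \<notin> chord_line a b" if "v \<in> P1" for v
    using that assms by (cases v rule: P1_cases) (auto simp: mem_chord_line pt_def irr_def)
  then show ?thesis
    by (auto simp: external_lines_eq chord_line_proj_line cubic_pts_def)
qed

text \<open>Inserting the spanning vectors of the chord into the equations of the axis gives
  \<open>a' = a\<close> and relations between \<open>a\<close>, \<open>b\<close>, \<open>b'\<close>
  which provide a root of the quadratic: outside characteristic 2 its discriminant vanishes, and in
  characteristic 2 it becomes t^2 + b.\<close>

lemma irr_chord_neq_axis: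
  fixes a b a' b' :: "'a::finite_field"
  assumes "(3 :: 'a) \<noteq> 0" "irr a b"
  shows "chord_line a b \<noteq> axis_line 1 (- a') b'"
proof
  assume eq: "chord_line a b = axis_line 1 (- a') b'"
  have "vector [a ^ 2 - b, a, 1, 0] \<in> chord_line a b" "vector [- (a * b), - b, 0, 1] \<in> chord_line a b"
    by (simp_all add: mem_chord_line algebra_simps power2_eq_square)
  then have *: "a ^ 2 - b = 3 * b'" "3 * a' = 3 * a" "a' * b' = a * b" "3 * b = a' ^ 2 - b'"
    unfolding eq mem_axis_line_monic[OF assms(1)] by (simp_all add: algebra_simps)
  then have "a' = a"
    using assms(1) by simp
  note * = *[unfolded this]
  show False
  proof (cases "(2 :: 'a) = 0")
    case True
    \<comment> \<open>In characteristic 2 every element is a square, so a quadratic with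
      \<open>a = 0\<close> has a root.\<close>
    have "inj (\<lambda>x :: 'a. x ^ 2)"
    proof (rule injI)
      fix x y :: 'a assume "x ^ 2 = y ^ 2"
      then have "(x - y) ^ 2 = 2 * (y ^ 2 - x * y)"
        by (simp add: power2_eq_square algebra_simps)
      then show "x = y"
        using True by simp
    qed
    then have "surj (\<lambda>x :: 'a. x ^ 2)"
      by (simp add: finite_UNIV_inj_surj)
    then obtain t where "- b = t ^ 2"
      by (rule surjE)
    moreover have "a = 0"
    proof (rule ccontr)
      assume "a \<noteq> 0"
      then have "b' = b"
        using *(3) by simp
      then have "a ^ 2 = 2 * (2 * b)"
        using *(1) by (simp add: algebra_simps)
      then show False
        using True \<open>a \<noteq> 0\<close> by simp
    qed
    ultimately have "t ^ 2 - a * t + b = 0"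
      by (metis add.left_inverse diff_zero mult_zero_left)
    then show False
      using assms(2) by (simp add: irr_def)
  next
    case False
    have "2 * (b - b') = (3 * b - (a ^ 2 - b')) + ((a ^ 2 - b) - 3 * b')"
      by (simp add: algebra_simps)
    then have "b' = b"
      using False *(1,4) by simp
    then have "a ^ 2 = 4 * b"
      using *(1) by (simp add: algebra_simps)
    moreover obtain h where h: "a = 2 * h"
      using False by (metis nonzero_mult_div_cancel_left times_divide_eq_right)
    moreover have "2 * (2 * (h ^ 2 - a * h + b)) = 4 * b - a ^ 2"
      by (simp add: h algebra_simps power2_eq_square)
    ultimately have "2 * (2 * (h ^ 2 - a * h + b)) = 0"
      by (metis eq_iff_diff_eq_0)
    then have "h ^ 2 - a * h + b = 0"
      using False by (metis mult_eq_0_iff)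
    then show False
      using assms(2) unfolding irr_def by blast
  qed
qed

text \<open>The quadratic factor has no zero in \<open>P1\<close>, which leaves the zeros of the
  linear cofactor.\<close>

lemma cubic_pts_plane_through_chord:
  assumes "irr a b" "chord_line a b \<subseteq> plane_of c"
  shows "cubic_pts (plane_of c) = {z \<in> P1. c $ 1 * fst z + (c $ 2 + a * c $ 1) * snd z = 0}"
proof -
  have c3: "c $ 3 = - (a * c $ 2) - (a ^ 2 - b) * c $ 1" and c4: "c $ 4 = a * b * c $ 1 + b * c $ 2"
    using assms(2) unfolding chord_line_subset_iff by blast+
  have "c $ 1 * fst z ^ 3 + c $ 2 * (fst z ^ 2 * snd z) + c $ 3 * (fst z * snd z ^ 2) + c $ 4 * snd z ^ 3
      = qform 1 (- a) b z * (c $ 1 * fst z + (c $ 2 + a * c $ 1) * snd z)" for z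
    unfolding c3 c4 by (simp add: qform_def algebra_simps power2_eq_square power3_eq_cube)
  then show ?thesis
    using irr_qform_neq_0[OF assms(1)] by (auto simp: mem_cubic_pts_plane_of)
qed

lemma chord_line_coeffs_neq_0:
  assumes "c \<noteq> 0" "chord_line a b \<subseteq> plane_of c"
  shows "(c $ 1, c $ 2 + a * c $ 1) \<noteq> (0, 0)"
  using assms by (auto simp: chord_line_subset_iff vec4_eq_iff)

lemma irr_chord_plane_one_bar:
  fixes H :: "('a::finite_field ^ 4) set"
  assumes "irr a b" "H \<in> proj_planes" "chord_line a b \<subseteq> H"
  shows "H \<in> one_bar_planes"
proof -
  obtain c where c: "c \<noteq> 0" "H = plane_of c"
    using proj_plane_eq_plane_of[OF assms(2)] .
  obtain w where "cubic_pts H = {w}"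
    using linear_form_root[OF chord_line_coeffs_neq_0[of c a b]] c assms
      cubic_pts_plane_through_chord[of a b c] by auto
  moreover have "H \<notin> Gamma_planes"
    using irr_chord_not_subset_osc_plane[OF assms(1)] assms(3) by (auto simp: Gamma_planes_eq)
  ultimately show ?thesis
    using assms(2) by (simp add: one_bar_planes_def C_planes_eq)
qed

lemma irr_chord_unique:
  assumes "c \<noteq> 0" "irr a b" "irr a' b'" "chord_line a b \<subseteq> plane_of c" "chord_line a' b' \<subseteq> plane_of c"
  shows "a = a' \<and> b = b'"
proof -
  have c3: "c $ 3 = b * c $ 1 - a * (c $ 2 + a * c $ 1)" "c $ 3 = b' * c $ 1 - a' * (c $ 2 + a' * c $ 1)"
    and c4: "c $ 4 = b * (c $ 2 + a * c $ 1)" "c $ 4 = b' * (c $ 2 + a' * c $ 1)"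
    using assms(4,5) by (simp_all add: chord_line_subset_iff algebra_simps power2_eq_square)
  show ?thesis
  proof (cases "c $ 1 = 0")
    case True
    then have "c $ 2 \<noteq> 0"
      using chord_line_coeffs_neq_0[OF assms(1,4)] by simp
    then show ?thesis
      using c3 c4 True by auto
  next
    case False
    \<comment> \<open>The root of the linear cofactor for the first chord; it must also be that for
      the second chord, which determines \<open>a\<close>.\<close>
    let ?z = "(- (c $ 2 + a * c $ 1) / c $ 1, 1)"
    have "?z \<in> cubic_pts (plane_of c)"
      unfolding cubic_pts_plane_through_chord[OF assms(2,4)] using False by simp
    then have "a' = a"
      unfolding cubic_pts_plane_through_chord[OF assms(3,5)] using False by simp
    then show ?thesis
      using c3 False by simp
  qed
qed

text \<open>Splitting off the linear factor of the only root leaves a quadratic, whose roots could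
  only be that root again. Unless the quadratic is irreducible, the form is then a cube and the
  plane osculating.\<close>

lemma one_bar_plane_has_chord:
  fixes H :: "('a::finite_field ^ 4) set"
  assumes "(3 :: 'a) \<noteq> 0" "H \<in> one_bar_planes"
  obtains a b where "irr a b" "chord_line a b \<subseteq> H"
proof -
  have H: "H \<in> proj_planes" "card (cubic_pts H) = 1" "H \<notin> Gamma_planes"
    using assms(2) by (auto simp: one_bar_planes_def C_planes_eq)
  obtain c where c: "c \<noteq> 0" "H = plane_of c"
    using proj_plane_eq_plane_of[OF H(1)] .
  obtain v where v: "cubic_pts H = {v}"
    using H(2) by (auto simp: card_1_singleton_iff)
  have root: "(t, 1) = v" if "c $ 1 * t ^ 3 + c $ 2 * t ^ 2 + c $ 3 * t + c $ 4 = 0" for t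
  proof -
    have "(t, 1) \<in> cubic_pts H"
      using that by (simp add: c mem_cubic_pts_plane_of)
    then show ?thesis
      using v by blast
  qed
  have inf_root: "c $ 1 = 0 \<longleftrightarrow> v = (1, 0)"
  proof -
    have "(1, 0) \<in> cubic_pts H \<longleftrightarrow> c $ 1 = 0"
      by (simp add: c mem_cubic_pts_plane_of)
    then show ?thesis
      using v by auto
  qed
  have "v \<in> P1"
    using v by (auto simp: cubic_pts_def)
  then consider "v = (1, 0)" | t where "v = (t, 1)"
    by (rule P1_cases)
  then show thesis
  proof cases
    case 1
    then have c1: "c $ 1 = 0"
      using inf_root by simp
    have c2: "c $ 2 \<noteq> 0"
    \<comment> \<open>If \<open>c $ 2\<close> vanished as well, the form would have a finite root or
      be a multiple of the cube with root infinity.\<close>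
    proof
      assume c2: "c $ 2 = 0"
      show False
      proof (cases "c $ 3 = 0")
        case True
        then show False
          using hess_zero_imp_Gamma[OF assms(1) c(1)] c1 c2 c H(3) by (simp add: hess0_def hess1_def hess2_def)
      next
        case False
        then show False
          using root[of "- c $ 4 / c $ 3"] c1 c2 1 by simp
      qed
    qed
    have "irr (- c $ 3 / c $ 2) (c $ 4 / c $ 2)"
      unfolding irr_def
    proof (intro allI notI)
      fix t assume "t ^ 2 - - c $ 3 / c $ 2 * t + c $ 4 / c $ 2 = 0"
      then have "c $ 2 * (t ^ 2 - - c $ 3 / c $ 2 * t + c $ 4 / c $ 2) = 0"
        by simp
      then have "c $ 1 * t ^ 3 + c $ 2 * t ^ 2 + c $ 3 * t + c $ 4 = 0"
        using c1 c2 by (simp add: algebra_simps)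
      then show False
        using root[of t] 1 by simp
    qed
    moreover have "chord_line (- c $ 3 / c $ 2) (c $ 4 / c $ 2) \<subseteq> H"
      using c1 c2 by (simp add: c chord_line_subset_iff)
    ultimately show thesis
      by (rule that)
  next
    case (2 t)
    then have c1: "c $ 1 \<noteq> 0"
      using inf_root by simp
    \<comment> \<open>Horner's scheme: \<open>c $ 1\<close>, \<open>m\<close>, \<open>n\<close> are
      the coefficients of the quotient by the linear factor with root \<open>t\<close>.\<close>
    define m where "m = c $ 2 + t * c $ 1"
    define n where "n = c $ 3 + t * m"
    have "(t, 1) \<in> cubic_pts H"
      using v 2 by simp
    then have "c $ 1 * t ^ 3 + c $ 2 * t ^ 2 + c $ 3 * t + c $ 4 = 0"
      by (simp add: c mem_cubic_pts_plane_of)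
    moreover have "c $ 4 + t * n = c $ 1 * t ^ 3 + c $ 2 * t ^ 2 + c $ 3 * t + c $ 4"
      by (simp add: n_def m_def algebra_simps power2_eq_square power3_eq_cube)
    ultimately have c4: "c $ 4 = - t * n"
      by (simp add: eq_neg_iff_add_eq_0)
    have c2: "c $ 2 = m - t * c $ 1" and c3: "c $ 3 = n - t * m"
      by (simp_all add: n_def m_def)
    have fact: "c $ 1 * r ^ 3 + c $ 2 * r ^ 2 + c $ 3 * r + c $ 4 = (r - t) * (c $ 1 * r ^ 2 + m * r + n)" for r
      by (simp add: c2 c3 c4 algebra_simps power2_eq_square power3_eq_cube)
    have quad_root: "r = t" if "c $ 1 * r ^ 2 + m * r + n = 0" for r
      using root[of r] fact[of r] that 2 by simp
    have "irr (- m / c $ 1) (n / c $ 1)"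
      unfolding irr_def
    proof (intro allI notI)
      fix r assume "r ^ 2 - - m / c $ 1 * r + n / c $ 1 = 0"
      then have "c $ 1 * (r ^ 2 - - m / c $ 1 * r + n / c $ 1) = 0"
        by simp
      then have r: "c $ 1 * r ^ 2 + m * r + n = 0"
        using c1 by (simp add: algebra_simps)
      then have "r = t"
        by (rule quad_root)
      \<comment> \<open>The other root of the quadratic, by Vieta. It must equal \<open>t\<close>
        too, so that \<open>t\<close> is a triple root.\<close>
      have "c $ 1 * (- m / c $ 1 - r) ^ 2 + m * (- m / c $ 1 - r) + n = c $ 1 * r ^ 2 + m * r + n"
        using c1 by (simp add: field_simps power2_eq_square)
      then have "- m / c $ 1 - r = t"
        using quad_root r by simp
      then have "- m / c $ 1 = 2 * t"
        using \<open>r = t\<close> by (simp add: algebra_simps)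
      moreover have "m = - (- m / c $ 1) * c $ 1"
        using c1 by simp
      ultimately have m: "m = - 2 * t * c $ 1"
        by simp
      have n: "n = t ^ 2 * c $ 1"
        using r unfolding \<open>r = t\<close> m by (simp add: algebra_simps power2_eq_square)
      have "plane_of c \<in> Gamma_planes"
        by (rule hess_zero_imp_Gamma[OF assms(1) c(1)])
          (simp_all add: hess0_def hess1_def hess2_def c2 c3 c4 m n algebra_simps power2_eq_square)
      then show False
        using H(3) c by simp
    qed
    moreover have "chord_line (- m / c $ 1) (n / c $ 1) \<subseteq> H"
      using c1 by (simp add: c chord_line_subset_iff c3 c4 field_simps power2_eq_square) (simp add: c2 algebra_simps)
    ultimately show thesis
      by (rule that)
  qed
qed

lemma card_imaginary_chords_in_plane:
  fixes H :: "('a::finite_field ^ 4) set"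
  assumes "(3 :: 'a) \<noteq> 0" "H \<in> proj_planes"
  shows "card {L \<in> imaginary_chords. L \<subseteq> H} = of_bool (H \<in> one_bar_planes)"
proof (cases "H \<in> one_bar_planes")
  case True
  obtain c where c: "c \<noteq> 0" "H = plane_of c"
    using proj_plane_eq_plane_of[OF assms(2)] .
  obtain a b where ab: "irr a b" "chord_line a b \<subseteq> H"
    using one_bar_plane_has_chord[OF assms(1) True] .
  then have "{L \<in> imaginary_chords. L \<subseteq> H} = {chord_line a b}"
    unfolding imaginary_chords_eq using irr_chord_unique[OF c(1) ab(1)] c(2) by blast
  then show ?thesis
    using True by simp
next
  case False
  then have "{L \<in> imaginary_chords. L \<subseteq> H} = {}"
    unfolding imaginary_chords_eq using irr_chord_plane_one_bar[OF _ assms(2)] by blast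
  then show ?thesis
    using False by simp
qed

lemma card_imaginary_axes_in_plane:
  fixes H :: "('a::finite_field ^ 4) set"
  assumes "(3 :: 'a) \<noteq> 0" "H \<in> nonosc_planes"
  shows "card {L \<in> imaginary_axes. L \<subseteq> H} = of_bool (H \<in> irr_planes)"
proof (cases "H \<in> irr_planes")
  case True
  obtain c where c: "c \<noteq> 0" "H = plane_of c"
    using proj_plane_eq_plane_of assms(2) by blast
  obtain a b where ab: "irr a b" "axis_line 1 (- a) b \<subseteq> H"
    using True unfolding irr_planes_def by blast
  have "L = axis_line 1 (- a) b" if L: "L \<in> imaginary_axes" "L \<subseteq> H" for L
  proof -
    obtain a' b' where "L = axis_line 1 (- a') b'"
      using L(1) unfolding imaginary_axes_eq[OF assms(1)] by blast
    then show ?thesis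
      using irr_axis_unique[OF assms(1) c(1), of a b a' b'] ab L c assms(2) by blast
  qed
  moreover have "axis_line 1 (- a) b \<in> imaginary_axes"
    unfolding imaginary_axes_eq[OF assms(1)] using ab by blast
  ultimately have "{L \<in> imaginary_axes. L \<subseteq> H} = {axis_line 1 (- a) b}"
    using ab by blast
  then show ?thesis
    using True by simp
next
  case False
  then have "{L \<in> imaginary_axes. L \<subseteq> H} = {}"
    unfolding imaginary_axes_eq[OF assms(1)] irr_planes_def using assms(2) by blast
  then show ?thesis
    using False by simp
qed

section \<open>Counting lines in planes\<close>

text \<open>Lines of the plane are sorted by their 0, 1 or 2 points on the cubic: q + 1 lines pass
  through each point, and exactly one line joins each pair. Doubling removes the binomial
  denominator.\<close>

lemma card_external_lines_in_plane:
  fixes H :: "('a::finite_field ^ 4) set"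
  assumes "H \<in> proj_planes" "CARD('a) \<ge> 3"
  shows "2 * int (card {L \<in> external_lines. L \<subseteq> H}) =
    2 * (int CARD('a) ^ 2 + int CARD('a) + 1) - 2 * int (card (cubic_pts H)) * (int CARD('a) + 1)
      + int (card (cubic_pts H)) * (int (card (cubic_pts H)) - 1)"
proof -
  let ?q = "CARD('a)" and ?\<L> = "{L \<in> proj_lines. L \<subseteq> H}" and ?n = "card (cubic_pts H)"
  define N where "N k = card {L \<in> ?\<L>. card (cubic_pts L) = k}" for k
  have sum: "(\<Sum>L\<in>?\<L>. g (card (cubic_pts L))) = N 0 * g 0 + N 1 * g 1 + N 2 * g 2" for g
  proof -
    have "card (cubic_pts L) \<in> {0, 1, 2}" if "L \<in> ?\<L>" for L
    proof -
      have "{..2 :: nat} = {0, 1, 2}"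
        by auto
      then show ?thesis
        using card_cubic_pts_line_le_2[of L] that assms(2) by blast
    qed
    then have "(\<Sum>L\<in>?\<L>. g (card (cubic_pts L)))
        = (\<Sum>k\<in>{0, 1, 2}. card {L \<in> ?\<L>. card (cubic_pts L) = k} * g k)"
      by (intro sum_by_values) simp_all
    then show ?thesis
      by (simp add: N_def del: card_0_eq card_eq_0_iff)
  qed
  have inter: "{v \<in> cubic_pts H. pt v \<in> L} = cubic_pts L" if "L \<in> ?\<L>" for L
    using that by (auto simp: cubic_pts_def)
  have "(\<Sum>L\<in>?\<L>. card {v \<in> cubic_pts H. pt v \<in> L}) = (\<Sum>v\<in>cubic_pts H. card {L \<in> ?\<L>. pt v \<in> L})"
    by (rule sum_card_swap) auto
  also have "\<dots> = (\<Sum>v\<in>cubic_pts H. ?q + 1)"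
  proof (intro sum.cong refl)
    fix v assume v: "v \<in> cubic_pts H"
    have "{L \<in> ?\<L>. pt v \<in> L} = {L \<in> proj_lines. pt v \<in> L \<and> L \<subseteq> H}"
      by auto
    then show "card {L \<in> ?\<L>. pt v \<in> L} = ?q + 1"
      using card_lines_through_in_plane[OF assms(1)] v by (simp add: cubic_pts_def pt_neq_0)
  qed
  also have "(\<Sum>L\<in>?\<L>. card {v \<in> cubic_pts H. pt v \<in> L}) = (\<Sum>L\<in>?\<L>. card (cubic_pts L))"
    using inter by (intro sum.cong refl) simp
  finally have m1: "N 1 + 2 * N 2 = ?n * (?q + 1)"
    using sum[of "\<lambda>k. k"] by simp
  let ?P = "SIGMA v:cubic_pts H. cubic_pts H - {v}"
  have "(\<Sum>L\<in>?\<L>. card {p \<in> ?P. pt (fst p) \<in> L \<and> pt (snd p) \<in> L})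
      = (\<Sum>p\<in>?P. card {L \<in> ?\<L>. pt (fst p) \<in> L \<and> pt (snd p) \<in> L})"
    by (rule sum_card_swap) auto
  also have "\<dots> = (\<Sum>p\<in>?P. 1)"
  proof (intro sum.cong refl)
    fix p assume "p \<in> ?P"
    then obtain v w where p: "p = (v, w)" and v: "v \<in> P1" "pt v \<in> H" and w: "w \<in> P1" "pt w \<in> H" "v \<noteq> w"
      by (auto simp: cubic_pts_def)
    have "vec.span {pt v, pt w} \<in> {L \<in> ?\<L>. pt v \<in> L \<and> pt w \<in> L}"
      using line_through_points[OF v(1) w(1,3)] v w assms(1)
      by (simp add: proj_planes_def span_subset_iff vec.span_base)
    moreover have "L = vec.span {pt v, pt w}" if "L \<in> ?\<L>" "pt v \<in> L" "pt w \<in> L" for L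
      using that line_through_points[OF v(1) w(1,3)] pt_neq_0[OF v(1)] pt_notin_span[OF v(1) w(1,3)]
      by (intro proj_line_eqI[where x = "pt v" and y = "pt w"]) (auto intro: vec.span_base)
    ultimately have "{L \<in> ?\<L>. pt v \<in> L \<and> pt w \<in> L} = {vec.span {pt v, pt w}}"
      by blast
    then show "card {L \<in> ?\<L>. pt (fst p) \<in> L \<and> pt (snd p) \<in> L} = 1"
      by (simp add: p)
  qed
  also have "(\<Sum>L\<in>?\<L>. card {p \<in> ?P. pt (fst p) \<in> L \<and> pt (snd p) \<in> L})
      = (\<Sum>L\<in>?\<L>. card (cubic_pts L) * (card (cubic_pts L) - 1))"
  proof (intro sum.cong refl)
    fix L assume "L \<in> ?\<L>"
    then have "{p \<in> ?P. pt (fst p) \<in> L \<and> pt (snd p) \<in> L} = (SIGMA v:cubic_pts L. cubic_pts L - {v})"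
      by (auto simp: cubic_pts_def)
    then show "card {p \<in> ?P. pt (fst p) \<in> L \<and> pt (snd p) \<in> L} = card (cubic_pts L) * (card (cubic_pts L) - 1)"
      by (simp only: card_distinct_pairs[OF finite])
  qed
  finally have m2: "2 * N 2 = ?n * (?n - 1)"
    using sum[of "\<lambda>k. k * (k - 1)"] by (simp add: card_distinct_pairs del: card_SigmaI)
  have m0: "N 0 + N 1 + N 2 = ?q ^ 2 + ?q + 1"
    using sum[of "\<lambda>_. 1"] card_lines_in_plane[OF assms(1)] by simp
  have "{L \<in> external_lines. L \<subseteq> H} = {L \<in> ?\<L>. card (cubic_pts L) = 0}"
    by (auto simp: external_lines_eq)
  then have ext: "card {L \<in> external_lines. L \<subseteq> H} = N 0"
    by (simp only: N_def)
  have "int (?n * (?n - 1)) = int ?n * (int ?n - 1)"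
    by (cases ?n) (simp_all add: algebra_simps)
  then have i2: "2 * int (N 2) = int ?n * (int ?n - 1)"
    using arg_cong[OF m2, of int] by simp
  have i1: "int (N 1) + 2 * int (N 2) = int ?n * (int ?q + 1)"
    using arg_cong[OF m1, of int] by (simp add: algebra_simps)
  have i0: "int (N 0) + int (N 1) + int (N 2) = int ?q ^ 2 + int ?q + 1"
    using arg_cong[OF m0, of int] by simp
  show ?thesis
    unfolding ext using i0 i1 i2 by (simp add: algebra_simps)
qed

section \<open>External lines sorted by the osculating planes containing them\<close>

lemma real_axis_external:
  assumes "(3 :: 'a::finite_field) \<noteq> 0" "L \<in> (real_axes :: ('a ^ 4) set set)"
  shows "L \<in> external_lines" "\<exists>w\<in>P1. L \<subseteq> osc_plane w"
proof -
  obtain u v where L: "L = pair_axis u v" and uv: "u \<in> P1" "v \<in> P1" "u \<noteq> v"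
    using assms(2) unfolding real_axes_eq[OF assms(1)] by blast
  have eq: "L = osc_plane u \<inter> osc_plane v"
    using osc_plane_inter[OF assms(1) uv] L by simp
  then have "cubic_pts L \<subseteq> cubic_pts (osc_plane u) \<inter> cubic_pts (osc_plane v)"
    by (auto simp: cubic_pts_def)
  then have "cubic_pts L = {}"
    using uv by (auto simp: cubic_pts_osc_plane)
  then show "L \<in> external_lines"
    using pair_axis_proj_line[OF assms(1) uv(1,2)] L by (simp add: external_lines_eq)
  show "\<exists>w\<in>P1. L \<subseteq> osc_plane w"
    using eq uv by blast
qed

lemma EG_lines_eq:
  "EG_lines = {L \<in> external_lines. (\<exists>w\<in>P1. L \<subseteq> osc_plane w) \<and> L \<notin> real_axes}"
  by (simp add: EG_lines_def Gamma_planes_eq)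

lemma EnG_lines_eq:
  "EnG_lines = {L \<in> external_lines. (\<forall>w\<in>P1. \<not> L \<subseteq> osc_plane w) \<and> L \<notin> imaginary_chords \<and> L \<notin> imaginary_axes}"
  by (simp add: EnG_lines_def Gamma_planes_eq)

text \<open>Lying in two osculating planes, the line would be their intersection, a real
  axis.\<close>

lemma card_osc_planes_through_EG_line:
  fixes L :: "('a::finite_field ^ 4) set"
  assumes "(3 :: 'a) \<noteq> 0" "L \<in> EG_lines"
  shows "card {w \<in> P1. L \<subseteq> osc_plane w} = 1"
proof -
  obtain w where w: "w \<in> P1" "L \<subseteq> osc_plane w"
    using assms(2) by (auto simp: EG_lines_eq)
  have "w' = w" if w': "w' \<in> P1" "L \<subseteq> osc_plane w'" for w'
  proof (rule ccontr)
    assume "w' \<noteq> w"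
    note ww = \<open>w' \<in> P1\<close> \<open>w \<in> P1\<close> this
    have "L \<in> proj_lines"
      using assms(2) by (auto simp: EG_lines_eq external_lines_eq)
    moreover have "pair_axis w' w \<in> proj_lines"
      using pair_axis_proj_line[OF assms(1) ww(1,2)] .
    moreover have "L \<subseteq> pair_axis w' w"
      using w w' osc_plane_inter[OF assms(1) ww] by blast
    ultimately have "L = pair_axis w' w"
      by (intro vec.subspace_dim_equal) (auto simp: proj_lines_def)
    then have "L \<in> real_axes"
      unfolding real_axes_eq[OF assms(1)] using ww by blast
    then show False
      using assms(2) by (simp add: EG_lines_eq)
  qed
  then have "{w \<in> P1. L \<subseteq> osc_plane w} = {w}"
    using w by blast
  then show ?thesis
    by simp
qed

text \<open>Each osculating plane meets \<open>H\<close> in one line, which is external exactly if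
  the point of osculation lies outside \<open>H\<close>. Counting these q + 1 intersections meets
  every E-Gamma line once and every real axis twice.\<close>

lemma card_EG_lines_in_nonosc_plane:
  fixes H :: "('a::finite_field ^ 4) set"
  assumes "(3 :: 'a) \<noteq> 0" "H \<in> nonosc_planes"
  shows "card {L \<in> EG_lines. L \<subseteq> H} + 2 * card {L \<in> real_axes. L \<subseteq> H} + card (cubic_pts H) = CARD('a) + 1"
proof -
  let ?E = "{L \<in> external_lines. L \<subseteq> H}"
  have "(\<Sum>L\<in>?E. card {w \<in> P1. L \<subseteq> osc_plane w}) = (\<Sum>w\<in>P1. card {L \<in> ?E. L \<subseteq> osc_plane w})"
    by (rule sum_card_swap) auto
  also have "\<dots> = (\<Sum>w\<in>P1. of_bool (w \<notin> cubic_pts H))"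
  proof (intro sum.cong refl)
    fix w :: "'a \<times> 'a" assume w: "w \<in> P1"
    have line: "H \<inter> osc_plane w \<in> proj_lines"
      using assms(2) w by (intro plane_inter_line osc_plane_proj_plane) (auto simp: Gamma_planes_eq)
    have "L = H \<inter> osc_plane w" if "L \<in> ?E" "L \<subseteq> osc_plane w" for L
      using that line by (intro vec.subspace_dim_equal) (auto simp: external_lines_eq proj_lines_def)
    moreover have "H \<inter> osc_plane w \<in> external_lines \<longleftrightarrow> w \<notin> cubic_pts H"
    proof -
      have "cubic_pts (H \<inter> osc_plane w) = cubic_pts H \<inter> {w}"
        using cubic_pts_osc_plane[OF w] by (auto simp: cubic_pts_def)
      then show ?thesis
        using line by (auto simp: external_lines_eq)
    qed
    ultimately have "{L \<in> ?E. L \<subseteq> osc_plane w} = (if w \<notin> cubic_pts H then {H \<inter> osc_plane w} else {})"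
      by auto
    then show "card {L \<in> ?E. L \<subseteq> osc_plane w} = of_bool (w \<notin> cubic_pts H)"
      by simp
  qed
  also have "\<dots> = card (P1 - cubic_pts H)"
    by (simp add: of_bool_def sum.If_cases Diff_eq Collect_neg_eq)
  finally have sum: "(\<Sum>L\<in>?E. card {w \<in> P1. L \<subseteq> osc_plane w}) = card (P1 - cubic_pts H)" .
  let ?EG = "{L \<in> EG_lines. L \<subseteq> H}" and ?R = "{L \<in> real_axes. L \<subseteq> H}"
  have "(\<Sum>L\<in>?E. card {w \<in> P1. L \<subseteq> osc_plane w}) = (\<Sum>L\<in>?EG \<union> ?R. card {w \<in> P1. L \<subseteq> osc_plane w})"
  proof (rule sum.mono_neutral_right)
    show "?EG \<union> ?R \<subseteq> ?E"
      using real_axis_external(1)[OF assms(1)] by (auto simp: EG_lines_eq)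
    show "\<forall>L\<in>?E - (?EG \<union> ?R). card {w \<in> P1. L \<subseteq> osc_plane w} = 0"
      by (auto simp: EG_lines_eq)
  qed simp
  also have "\<dots> = (\<Sum>L\<in>?EG. card {w \<in> P1. L \<subseteq> osc_plane w}) + (\<Sum>L\<in>?R. card {w \<in> P1. L \<subseteq> osc_plane w})"
    by (rule sum.union_disjoint) (auto simp: EG_lines_eq)
  also have "\<dots> = card ?EG + 2 * card ?R"
    using card_osc_planes_through_EG_line[OF assms(1)] card_osc_planes_through_real_axis[OF assms(1)] by simp
  finally have "card ?EG + 2 * card ?R = card (P1 - cubic_pts H)"
    using sum by simp
  moreover have "cubic_pts H \<subseteq> P1"
    by (auto simp: cubic_pts_def)
  then have "card (P1 - cubic_pts H) + card (cubic_pts H) = CARD('a) + 1"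
    using card_P1[where 'a = 'a] card_mono[OF finite, of "cubic_pts H" P1] by (simp add: card_Diff_subset)
  ultimately show ?thesis
    by simp
qed

text \<open>Osculating planes separate the first two classes from the other three; that chords and
  axes do not overlap is \<open>irr_chord_neq_axis\<close>.\<close>

lemma card_external_lines_split:
  fixes H :: "('a::finite_field ^ 4) set"
  assumes "(3 :: 'a) \<noteq> 0"
  shows "card {L \<in> external_lines. L \<subseteq> H} = card {L \<in> EG_lines. L \<subseteq> H} + card {L \<in> real_axes. L \<subseteq> H}
    + card {L \<in> EnG_lines. L \<subseteq> H} + card {L \<in> imaginary_chords. L \<subseteq> H} + card {L \<in> imaginary_axes. L \<subseteq> H}"
proof -
  have R: "L \<in> external_lines \<and> (\<exists>w\<in>P1. L \<subseteq> osc_plane w)" if "L \<in> real_axes" for L :: "('a ^ 4) set"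
    using real_axis_external[OF assms that] by blast
  have C: "L \<in> external_lines \<and> (\<forall>w\<in>P1. \<not> L \<subseteq> osc_plane w) \<and> L \<notin> imaginary_axes"
    if "L \<in> imaginary_chords" for L :: "('a ^ 4) set"
    using that irr_chord_external irr_chord_not_subset_osc_plane irr_chord_neq_axis[OF assms]
    unfolding imaginary_chords_eq imaginary_axes_eq[OF assms] by blast
  have A: "L \<in> external_lines \<and> (\<forall>w\<in>P1. \<not> L \<subseteq> osc_plane w)"
    if "L \<in> imaginary_axes" for L :: "('a ^ 4) set"
    using that irr_axis_external[OF assms] irr_axis_not_subset_osc_plane[OF assms]
    unfolding imaginary_axes_eq[OF assms] by blast
  let ?EG = "{L \<in> EG_lines. L \<subseteq> H}" and ?R = "{L \<in> real_axes. L \<subseteq> H}"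
    and ?EnG = "{L \<in> EnG_lines. L \<subseteq> H}" and ?C = "{L \<in> imaginary_chords. L \<subseteq> H}"
    and ?A = "{L \<in> imaginary_axes. L \<subseteq> H}"
  have "{L \<in> external_lines. L \<subseteq> H} = ?EG \<union> ?R \<union> ?EnG \<union> ?C \<union> ?A"
    using R C A unfolding EG_lines_eq EnG_lines_eq by blast
  moreover have "?EG \<inter> ?R = {}" "(?EG \<union> ?R) \<inter> ?EnG = {}" "(?EG \<union> ?R \<union> ?EnG) \<inter> ?C = {}"
    "(?EG \<union> ?R \<union> ?EnG \<union> ?C) \<inter> ?A = {}"
    using R C A unfolding EG_lines_eq EnG_lines_eq by blast+
  ultimately show ?thesis
    by (simp add: card_Un_disjoint)
qed

text \<open>An osculating plane has one point of the cubic and therefore q^2 external lines, of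
  which q are real axes.\<close>

lemma card_EG_lines_in_osc_plane:
  fixes v :: "'a::finite_field \<times> 'a"
  assumes "(3 :: 'a) \<noteq> 0" "CARD('a) \<ge> 3" "v \<in> P1"
  shows "int (card {L \<in> EG_lines. L \<subseteq> osc_plane v}) = int CARD('a) ^ 2 - int CARD('a)"
proof -
  have "{L \<in> external_lines. L \<subseteq> osc_plane v} = {L \<in> EG_lines. L \<subseteq> osc_plane v} \<union> {L \<in> real_axes. L \<subseteq> osc_plane v}"
    using real_axis_external(1)[OF assms(1)] assms(3) by (auto simp: EG_lines_eq)
  moreover have "{L \<in> EG_lines. L \<subseteq> osc_plane v} \<inter> {L \<in> real_axes. L \<subseteq> osc_plane v} = {}"
    by (auto simp: EG_lines_eq)
  ultimately have "card {L \<in> external_lines. L \<subseteq> osc_plane v} = card {L \<in> EG_lines. L \<subseteq> osc_plane v} + CARD('a)"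
    using card_real_axes_in_osc_plane[OF assms(1,3)] by (simp add: card_Un_disjoint)
  moreover have "int (card {L \<in> external_lines. L \<subseteq> osc_plane v}) = int CARD('a) ^ 2"
    using card_external_lines_in_plane[OF osc_plane_proj_plane[OF assms(3)] assms(2)]
    by (simp add: cubic_pts_osc_plane[OF assms(3)])
  ultimately show ?thesis
    by simp
qed

lemma card_EG_lines:
  assumes "(3 :: 'a::finite_field) \<noteq> 0" "CARD('a) \<ge> 3"
  shows "int (card (EG_lines :: ('a ^ 4) set set)) = int CARD('a) ^ 3 - int CARD('a)"
proof -
  have "(\<Sum>L\<in>EG_lines. card {w \<in> P1. L \<subseteq> osc_plane (w :: 'a \<times> 'a)})
      = (\<Sum>w\<in>P1. card {L \<in> EG_lines. L \<subseteq> osc_plane (w :: 'a \<times> 'a)})"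
    by (rule sum_card_swap) auto
  then have "card (EG_lines :: ('a ^ 4) set set) = (\<Sum>w\<in>P1. card {L \<in> EG_lines. L \<subseteq> osc_plane (w :: 'a \<times> 'a)})"
    using card_osc_planes_through_EG_line[OF assms(1)] by simp
  then have "int (card (EG_lines :: ('a ^ 4) set set))
      = (\<Sum>w\<in>P1. int (card {L \<in> EG_lines. L \<subseteq> osc_plane (w :: 'a \<times> 'a)}))"
    by simp
  also have "\<dots> = (int CARD('a) + 1) * (int CARD('a) ^ 2 - int CARD('a))"
    using card_EG_lines_in_osc_plane[OF assms] by (simp add: card_P1)
  finally show ?thesis
    by (simp add: algebra_simps power2_eq_square power3_eq_cube)
qed

lemma card_EG_lines_in_plane:
  fixes H :: "('a::finite_field ^ 4) set"
  assumes "(3 :: 'a) \<noteq> 0" "H \<in> nonosc_planes"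
  shows "int (card {L \<in> EG_lines. L \<subseteq> H})
    = int CARD('a) + 1 - int (card (cubic_pts H)) - 2 * of_bool (H \<in> split_planes)"
  using arg_cong[OF card_EG_lines_in_nonosc_plane[OF assms], of int]
  by (simp add: card_real_axes_in_nonosc_plane[OF assms])

lemma card_EnG_lines_in_plane:
  fixes H :: "('a::finite_field ^ 4) set"
  assumes "(3 :: 'a) \<noteq> 0" "CARD('a) \<ge> 3" "H \<in> nonosc_planes"
  shows "2 * int (card {L \<in> EnG_lines. L \<subseteq> H})
    = 2 * int CARD('a) ^ 2 - int (card (cubic_pts H)) * (2 * int CARD('a) + 1 - int (card (cubic_pts H)))
      + 2 * of_bool (H \<in> split_planes) - 2 * of_bool (H \<in> one_bar_planes) - 2 * of_bool (H \<in> irr_planes)"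
proof -
  have "int (card {L \<in> external_lines. L \<subseteq> H}) = int (card {L \<in> EG_lines. L \<subseteq> H}) + of_bool (H \<in> split_planes)
      + int (card {L \<in> EnG_lines. L \<subseteq> H}) + of_bool (H \<in> one_bar_planes) + of_bool (H \<in> irr_planes)"
    using arg_cong[OF card_external_lines_split[OF assms(1), of H], of int] assms
    by (simp add: card_real_axes_in_nonosc_plane card_imaginary_chords_in_plane card_imaginary_axes_in_plane)
  then show ?thesis
    using card_external_lines_in_plane[of H] card_EG_lines_in_plane[OF assms(1,3)] assms
    by (simp add: algebra_simps)
qed

text \<open>The split and the double planes are known from the comparison of cardinalities. The
  irreducible ones are found by exclusion among the non-osculating planes.\<close>

lemma planes_by_type:
  fixes H :: "('a::finite_field ^ 4) set"
  assumes "(3 :: 'a) \<noteq> 0" "CARD('a) \<ge> 3"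
  shows "H \<in> C_planes 2 \<Longrightarrow> H \<notin> split_planes \<and> H \<notin> irr_planes"
    and "CARD('a) mod 3 = 1 \<Longrightarrow> H \<in> C_planes 0 \<union> C_planes 3 \<Longrightarrow> H \<in> split_planes \<and> H \<notin> irr_planes"
    and "CARD('a) mod 3 = 1 \<Longrightarrow> H \<in> one_bar_planes \<Longrightarrow> H \<notin> split_planes \<and> H \<in> irr_planes"
    and "CARD('a) mod 3 = 2 \<Longrightarrow> H \<in> C_planes 0 \<union> C_planes 3 \<Longrightarrow> H \<notin> split_planes \<and> H \<in> irr_planes"
    and "CARD('a) mod 3 = 2 \<Longrightarrow> H \<in> one_bar_planes \<Longrightarrow> H \<in> split_planes \<and> H \<notin> irr_planes"
proof -
  have D: "H \<in> double_planes \<longleftrightarrow> H \<in> C_planes 2"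
    using double_planes_eq[OF assms] by simp
  have P: "H \<in> nonosc_planes \<longleftrightarrow> H \<in> C_planes 0 \<or> H \<in> one_bar_planes \<or> H \<in> C_planes 2 \<or> H \<in> C_planes 3"
    unfolding nonosc_planes_partition by blast
  have disj: "H \<in> C_planes 0 \<or> H \<in> C_planes 3 \<Longrightarrow> H \<notin> one_bar_planes \<and> H \<notin> C_planes 2"
    "H \<in> one_bar_planes \<Longrightarrow> H \<notin> C_planes 0 \<and> H \<notin> C_planes 2 \<and> H \<notin> C_planes 3"
    by (auto simp: one_bar_planes_def C_planes_eq)
  note S = nonosc_plane_cases[OF assms(1), of H] split_not_double[OF assms(1), of H]
    irr_not_pair[OF assms(1), of H]
  have S1: "H \<in> split_planes \<longleftrightarrow> H \<in> C_planes 0 \<or> H \<in> C_planes 3" if "CARD('a) mod 3 = 1"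
    unfolding split_planes_eq_1[OF assms that] by blast
  have S2: "H \<in> split_planes \<longleftrightarrow> H \<in> one_bar_planes" if "CARD('a) mod 3 = 2"
    unfolding split_planes_eq_2[OF assms that] ..
  show "H \<in> C_planes 2 \<Longrightarrow> H \<notin> split_planes \<and> H \<notin> irr_planes"
    using D S by argo
  show "CARD('a) mod 3 = 1 \<Longrightarrow> H \<in> C_planes 0 \<union> C_planes 3 \<Longrightarrow> H \<in> split_planes \<and> H \<notin> irr_planes"
    using S S1 unfolding Un_iff by argo
  show "CARD('a) mod 3 = 1 \<Longrightarrow> H \<in> one_bar_planes \<Longrightarrow> H \<notin> split_planes \<and> H \<in> irr_planes"
    using D P S S1 disj by argo
  show "CARD('a) mod 3 = 2 \<Longrightarrow> H \<in> C_planes 0 \<union> C_planes 3 \<Longrightarrow> H \<notin> split_planes \<and> H \<in> irr_planes"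
    using D P S S2 disj unfolding Un_iff by argo
  show "CARD('a) mod 3 = 2 \<Longrightarrow> H \<in> one_bar_planes \<Longrightarrow> H \<in> split_planes \<and> H \<notin> irr_planes"
    using S S2 by argo
qed

section \<open>From counts in planes to averages over lines\<close>

lemma nonempty_plane_types:
  assumes "CARD('a::finite_field) \<ge> 3"
  shows "C_planes 3 \<noteq> ({} :: ('a ^ 4) set set)" "one_bar_planes \<noteq> ({} :: ('a ^ 4) set set)"
    "C_planes 0 \<noteq> ({} :: ('a ^ 4) set set)"
proof -
  have "int CARD('a) ^ 3 - int CARD('a) = int CARD('a) * (int CARD('a) - 1) * (int CARD('a) + 1)"
    by (simp add: algebra_simps power3_eq_cube)
  then have "int CARD('a) ^ 3 - int CARD('a) \<noteq> 0"
    using assms by simp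
  then show "C_planes 3 \<noteq> ({} :: ('a ^ 4) set set)" "one_bar_planes \<noteq> ({} :: ('a ^ 4) set set)"
    "C_planes 0 \<noteq> ({} :: ('a ^ 4) set set)"
    using card_C_planes(1,4)[OF assms] card_one_bar_planes[OF assms] by force+
qed

text \<open>Double counting of incidences. If there are no lines, both sides are 0 by the convention
  for division by zero.\<close>

lemma Pi_avg_eq:
  fixes \<L> \<H> :: "('a::finite_field ^ 4) set set"
  assumes "Lambda_eq \<L> \<H> k"
  shows "Pi_avg \<H> \<L> = real (card \<H>) * real_of_int k / real (card \<L>)"
proof -
  have "(\<Sum>L\<in>\<L>. card {H \<in> \<H>. L \<subseteq> H}) = (\<Sum>H\<in>\<H>. card {L \<in> \<L>. L \<subseteq> H})"
    by (rule sum_card_swap) auto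
  then have "(\<Sum>L\<in>\<L>. real (card {H \<in> \<H>. L \<subseteq> H})) = (\<Sum>H\<in>\<H>. real (card {L \<in> \<L>. L \<subseteq> H}))"
    by (simp only: flip: of_nat_sum)
  also have "\<dots> = (\<Sum>H\<in>\<H>. real_of_int k)"
  proof (intro sum.cong refl)
    fix H assume "H \<in> \<H>"
    then have "real_of_int (int (card {L \<in> \<L>. L \<subseteq> H})) = real_of_int k"
      using assms by (simp add: Lambda_eq_def)
    then show "real (card {L \<in> \<L>. L \<subseteq> H}) = real_of_int k"
      by simp
  qed
  finally show ?thesis
    by (simp add: Pi_avg_def)
qed

text \<open>Translation by 1 permutes the field and thus leaves the sum of its elements
  unchanged.\<close>

lemma of_nat_card_finite_field: "of_nat CARD('a) = (0 :: 'a::finite_field)"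
proof -
  have "(\<Sum>x\<in>UNIV. x) = (\<Sum>x\<in>UNIV. x + (1 :: 'a))"
    by (rule sum.reindex_bij_witness[of _ "\<lambda>x. x + 1" "\<lambda>x. x - 1"]) auto
  then show ?thesis
    by (simp add: sum.distrib)
qed

text \<open>Otherwise 3 and q both vanish in the field, hence so does the remainder of q modulo 3,
  which is 1 or 2; with 3 = 0 either case gives 1 = 0.\<close>

lemma three_neq_0:
  assumes "CARD('a::finite_field) mod 3 \<noteq> 0"
  shows "(3 :: 'a) \<noteq> 0"
proof
  assume three: "(3 :: 'a) = 0"
  have "of_nat CARD('a) = of_nat (3 * (CARD('a) div 3) + CARD('a) mod 3)"
    by simp
  also have "\<dots> = 3 * of_nat (CARD('a) div 3) + (of_nat (CARD('a) mod 3) :: 'a)"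
    unfolding of_nat_add of_nat_mult by simp
  finally have "of_nat (CARD('a) mod 3) = (0 :: 'a)"
    using of_nat_card_finite_field[where 'a = 'a] three by simp
  moreover have "CARD('a) mod 3 = 1 \<or> CARD('a) mod 3 = 2"
    using assms by presburger
  ultimately have "(1 :: 'a) = 0 \<or> (2 :: 'a) = 0"
    by auto
  moreover have "(3 :: 'a) = 2 + 1"
    by simp
  ultimately show False
    using three by simp
qed

text \<open>Every line lies in \<open>q + 1\<close> planes, and no \<open>\<Gamma>\<close>-plane contains an En\<open>\<Gamma>\<close>-line.\<close>

lemma card_EnG_lines:
  assumes "CARD('a::finite_field) \<ge> 3"
    and k: "Lambda_eq (EnG_lines :: ('a ^ 4) set set) (C_planes 0) k0"
      "Lambda_eq (EnG_lines :: ('a ^ 4) set set) one_bar_planes k1"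
      "Lambda_eq (EnG_lines :: ('a ^ 4) set set) (C_planes 2) k2"
      "Lambda_eq (EnG_lines :: ('a ^ 4) set set) (C_planes 3) k3"
  shows "6 * int (card (EnG_lines :: ('a ^ 4) set set)) * (int CARD('a) + 1) =
    (int CARD('a) ^ 3 - int CARD('a)) * (2 * k0 + 3 * k1 + k3) + 6 * (int CARD('a) ^ 2 + int CARD('a)) * k2"
proof -
  let ?f = "\<lambda>H :: ('a ^ 4) set. int (card {L \<in> EnG_lines. L \<subseteq> H})"
  have lam: "sum ?f \<H> = int (card \<H>) * k" if "Lambda_eq EnG_lines \<H> k" for \<H> k
    using that by (simp add: Lambda_eq_def)
  have "(\<Sum>L\<in>EnG_lines. card {H \<in> proj_planes. L \<subseteq> (H :: ('a ^ 4) set)})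
      = (\<Sum>H\<in>proj_planes. card {L \<in> EnG_lines. L \<subseteq> (H :: ('a ^ 4) set)})"
    by (rule sum_card_swap) auto
  moreover have "card {H \<in> proj_planes. L \<subseteq> H} = CARD('a) + 1" if "L \<in> EnG_lines" for L :: "('a ^ 4) set"
    using that by (intro card_planes_through_line) (simp add: EnG_lines_def external_lines_def)
  ultimately have "card (EnG_lines :: ('a ^ 4) set set) * (CARD('a) + 1)
      = (\<Sum>H\<in>proj_planes. card {L \<in> EnG_lines. L \<subseteq> (H :: ('a ^ 4) set)})"
    by simp
  then have "int (card (EnG_lines :: ('a ^ 4) set set)) * (int CARD('a) + 1) = sum ?f proj_planes"
    by (metis (mono_tags, lifting) of_nat_1 of_nat_add of_nat_mult of_nat_sum sum.cong)
  also have "\<dots> = sum ?f nonosc_planes"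
  proof (rule sum.mono_neutral_right)
    show "\<forall>H\<in>proj_planes - nonosc_planes. ?f H = 0"
      by (auto simp: EnG_lines_def)
  qed auto
  also have "\<dots> = sum ?f (C_planes 0 \<union> one_bar_planes \<union> C_planes 2) + sum ?f (C_planes 3)"
    unfolding nonosc_planes_partition
    by (rule sum.union_disjoint) (auto simp: one_bar_planes_def C_planes_eq)
  also have "sum ?f (C_planes 0 \<union> one_bar_planes \<union> C_planes 2) = sum ?f (C_planes 0 \<union> one_bar_planes) + sum ?f (C_planes 2)"
    by (rule sum.union_disjoint) (auto simp: one_bar_planes_def C_planes_eq)
  also have "sum ?f (C_planes 0 \<union> one_bar_planes) = sum ?f (C_planes 0) + sum ?f one_bar_planes"
    by (rule sum.union_disjoint) (auto simp: one_bar_planes_def C_planes_eq)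
  \<comment> \<open>The factor 6 clears the denominators in the numbers of planes of the four
    types.\<close>
  finally have "6 * int (card (EnG_lines :: ('a ^ 4) set set)) * (int CARD('a) + 1)
      = 2 * (3 * int (card (C_planes 0 :: ('a ^ 4) set set))) * k0
        + 3 * (2 * int (card (one_bar_planes :: ('a ^ 4) set set))) * k1
        + 6 * int (card (C_planes 2 :: ('a ^ 4) set set)) * k2
        + 6 * int (card (C_planes 3 :: ('a ^ 4) set set)) * k3"
    by (simp add: lam[OF k(1)] lam[OF k(2)] lam[OF k(3)] lam[OF k(4)] algebra_simps)
  then show ?thesis
    unfolding card_C_planes[OF assms(1)] card_one_bar_planes[OF assms(1)] by (simp add: algebra_simps)
qed

lemma Lambda_eq_EG:
  fixes \<H> :: "('a::finite_field ^ 4) set set"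
  assumes "(3 :: 'a) \<noteq> 0" "\<H> \<noteq> {}" "\<H> \<subseteq> nonosc_planes"
    and "\<And>H. H \<in> \<H> \<Longrightarrow> card (cubic_pts H) = n" "\<And>H. H \<in> \<H> \<Longrightarrow> H \<in> split_planes \<longleftrightarrow> s"
    and "k = int CARD('a) + 1 - int n - 2 * of_bool s"
  shows "Lambda_eq EG_lines \<H> k"
  using assms card_EG_lines_in_plane[OF assms(1)] by (auto simp: Lambda_eq_def)

lemma Lambda_eq_EnG:
  fixes \<H> :: "('a::finite_field ^ 4) set set"
  assumes "(3 :: 'a) \<noteq> 0" "CARD('a) \<ge> 3" "\<H> \<noteq> {}" "\<H> \<subseteq> nonosc_planes"
    and "\<And>H. H \<in> \<H> \<Longrightarrow> card (cubic_pts H) = n" "\<And>H. H \<in> \<H> \<Longrightarrow> H \<in> split_planes \<longleftrightarrow> s"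
      "\<And>H. H \<in> \<H> \<Longrightarrow> H \<in> irr_planes \<longleftrightarrow> i" "\<And>H. H \<in> \<H> \<Longrightarrow> H \<in> one_bar_planes \<longleftrightarrow> b"
    and "2 * k = 2 * int CARD('a) ^ 2 - int n * (2 * int CARD('a) + 1 - int n)
      + 2 * of_bool s - 2 * of_bool b - 2 * of_bool i"
  shows "Lambda_eq EnG_lines \<H> k"
proof -
  have "2 * int (card {L \<in> EnG_lines. L \<subseteq> H}) = 2 * k" if "H \<in> \<H>" for H
  proof -
    have "H \<in> nonosc_planes"
      using that assms(4) by blast
    then show ?thesis
      unfolding card_EnG_lines_in_plane[OF assms(1,2) \<open>H \<in> nonosc_planes\<close>] assms(9)
      using that assms(5-8) by simp
  qed
  then show ?thesis
    using assms(3) by (simp add: Lambda_eq_def)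
qed

text \<open>The three types of planes number q^3 - q divided by 6, 2 and 3, so q^3 - q cancels from
  the averages. \<open>d\<close> will be 1 for E-Gamma lines and q - 1 for En-Gamma lines.\<close>

lemma Pi_avg_values:
  fixes \<L> :: "('a::finite_field ^ 4) set set"
  assumes "CARD('a) \<ge> 3"
    and "real (card \<L>) = (real CARD('a) ^ 3 - real CARD('a)) * d" "d \<noteq> 0"
  shows "Lambda_eq \<L> (C_planes 3) k \<Longrightarrow> Pi_avg (C_planes 3) \<L> = real_of_int k / (6 * d)"
    and "Lambda_eq \<L> one_bar_planes k \<Longrightarrow> Pi_avg one_bar_planes \<L> = real_of_int k / (2 * d)"
    and "Lambda_eq \<L> (C_planes 0) k \<Longrightarrow> Pi_avg (C_planes 0) \<L> = real_of_int k / (3 * d)"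
proof -
  let ?q = "real CARD('a)"
  have "?q ^ 3 - ?q = ?q * (?q - 1) * (?q + 1)"
    by (simp add: algebra_simps power3_eq_cube)
  then have nz: "?q ^ 3 - ?q \<noteq> 0"
    using assms(1) by simp
  have card: "6 * real (card (C_planes 3 :: ('a ^ 4) set set)) = ?q ^ 3 - ?q"
    "2 * real (card (one_bar_planes :: ('a ^ 4) set set)) = ?q ^ 3 - ?q"
    "3 * real (card (C_planes 0 :: ('a ^ 4) set set)) = ?q ^ 3 - ?q"
    using arg_cong[OF card_C_planes(1)[OF assms(1)], of real_of_int]
      arg_cong[OF card_one_bar_planes[OF assms(1)], of real_of_int]
      arg_cong[OF card_C_planes(4)[OF assms(1)], of real_of_int] by simp_all
  have avg: "Pi_avg \<H> \<L> = real_of_int k / (m * d)"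
    if "Lambda_eq \<L> \<H> k" "m * real (card \<H>) = ?q ^ 3 - ?q" for \<H> m
  proof -
    have "m \<noteq> 0" "real (card \<H>) \<noteq> 0"
      using that(2) nz by auto
    then show ?thesis
      unfolding Pi_avg_eq[OF that(1)] assms(2) that(2)[symmetric] using assms(3) by (simp add: field_simps)
  qed
  show "Lambda_eq \<L> (C_planes 3) k \<Longrightarrow> Pi_avg (C_planes 3) \<L> = real_of_int k / (6 * d)"
    and "Lambda_eq \<L> one_bar_planes k \<Longrightarrow> Pi_avg one_bar_planes \<L> = real_of_int k / (2 * d)"
    and "Lambda_eq \<L> (C_planes 0) k \<Longrightarrow> Pi_avg (C_planes 0) \<L> = real_of_int k / (3 * d)"
    using avg card by blast+
qed

lemma C_planes_nonosc:
  "C_planes 0 \<subseteq> (nonosc_planes :: ('a::finite_field ^ 4) set set)"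
  "one_bar_planes \<subseteq> (nonosc_planes :: ('a ^ 4) set set)"
  "C_planes 2 \<subseteq> (nonosc_planes :: ('a ^ 4) set set)"
  "C_planes 3 \<subseteq> (nonosc_planes :: ('a ^ 4) set set)"
  unfolding nonosc_planes_partition by blast+

lemma C_planes_cubic_pts:
  fixes H :: "('a::finite_field ^ 4) set"
  shows "H \<in> C_planes d \<Longrightarrow> card (cubic_pts H) = d"
    and "H \<in> one_bar_planes \<Longrightarrow> card (cubic_pts H) = 1"
    and "H \<in> C_planes 0 \<Longrightarrow> H \<notin> one_bar_planes"
    and "H \<in> C_planes 2 \<Longrightarrow> H \<notin> one_bar_planes"
    and "H \<in> C_planes 3 \<Longrightarrow> H \<notin> one_bar_planes"
  by (auto simp: C_planes_eq one_bar_planes_def)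

text \<open>Planes with two points also contain En-Gamma lines, so they enter the total number of
  such lines, over which the averages are taken.\<close>

lemma Lambda_eq_EnG_C_planes_2:
  assumes "(3 :: 'a::finite_field) \<noteq> 0" "CARD('a) \<ge> 3"
  shows "Lambda_eq (EnG_lines :: ('a ^ 4) set set) (C_planes 2) ((int CARD('a) - 1) ^ 2)"
proof (rule Lambda_eq_EnG[where s = False and i = False and b = False,
      OF assms _ C_planes_nonosc(3) C_planes_cubic_pts(1)])
  show "C_planes 2 \<noteq> ({} :: ('a ^ 4) set set)"
  proof
    assume "C_planes 2 = ({} :: ('a ^ 4) set set)"
    then have "int CARD('a) ^ 2 + int CARD('a) = 0"
      using card_C_planes(2)[OF assms(2)] by simp
    moreover have "int CARD('a) ^ 2 \<ge> 0" "int CARD('a) > 0"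
      using assms(2) by simp_all
    ultimately show False
      by linarith
  qed
qed (use planes_by_type(1)[OF assms] C_planes_cubic_pts(4) in \<open>auto simp: algebra_simps power2_eq_square\<close>)

lemma Pi_avg_EG_values:
  fixes k :: int
  assumes "(3 :: 'a::finite_field) \<noteq> 0" "CARD('a) \<ge> 3"
  shows "Lambda_eq (EG_lines :: ('a ^ 4) set set) (C_planes 3) k \<Longrightarrow>
      Pi_avg (C_planes 3) (EG_lines :: ('a ^ 4) set set) = real_of_int k / 6"
    and "Lambda_eq (EG_lines :: ('a ^ 4) set set) one_bar_planes k \<Longrightarrow>
      Pi_avg one_bar_planes (EG_lines :: ('a ^ 4) set set) = real_of_int k / 2"
    and "Lambda_eq (EG_lines :: ('a ^ 4) set set) (C_planes 0) k \<Longrightarrow>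
      Pi_avg (C_planes 0) (EG_lines :: ('a ^ 4) set set) = real_of_int k / 3"
proof -
  have card: "real (card (EG_lines :: ('a ^ 4) set set)) = (real CARD('a) ^ 3 - real CARD('a)) * 1"
    using arg_cong[OF card_EG_lines[OF assms], of real_of_int] by simp
  note vals = Pi_avg_values[OF assms(2) card one_neq_zero, of k]
  show "Lambda_eq (EG_lines :: ('a ^ 4) set set) (C_planes 3) k \<Longrightarrow>
      Pi_avg (C_planes 3) (EG_lines :: ('a ^ 4) set set) = real_of_int k / 6"
    and "Lambda_eq (EG_lines :: ('a ^ 4) set set) one_bar_planes k \<Longrightarrow>
      Pi_avg one_bar_planes (EG_lines :: ('a ^ 4) set set) = real_of_int k / 2"
    and "Lambda_eq (EG_lines :: ('a ^ 4) set set) (C_planes 0) k \<Longrightarrow>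
      Pi_avg (C_planes 0) (EG_lines :: ('a ^ 4) set set) = real_of_int k / 3"
    using vals by simp_all
qed

text \<open>The weighted sum of the three counts has the same value in both residue classes; it
  yields (q^3 - q)(q - 1) as the number of En-Gamma lines.\<close>

lemma Pi_avg_EnG_values:
  assumes "(3 :: 'a::finite_field) \<noteq> 0" "CARD('a) \<ge> 3"
    and lam: "Lambda_eq (EnG_lines :: ('a ^ 4) set set) (C_planes 0) k0"
      "Lambda_eq (EnG_lines :: ('a ^ 4) set set) one_bar_planes k1"
      "Lambda_eq (EnG_lines :: ('a ^ 4) set set) (C_planes 3) k3"
    and k: "2 * k0 + 3 * k1 + k3 = 6 * (int CARD('a) ^ 2 - int CARD('a))"
  shows "Pi_avg (C_planes 3) (EnG_lines :: ('a ^ 4) set set) = real_of_int k3 / (6 * (real CARD('a) - 1))"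
    and "Pi_avg one_bar_planes (EnG_lines :: ('a ^ 4) set set) = real_of_int k1 / (2 * (real CARD('a) - 1))"
    and "Pi_avg (C_planes 0) (EnG_lines :: ('a ^ 4) set set) = real_of_int k0 / (3 * (real CARD('a) - 1))"
proof -
  let ?q = "int CARD('a)"
  have "6 * int (card (EnG_lines :: ('a ^ 4) set set)) * (?q + 1)
      = (?q ^ 3 - ?q) * (2 * k0 + 3 * k1 + k3) + 6 * (?q ^ 2 + ?q) * (?q - 1) ^ 2"
    using card_EnG_lines[OF assms(2) lam(1,2) Lambda_eq_EnG_C_planes_2[OF assms(1,2)] lam(3)] .
  also have "\<dots> = 6 * ((?q ^ 3 - ?q) * (?q - 1)) * (?q + 1)"
    unfolding k by (simp add: algebra_simps power2_eq_square power3_eq_cube)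
  finally have "int (card (EnG_lines :: ('a ^ 4) set set)) = (?q ^ 3 - ?q) * (?q - 1)"
    by simp
  then have "real_of_int (int (card (EnG_lines :: ('a ^ 4) set set))) = real_of_int ((?q ^ 3 - ?q) * (?q - 1))"
    by (simp only:)
  then have card: "real (card (EnG_lines :: ('a ^ 4) set set)) = (real CARD('a) ^ 3 - real CARD('a)) * (real CARD('a) - 1)"
    by simp
  have "real CARD('a) - 1 \<noteq> 0"
    using assms(2) by simp
  note vals = Pi_avg_values[OF assms(2) card this]
  show "Pi_avg (C_planes 3) (EnG_lines :: ('a ^ 4) set set) = real_of_int k3 / (6 * (real CARD('a) - 1))"
    by (rule vals(1)[OF lam(3)])
  show "Pi_avg one_bar_planes (EnG_lines :: ('a ^ 4) set set) = real_of_int k1 / (2 * (real CARD('a) - 1))"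
    by (rule vals(2)[OF lam(2)])
  show "Pi_avg (C_planes 0) (EnG_lines :: ('a ^ 4) set set) = real_of_int k0 / (3 * (real CARD('a) - 1))"
    by (rule vals(3)[OF lam(1)])
qed

lemma Lambda_eq_EG_1:
  assumes "(3 :: 'a::finite_field) \<noteq> 0" "CARD('a) \<ge> 3" "CARD('a) mod 3 = 1"
  shows "Lambda_eq (EG_lines :: ('a ^ 4) set set) (C_planes 3) (int CARD('a) - 4)"
    and "Lambda_eq (EG_lines :: ('a ^ 4) set set) one_bar_planes (int CARD('a))"
    and "Lambda_eq (EG_lines :: ('a ^ 4) set set) (C_planes 0) (int CARD('a) - 1)"
proof -
  note t = planes_by_type(2,3)[OF assms]
  note ne = nonempty_plane_types[OF assms(2)]
  show "Lambda_eq (EG_lines :: ('a ^ 4) set set) (C_planes 3) (int CARD('a) - 4)"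
    by (rule Lambda_eq_EG[where s = True, OF assms(1) ne(1) C_planes_nonosc(4) C_planes_cubic_pts(1)])
      (use t in auto)
  show "Lambda_eq (EG_lines :: ('a ^ 4) set set) one_bar_planes (int CARD('a))"
    by (rule Lambda_eq_EG[where s = False, OF assms(1) ne(2) C_planes_nonosc(2) C_planes_cubic_pts(2)])
      (use t in auto)
  show "Lambda_eq (EG_lines :: ('a ^ 4) set set) (C_planes 0) (int CARD('a) - 1)"
    by (rule Lambda_eq_EG[where s = True, OF assms(1) ne(3) C_planes_nonosc(1) C_planes_cubic_pts(1)])
      (use t in auto)
qed

lemma Lambda_eq_EnG_1:
  assumes "(3 :: 'a::finite_field) \<noteq> 0" "CARD('a) \<ge> 3" "CARD('a) mod 3 = 1"
  shows "Lambda_eq (EnG_lines :: ('a ^ 4) set set) (C_planes 3) (int CARD('a)^2 - 3 * int CARD('a) + 4)"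
    and "Lambda_eq (EnG_lines :: ('a ^ 4) set set) one_bar_planes (int CARD('a)^2 - int CARD('a) - 2)"
    and "Lambda_eq (EnG_lines :: ('a ^ 4) set set) (C_planes 0) (int CARD('a)^2 + 1)"
proof -
  note t = planes_by_type(2,3)[OF assms]
  note ne = nonempty_plane_types[OF assms(2)]
  show "Lambda_eq (EnG_lines :: ('a ^ 4) set set) (C_planes 3) (int CARD('a)^2 - 3 * int CARD('a) + 4)"
    by (rule Lambda_eq_EnG[where s = True and i = False and b = False,
          OF assms(1,2) ne(1) C_planes_nonosc(4) C_planes_cubic_pts(1)])
      (use t C_planes_cubic_pts(5) in \<open>auto simp: algebra_simps power2_eq_square\<close>)
  show "Lambda_eq (EnG_lines :: ('a ^ 4) set set) one_bar_planes (int CARD('a)^2 - int CARD('a) - 2)"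
    by (rule Lambda_eq_EnG[where s = False and i = True and b = True,
          OF assms(1,2) ne(2) C_planes_nonosc(2) C_planes_cubic_pts(2)])
      (use t in \<open>auto simp: algebra_simps power2_eq_square\<close>)
  show "Lambda_eq (EnG_lines :: ('a ^ 4) set set) (C_planes 0) (int CARD('a)^2 + 1)"
    by (rule Lambda_eq_EnG[where s = True and i = False and b = False,
          OF assms(1,2) ne(3) C_planes_nonosc(1) C_planes_cubic_pts(1)])
      (use t C_planes_cubic_pts(3) in \<open>auto simp: algebra_simps power2_eq_square\<close>)
qed

lemma Lambda_eq_EG_2:
  assumes "(3 :: 'a::finite_field) \<noteq> 0" "CARD('a) \<ge> 3" "CARD('a) mod 3 = 2"
  shows "Lambda_eq (EG_lines :: ('a ^ 4) set set) (C_planes 3) (int CARD('a) - 2)"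
    and "Lambda_eq (EG_lines :: ('a ^ 4) set set) one_bar_planes (int CARD('a) - 2)"
    and "Lambda_eq (EG_lines :: ('a ^ 4) set set) (C_planes 0) (int CARD('a) + 1)"
proof -
  note t = planes_by_type(4,5)[OF assms]
  note ne = nonempty_plane_types[OF assms(2)]
  show "Lambda_eq (EG_lines :: ('a ^ 4) set set) (C_planes 3) (int CARD('a) - 2)"
    by (rule Lambda_eq_EG[where s = False, OF assms(1) ne(1) C_planes_nonosc(4) C_planes_cubic_pts(1)])
      (use t in auto)
  show "Lambda_eq (EG_lines :: ('a ^ 4) set set) one_bar_planes (int CARD('a) - 2)"
    by (rule Lambda_eq_EG[where s = True, OF assms(1) ne(2) C_planes_nonosc(2) C_planes_cubic_pts(2)])
      (use t in auto)
  show "Lambda_eq (EG_lines :: ('a ^ 4) set set) (C_planes 0) (int CARD('a) + 1)"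
    by (rule Lambda_eq_EG[where s = False, OF assms(1) ne(3) C_planes_nonosc(1) C_planes_cubic_pts(1)])
      (use t in auto)
qed

lemma Lambda_eq_EnG_2:
  assumes "(3 :: 'a::finite_field) \<noteq> 0" "CARD('a) \<ge> 3" "CARD('a) mod 3 = 2"
  shows "Lambda_eq (EnG_lines :: ('a ^ 4) set set) (C_planes 3) ((int CARD('a) - 1) * (int CARD('a) - 2))"
    and "Lambda_eq (EnG_lines :: ('a ^ 4) set set) one_bar_planes (int CARD('a)^2 - int CARD('a))"
    and "Lambda_eq (EnG_lines :: ('a ^ 4) set set) (C_planes 0) (int CARD('a)^2 - 1)"
proof -
  note t = planes_by_type(4,5)[OF assms]
  note ne = nonempty_plane_types[OF assms(2)]
  show "Lambda_eq (EnG_lines :: ('a ^ 4) set set) (C_planes 3) ((int CARD('a) - 1) * (int CARD('a) - 2))"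
    by (rule Lambda_eq_EnG[where s = False and i = True and b = False,
          OF assms(1,2) ne(1) C_planes_nonosc(4) C_planes_cubic_pts(1)])
      (use t C_planes_cubic_pts(5) in \<open>auto simp: algebra_simps power2_eq_square\<close>)
  show "Lambda_eq (EnG_lines :: ('a ^ 4) set set) one_bar_planes (int CARD('a)^2 - int CARD('a))"
    by (rule Lambda_eq_EnG[where s = True and i = False and b = True,
          OF assms(1,2) ne(2) C_planes_nonosc(2) C_planes_cubic_pts(2)])
      (use t in \<open>auto simp: algebra_simps power2_eq_square\<close>)
  show "Lambda_eq (EnG_lines :: ('a ^ 4) set set) (C_planes 0) (int CARD('a)^2 - 1)"
    by (rule Lambda_eq_EnG[where s = False and i = True and b = False,
          OF assms(1,2) ne(3) C_planes_nonosc(1) C_planes_cubic_pts(1)])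
      (use t C_planes_cubic_pts(3) in \<open>auto simp: algebra_simps power2_eq_square\<close>)
qed

theorem theorem5p10:
  fixes q :: nat
  assumes "CARD('a::finite_field) = q" and "q \<ge> 5" and "\<not> [int q = 0] (mod 3)"
  shows
    "([int q = 1] (mod 3) \<longrightarrow>
      Lambda_eq (EG_lines :: ('a ^ 4) set set) (C_planes 3) (int q - 4) \<and>
      Lambda_eq (EG_lines :: ('a ^ 4) set set) one_bar_planes (int q) \<and>
      Lambda_eq (EG_lines :: ('a ^ 4) set set) (C_planes 0) (int q - 1) \<and>
      Pi_avg (C_planes 3) (EG_lines :: ('a ^ 4) set set) = (real q - 4) / 6 \<and>
      Pi_avg one_bar_planes (EG_lines :: ('a ^ 4) set set) = real q / 2 \<and>
      Pi_avg (C_planes 0) (EG_lines :: ('a ^ 4) set set) = (real q - 1) / 3 \<and>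
      Lambda_eq (EnG_lines :: ('a ^ 4) set set) (C_planes 3) ((int q)^2 - 3 * int q + 4) \<and>
      Lambda_eq (EnG_lines :: ('a ^ 4) set set) one_bar_planes ((int q)^2 - int q - 2) \<and>
      Lambda_eq (EnG_lines :: ('a ^ 4) set set) (C_planes 0) ((int q)^2 + 1) \<and>
      Pi_avg (C_planes 3) (EnG_lines :: ('a ^ 4) set set) = ((real q)^2 - 3 * real q + 4) / (6 * (real q - 1)) \<and>
      Pi_avg one_bar_planes (EnG_lines :: ('a ^ 4) set set) = ((real q)^2 - real q - 2) / (2 * (real q - 1)) \<and>
      Pi_avg (C_planes 0) (EnG_lines :: ('a ^ 4) set set) = ((real q)^2 + 1) / (3 * (real q - 1))) \<and>
     ([int q = - 1] (mod 3) \<longrightarrow>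
      Lambda_eq (EG_lines :: ('a ^ 4) set set) (C_planes 3) (int q - 2) \<and>
      Lambda_eq (EG_lines :: ('a ^ 4) set set) one_bar_planes (int q - 2) \<and>
      Lambda_eq (EG_lines :: ('a ^ 4) set set) (C_planes 0) (int q + 1) \<and>
      Pi_avg (C_planes 3) (EG_lines :: ('a ^ 4) set set) = (real q - 2) / 6 \<and>
      Pi_avg one_bar_planes (EG_lines :: ('a ^ 4) set set) = (real q - 2) / 2 \<and>
      Pi_avg (C_planes 0) (EG_lines :: ('a ^ 4) set set) = (real q + 1) / 3 \<and>
      Lambda_eq (EnG_lines :: ('a ^ 4) set set) (C_planes 3) ((int q - 1) * (int q - 2)) \<and>
      Lambda_eq (EnG_lines :: ('a ^ 4) set set) one_bar_planes ((int q)^2 - int q) \<and>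
      Lambda_eq (EnG_lines :: ('a ^ 4) set set) (C_planes 0) ((int q)^2 - 1) \<and>
      Pi_avg (C_planes 3) (EnG_lines :: ('a ^ 4) set set) = (real q - 2) / 6 \<and>
      Pi_avg one_bar_planes (EnG_lines :: ('a ^ 4) set set) = real q / 2 \<and>
      Pi_avg (C_planes 0) (EnG_lines :: ('a ^ 4) set set) = (real q + 1) / 3)"
proof -
  have q: "CARD('a) \<ge> 3"
    using assms by simp
  have mod3: "q mod 3 \<noteq> 0" "[int q = 1] (mod 3) \<longleftrightarrow> q mod 3 = 1" "[int q = - 1] (mod 3) \<longleftrightarrow> q mod 3 = 2"
  proof -
    have "int q mod 3 = int (q mod 3)"
      by (simp add: zmod_int)
    then show "q mod 3 \<noteq> 0" "[int q = 1] (mod 3) \<longleftrightarrow> q mod 3 = 1" "[int q = - 1] (mod 3) \<longleftrightarrow> q mod 3 = 2"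
      using assms(3) by (simp_all add: cong_def)
  qed
  have three: "(3 :: 'a) \<noteq> 0"
    using three_neq_0 mod3(1) assms(1) by blast
  \<comment> \<open>Each case proves the whole conjunction; the implication for the other residue is
    vacuous.\<close>
  have case1: ?thesis if "q mod 3 = 1"
  proof -
    have m: "CARD('a) mod 3 = 1"
      using that assms(1) by simp
    note EG = Lambda_eq_EG_1[OF three q m]
    note EnG = Lambda_eq_EnG_1[OF three q m]
    have "2 * ((int CARD('a))^2 + 1) + 3 * ((int CARD('a))^2 - int CARD('a) - 2) + ((int CARD('a))^2 - 3 * int CARD('a) + 4)
        = 6 * (int CARD('a) ^ 2 - int CARD('a))"
      by simp
    note Pi_EnG = Pi_avg_EnG_values[OF three q EnG(3,2,1) this]
    note Pi_EG = Pi_avg_EG_values(1)[OF three q EG(1)] Pi_avg_EG_values(2)[OF three q EG(2)]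
      Pi_avg_EG_values(3)[OF three q EG(3)]
    show ?thesis
      using that mod3 EG EnG Pi_EG Pi_EnG unfolding assms(1) by simp
  qed
  have case2: ?thesis if "q mod 3 = 2"
  proof -
    have m: "CARD('a) mod 3 = 2"
      using that assms(1) by simp
    note EG = Lambda_eq_EG_2[OF three q m]
    note EnG = Lambda_eq_EnG_2[OF three q m]
    have "2 * ((int CARD('a))^2 - 1) + 3 * ((int CARD('a))^2 - int CARD('a)) + (int CARD('a) - 1) * (int CARD('a) - 2)
        = 6 * (int CARD('a) ^ 2 - int CARD('a))"
      by (simp add: algebra_simps power2_eq_square)
    note Pi_EnG = Pi_avg_EnG_values[OF three q EnG(3,2,1) this, unfolded assms(1)]
    note Pi_EG = Pi_avg_EG_values(1)[OF three q EG(1)] Pi_avg_EG_values(2)[OF three q EG(2)]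
      Pi_avg_EG_values(3)[OF three q EG(3)]
    \<comment> \<open>For this residue all three counts are divisible by q - 1, which cancels
      against the number of lines.\<close>
    have frac: "real_of_int ((int q - 1) * (int q - 2)) / (6 * (real q - 1)) = (real q - 2) / 6"
      "real_of_int (int q ^ 2 - int q) / (2 * (real q - 1)) = real q / 2"
      "real_of_int (int q ^ 2 - 1) / (3 * (real q - 1)) = (real q + 1) / 3"
      using assms(2) by (simp_all add: field_simps power2_eq_square)
    show ?thesis
      using that mod3 EG EnG Pi_EG Pi_EnG[unfolded frac] unfolding assms(1) by simp
  qed
  consider "q mod 3 = 1" | "q mod 3 = 2"
    using mod3(1) by linarith
  then show ?thesis
    by cases (fact case1, fact case2)
qed

end
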